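(* Let $R$ be a non-zero ring with identity (not necessarily commutative), let $n\ge1$, and let $f(Z)=Z^n-a_1Z^{n-1}+\cdots+(-1)^{n-1}a_{n-1}Z+(-1)^na_n\in R[Z]$ with $a_1,\dots,a_n$ central in $R$. Then there exist matrices $A_1,\dots,A_n\in M_{n!}(R)$ such that: (i) $A_1,\dots,A_n$ commute with each other and with every element of $R$; (ii) $\sigma_i(A_1,\dots,A_n)=a_i$ for all $1\le i\le n$, where $\sigma_1,\dots,\sigma_n$ are the elementary symmetric polynomials; (iii) the matrices $A_1^{\alpha_1}\cdots A_n^{\alpha_n}$, $0\le\alpha_i\le n-i$, are $R$-linearly independent; (iv) every non-zero entry of $A_1,\dots,A_n$ is equal, up to a sign, to a coefficient of $f$. It follows that the subring $R[A_1,\dots,A_n]$ of $M_{n!}(R)$ is a universal splitting ring for $f$, i.e. the ring homomorphism $R[X_1,\dots,X_n]\to M_{n!}(R)$ extending $R\to M_{n!}(R)$ and sending $X_i\mapsto A_i$ has image $R[A_1,\dots,A_n]$ and kernel the two-sided ideal $I_f$ generated by $\sigma_1-a_1,\dots,\sigma_n-a_n$, and $f(Z)=(Z-A_1)\cdots(Z-A_n)$ in $R[A_1,\dots,A_n][Z]$. In the special case when $R=F$ is a field and $f$ is an irreducible and separable polynomial in $F[Z]$ with Galois group $S_n$, the ring $F[A_1,\dots,A_n]$ is (isomorphic over $F$ to) the splitting field of $f$ over $F$.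
   Context: In polynomial rings the variables commute with each other and with the coefficients. $R$ is regarded as a subring of $M_{n!}(R)$ by identifying $x\in R$ with the scalar matrix having $x$ in every diagonal entry; $R[A_1,\dots,A_n]$ is the subring generated by $R$ and $A_1,\dots,A_n$. The coefficients of $f$ include the leading coefficient $1$. The linear independence in (iii) is for the family indexed by the tuples $(\alpha_1,\dots,\alpha_n)$. *)

theory Defs
  imports
    "Jordan_Normal_Form.Matrix"
    "HOL-Library.Poly_Mapping"
    "HOL-Algebra.UnivPoly"
    "HOL-Algebra.Generated_Fields"
    "HOL-Algebra.Ring_Divisibility"
    "HOL-Algebra.Bij"
    "HOL-Algebra.Sym_Groups"
    "HOL-Algebra.Algebraic_Closure_Type"
begin

text \<open>
  The non-zero ring with identity R is a type of class \<open>ring_1\<close> (which includes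
  \<open>0 \<noteq> 1\<close> and is not commutative). It is turned into a HOL-Algebra ring, because the
  matrix ring, its subrings and univariate polynomials over those have no type of their own.
\<close>

abbreviation base_ring :: "'a::ring_1 ring" where
  "base_ring \<equiv> ring_of_type_algebra"

text \<open>Ordered product \<open>x\<^sub>1 \<cdots> x\<^sub>n\<close>; \<^const>\<open>finprod\<close> is
  only meant for commutative monoids.\<close>

definition ordered_prod :: "('b, 'm) monoid_scheme \<Rightarrow> nat \<Rightarrow> (nat \<Rightarrow> 'b) \<Rightarrow> 'b" where
  "ordered_prod G n x = foldr (mult G) (map x [1..<Suc n]) \<one>\<^bsub>G\<^esub>"

text \<open>\<open>\<sigma>\<^sub>k(x\<^sub>1, \<dots>, x\<^sub>n)\<close> in a possibly non-commutative ring: in each monomial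
  the factors are taken in increasing order of their indices.\<close>

definition elem_sym :: "('b, 'm) ring_scheme \<Rightarrow> nat \<Rightarrow> nat \<Rightarrow> (nat \<Rightarrow> 'b) \<Rightarrow> 'b" where
  "elem_sym S n k x =
    (\<Oplus>\<^bsub>S\<^esub>I\<in>{I. I \<subseteq> {1..n} \<and> card I = k}.
        foldr (mult S) (map x (sorted_list_of_set I)) \<one>\<^bsub>S\<^esub>)"

text \<open>\<open>f(Z) = Z\<^sup>n - a\<^sub>1 Z\<^sup>n\<^sup>-\<^sup>1 + \<cdots> + (-1)\<^sup>n a\<^sub>n\<close>. Only the values
  of \<open>a\<close> on \<open>{1..n}\<close> matter.\<close>

definition signed_poly :: "nat \<Rightarrow> (nat \<Rightarrow> 'a::ring_1) \<Rightarrow> (nat \<Rightarrow> 'a)" where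
  "signed_poly n a =
    up_ring.monom (UP base_ring) 1 n \<oplus>\<^bsub>UP base_ring\<^esub>
    (\<Oplus>\<^bsub>UP base_ring\<^esub>i\<in>{1..n}. up_ring.monom (UP base_ring) ((- 1) ^ i * a i) (n - i))"


subsection \<open>Matrices of size \<open>n!\<close>\<close>

abbreviation fact_mat_ring :: "nat \<Rightarrow> 'a::ring_1 mat ring" where
  "fact_mat_ring n \<equiv> ring_mat TYPE('a) (fact n) ()"

definition scalar :: "nat \<Rightarrow> 'a::ring_1 \<Rightarrow> 'a mat" where
  "scalar n r = r \<cdot>\<^sub>m 1\<^sub>m (fact n)"

text \<open>The subring \<open>R[A\<^sub>1, \<dots>, A\<^sub>n]\<close>.\<close>

definition adjoin :: "nat \<Rightarrow> (nat \<Rightarrow> 'a::ring_1 mat) \<Rightarrow> 'a mat ring" where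
  "adjoin n A =
    (fact_mat_ring n)\<lparr>carrier := generate_ring (fact_mat_ring n) (scalar n ` UNIV \<union> A ` {1..n})\<rparr>"

definition mat_monomial :: "nat \<Rightarrow> (nat \<Rightarrow> 'a::ring_1 mat) \<Rightarrow> (nat \<Rightarrow> nat) \<Rightarrow> 'a mat" where
  "mat_monomial n A \<alpha> = ordered_prod (fact_mat_ring n) n (\<lambda>i. A i [^]\<^bsub>fact_mat_ring n\<^esub> \<alpha> i)"

text \<open>The four properties of \<open>A\<^sub>1, \<dots>, A\<^sub>n\<close>. In the third one, the coefficients
  multiply from the left; by the first one this is the same as multiplying from the right.\<close>

definition splitting_matrices ::
    "nat \<Rightarrow> (nat \<Rightarrow> 'a::ring_1) \<Rightarrow> (nat \<Rightarrow> 'a mat) \<Rightarrow> bool" where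
  "splitting_matrices n a A \<longleftrightarrow>
    (\<forall>i\<in>{1..n}. A i \<in> carrier_mat (fact n) (fact n)) \<and>
    ((\<forall>i\<in>{1..n}. \<forall>j\<in>{1..n}. A i * A j = A j * A i) \<and>
     (\<forall>i\<in>{1..n}. \<forall>r. A i * scalar n r = scalar n r * A i)) \<and>
    (\<forall>i\<in>{1..n}. elem_sym (fact_mat_ring n) n i A = scalar n (a i)) \<and>
    (\<forall>c :: (nat \<Rightarrow> nat) \<Rightarrow> 'a.
       (\<Oplus>\<^bsub>fact_mat_ring n\<^esub>\<alpha>\<in>(\<Pi>\<^sub>E i\<in>{1..n}. {0..n - i}). c \<alpha> \<cdot>\<^sub>m mat_monomial n A \<alpha>)
         = 0\<^sub>m (fact n) (fact n) \<longrightarrow>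
       (\<forall>\<alpha>\<in>(\<Pi>\<^sub>E i\<in>{1..n}. {0..n - i}). c \<alpha> = 0)) \<and>
    (\<forall>k\<in>{1..n}. \<forall>i<fact n. \<forall>j<fact n. A k $$ (i, j) \<noteq> 0 \<longrightarrow>
       (\<exists>d\<le>n. A k $$ (i, j) = up_ring.coeff (UP base_ring) (signed_poly n a) d \<or>
              A k $$ (i, j) = - up_ring.coeff (UP base_ring) (signed_poly n a) d))"


subsection \<open>The polynomial ring in \<open>n\<close> variables\<close>

text \<open>Polynomials are finitely supported maps from exponent vectors to coefficients; the product
  of \<^typ>\<open>'a \<Rightarrow>\<^sub>0 'b\<close> is convolution, so the variables \<open>X\<^sub>1, \<dots>, X\<^sub>n\<close> are
  central.\<close>

type_synonym 'a mpoly = "(nat \<Rightarrow>\<^sub>0 nat) \<Rightarrow>\<^sub>0 'a"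

definition mpoly_ring :: "nat \<Rightarrow> 'a::ring_1 mpoly ring" where
  "mpoly_ring n =
    \<lparr>carrier = {p. \<forall>m\<in>Poly_Mapping.keys p. Poly_Mapping.keys m \<subseteq> {1..n}}, mult = (*), one = 1, zero = 0, add = (+)\<rparr>"

definition mconst :: "'a::ring_1 \<Rightarrow> 'a mpoly" where
  "mconst r = Poly_Mapping.single 0 r"

definition mvar :: "nat \<Rightarrow> 'a::ring_1 mpoly" where
  "mvar i = Poly_Mapping.single (Poly_Mapping.single i 1) 1"

text \<open>The two-sided ideal \<open>I\<^sub>f\<close>.\<close>

definition splitting_ideal :: "nat \<Rightarrow> (nat \<Rightarrow> 'a::ring_1) \<Rightarrow> 'a mpoly set" where
  "splitting_ideal n a =
    Idl\<^bsub>mpoly_ring n\<^esub> ((\<lambda>i. elem_sym (mpoly_ring n) n i mvar - mconst (a i)) ` {1..n})"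

definition extends_eval ::
    "nat \<Rightarrow> (nat \<Rightarrow> 'a::ring_1 mat) \<Rightarrow> ('a mpoly \<Rightarrow> 'a mat) \<Rightarrow> bool" where
  "extends_eval n A h \<longleftrightarrow>
    h \<in> ring_hom (mpoly_ring n) (fact_mat_ring n) \<and>
    (\<forall>r. h (mconst r) = scalar n r) \<and> (\<forall>i\<in>{1..n}. h (mvar i) = A i)"


subsection \<open>Splitting and Galois groups\<close>

text \<open>For \<open>\<phi> : R \<rightarrow> S\<close> and \<open>f \<in> R[Z]\<close>, this says that
  \<open>f(Z) = (Z - x\<^sub>1) \<cdots> (Z - x\<^sub>n)\<close> in \<open>S[Z]\<close>, coefficients being mapped by \<open>\<phi>\<close>.\<close>

definition splits_as ::
    "('a, 'k) ring_scheme \<Rightarrow> (nat \<Rightarrow> 'a) \<Rightarrow> ('b, 'm) ring_scheme \<Rightarrow> ('a \<Rightarrow> 'b)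
      \<Rightarrow> nat \<Rightarrow> (nat \<Rightarrow> 'b) \<Rightarrow> bool" where
  "splits_as R f S \<phi> n x \<longleftrightarrow>
    (\<forall>i\<in>{1..n}. x i \<in> carrier S) \<and>
    (\<forall>d. \<phi> (up_ring.coeff (UP R) f d) =
      up_ring.coeff (UP S)
        (ordered_prod (UP S) n
          (\<lambda>i. up_ring.monom (UP S) \<one>\<^bsub>S\<^esub> 1 \<ominus>\<^bsub>UP S\<^esub> up_ring.monom (UP S) (x i) 0)) d)"

definition universal_splitting_ring ::
    "nat \<Rightarrow> (nat \<Rightarrow> 'a::ring_1) \<Rightarrow> (nat \<Rightarrow> 'a mat) \<Rightarrow> bool" where
  "universal_splitting_ring n a A \<longleftrightarrow>
    (\<exists>h. extends_eval n A h \<and>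
       (\<forall>h'. extends_eval n A h' \<longrightarrow> (\<forall>p\<in>carrier (mpoly_ring n). h' p = h p)) \<and>
       h ` carrier (mpoly_ring n) = carrier (adjoin n A) \<and>
       a_kernel (mpoly_ring n) (fact_mat_ring n) h = splitting_ideal n a) \<and>
    splits_as base_ring (signed_poly n a) (adjoin n A) (scalar n) n A"

text \<open>\<open>L\<close>, as an extension of \<open>F\<close> along \<open>\<phi>\<close>, is a splitting field of the monic
  polynomial \<open>f\<close> of degree \<open>n\<close>.\<close>

definition splitting_field ::
    "('a, 'k) ring_scheme \<Rightarrow> nat \<Rightarrow> (nat \<Rightarrow> 'a) \<Rightarrow> ('b, 'm) ring_scheme
      \<Rightarrow> ('a \<Rightarrow> 'b) \<Rightarrow> bool" where
  "splitting_field F n f L \<phi> \<longleftrightarrow>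
    field F \<and> field L \<and> \<phi> \<in> ring_hom F L \<and>
    (\<exists>x. splits_as F f L \<phi> n x \<and> carrier L = generate_field L (\<phi> ` carrier F \<union> x ` {1..n}))"

text \<open>\<open>f\<close> has no multiple roots in the splitting field \<open>L\<close>.\<close>

definition separable_in ::
    "('a, 'k) ring_scheme \<Rightarrow> nat \<Rightarrow> (nat \<Rightarrow> 'a) \<Rightarrow> ('b, 'm) ring_scheme
      \<Rightarrow> ('a \<Rightarrow> 'b) \<Rightarrow> bool" where
  "separable_in F n f L \<phi> \<longleftrightarrow> (\<exists>x. splits_as F f L \<phi> n x \<and> inj_on x {1..n})"

definition galois_group :: "('b, 'm) ring_scheme \<Rightarrow> 'b set \<Rightarrow> ('b \<Rightarrow> 'b) monoid" where
  "galois_group L E =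
    BijGroup (carrier L)\<lparr>carrier :=
      {g \<in> Bij (carrier L). g \<in> ring_hom L L \<and> (\<forall>y\<in>E. g y = y)}\<rparr>"

end

theory Submission
  imports Defs
begin

text \<open>
  Successive synthetic division of \<open>f\<close> by \<open>Z - X\<^sub>1, Z - X\<^sub>2, \<dots>\<close> leaves remainders \<open>f\<^sub>1, \<dots>, f\<^sub>n\<close>,
  where \<open>f\<^sub>k\<close> involves only \<open>X\<^sub>1, \<dots>, X\<^sub>k\<close> and is monic in \<open>X\<^sub>k\<close> of degree \<open>n - k + 1\<close>, and
  which generate the ideal \<open>I\<^sub>f\<close>. Hence \<open>R[X\<^sub>1, \<dots>, X\<^sub>n] / I\<^sub>f\<close> is free over \<open>R\<close> on the \<open>n!\<close>
  monomials \<open>X\<^sup>\<alpha>\<close> with \<open>\<alpha>\<^sub>i \<le> n - i\<close>: dividing by \<open>f\<^sub>n, \<dots>, f\<^sub>1\<close> in turn kills \<open>I\<^sub>f\<close> and fixes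
  these monomials. The matrices \<open>A\<^sub>i\<close> are those of multiplication by \<open>X\<^sub>i\<close> in this basis. Their
  entries are coefficients of \<open>f\<close> up to sign because the coefficients of \<open>f\<^sub>k\<close> are, up to sign, partial
  quotients of \<open>f\<^sub>k\<^sub>-\<^sub>1\<close>, and a power of \<open>X\<^sub>k\<^sub>-\<^sub>1\<close> times such a partial quotient is again, modulo
  \<open>f\<^sub>k\<^sub>-\<^sub>1\<close>, plus or minus a segment of \<open>f\<^sub>k\<^sub>-\<^sub>1\<close> shifted by a power of \<open>X\<^sub>k\<^sub>-\<^sub>1\<close>.

  For any matrices with the four properties, freeness and (iii) identify the kernel of evaluation with
  \<open>I\<^sub>f\<close>. If the Galois group of a splitting field is \<open>S\<^sub>n\<close>, every permutation of the roots is
  induced by an automorphism, so a polynomial in the span of the reduced monomials which vanishes at one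
  ordering of the roots vanishes at all of them and is therefore zero; the splitting field is thus the
  same quotient.
\<close>

section \<open>Polynomials in central variables\<close>

text \<open>Condition (iv) shapes the construction. Naive reduction of monomials modulo f_1, ...,
  f_n would mix products and sums of coefficients of f. The induction therefore treats all products
  of a monomial with a partial quotient: a division step returns products of the same kind in one
  variable fewer, attached to distinct powers of the removed variable, so that coefficients of f are
  neither multiplied nor added. Freeness rests on the order of the divisions: f_k does not involve
  X_l for l > k, so it passes through the divisions by f_n, ..., f_(k+1) as a factor and is killed
  by the one by f_k. R is not commutative, and only the a_i are central. Each f_k must be central to
  be moved past other coefficients, and the matrices describe left multiplication in coordinates
  that act from the right, so that composition is the matrix product. The power series in T whose
  coefficients are the partial quotients links the f_k with the \<sigma>_i - a_i: multiplied by the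
  product of the 1 - X_i T, it gives back the signed coefficients of f.\<close>

abbreviation lkp :: "('b \<Rightarrow>\<^sub>0 'c::zero) \<Rightarrow> 'b \<Rightarrow> 'c" where "lkp \<equiv> Poly_Mapping.lookup"
abbreviation supp :: "('b \<Rightarrow>\<^sub>0 'c::zero) \<Rightarrow> 'b set" where "supp \<equiv> Poly_Mapping.keys"
abbreviation sgl :: "'b \<Rightarrow> 'c::zero \<Rightarrow> ('b \<Rightarrow>\<^sub>0 'c)" where "sgl \<equiv> Poly_Mapping.single"
abbreviation xmon :: "(nat \<Rightarrow>\<^sub>0 nat) \<Rightarrow> 'a::ring_1 mpoly" where "xmon m \<equiv> Poly_Mapping.single m 1"

section \<open>Central elements\<close>

definition central :: "'b::ring_1 \<Rightarrow> bool" where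
  "central x \<longleftrightarrow> (\<forall>y. y * x = x * y)"

lemma centralD: "central x \<Longrightarrow> y * x = x * y"
  by (simp add: central_def)

lemma central_left_commute: "central x \<Longrightarrow> y * (x * z) = x * (y * z)"
  by (metis central_def mult.assoc)

lemma central_0: "central 0" and central_1: "central 1"
  by (simp_all add: central_def)

lemma central_add: "central x \<Longrightarrow> central y \<Longrightarrow> central (x + y)"
  by (simp add: central_def algebra_simps)

lemma central_uminus: "central x \<Longrightarrow> central (- x)"
  by (simp add: central_def)

lemma central_mult: "central x \<Longrightarrow> central y \<Longrightarrow> central (x * y)"
  unfolding central_def by (metis mult.assoc)

lemma central_power: "central x \<Longrightarrow> central (x ^ k)"
  by (induction k) (auto intro: central_mult central_1)

section \<open>Decomposition into monomials and induction on polynomials\<close>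

lemma mpoly_sum_singles: "(p :: 'a::ring_1 mpoly) = (\<Sum>m\<in>supp p. sgl m (lkp p m))"
proof (rule poly_mapping_eqI)
  fix k
  show "lkp p k = lkp (\<Sum>m\<in>supp p. sgl m (lkp p m)) k"
    by (cases "k \<in> supp p")
      (auto simp: lookup_sum lookup_single when_def sum.delta' in_keys_iff)
qed

text \<open>Most claims below are additive in \<open>p\<close>. The monomial case retains
  \<open>m \<in> supp p\<close>, so that a condition on the exponents of the fixed \<open>p\<close>
  can be used there, although it is lost for the summands in the other cases.\<close>

lemma mpoly_induct [case_names single add]:
  assumes single: "\<And>m c. m \<in> supp p \<Longrightarrow> c = lkp p m \<Longrightarrow> P (sgl m c)"
    and zero: "P 0"
    and add: "\<And>p q. P p \<Longrightarrow> P q \<Longrightarrow> P (p + q)"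
  shows "P (p :: 'a::ring_1 mpoly)"
proof -
  have "P (\<Sum>m\<in>S. sgl m (lkp p m))" if "finite S" "S \<subseteq> supp p" for S
    using that by (induction S rule: finite_induct) (auto intro: assms)
  then show ?thesis using mpoly_sum_singles[of p] by (metis finite_keys order_refl)
qed

lemma single_eq: "sgl m c = mconst c * xmon m"
  by (simp add: mconst_def mult_single)

lemma mconst_0 [simp]: "mconst 0 = 0" and mconst_1 [simp]: "mconst 1 = 1"
  by (simp_all add: mconst_def)

lemma mconst_add: "mconst (c + d) = mconst c + mconst d"
  by (simp add: mconst_def single_add)

lemma mconst_mult: "mconst (c * d) = mconst c * mconst d"
  by (simp add: mconst_def mult_single)

lemma mconst_uminus: "mconst (- c) = - mconst c"
  by (simp add: mconst_def single_uminus)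

lemma central_single:
  assumes "central c" shows "central (sgl m c :: 'a::ring_1 mpoly)"
  unfolding central_def
proof
  fix y :: "'a mpoly"
  show "y * sgl m c = sgl m c * y"
    by (rule mpoly_induct[where p = y])
      (use assms in \<open>auto simp: mult_single add.commute algebra_simps central_def\<close>)
qed

lemma central_mconst: "central c \<Longrightarrow> central (mconst c)"
  by (simp add: mconst_def central_single)

lemma central_mvar: "central (mvar i)"
  by (simp add: mvar_def central_single central_1)

lemma mvar_power: "mvar i ^ k = xmon (sgl i k)"
  by (induction k) (auto simp: mvar_def mult_single simp flip: single_add single_one)

lemma lookup_single_mult: "lkp (sgl m c * p :: 'a::ring_1 mpoly) (m + k) = c * lkp p k"
proof (rule mpoly_induct[where p = p])
qed (auto simp: mult_single lookup_single when_def lookup_add algebra_simps)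

lemma supp_single_mult: "supp (sgl m c * p :: 'a::ring_1 mpoly) \<subseteq> (+) m ` supp p"
  using keys_mult[of "sgl m c" p] by (auto split: if_splits)

subsection \<open>Polynomials in the first \<open>k\<close> variables\<close>

lemma mpoly_ring_carrier: "p \<in> carrier (mpoly_ring k) \<longleftrightarrow> (\<forall>m\<in>supp p. supp m \<subseteq> {1..k})"
  by (simp add: mpoly_ring_def)

lemma mpoly_carrier_0: "0 \<in> carrier (mpoly_ring k)"
  and mpoly_carrier_1: "1 \<in> carrier (mpoly_ring k)"
  and mpoly_carrier_mconst: "mconst c \<in> carrier (mpoly_ring k)"
  by (auto simp: mpoly_ring_carrier mconst_def)

lemma mpoly_carrier_single: "supp m \<subseteq> {1..k} \<Longrightarrow> sgl m c \<in> carrier (mpoly_ring k)"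
  by (auto simp: mpoly_ring_carrier)

lemma mpoly_carrier_mvar: "i \<in> {1..k} \<Longrightarrow> mvar i \<in> carrier (mpoly_ring k)"
  by (auto simp: mvar_def mpoly_ring_carrier)

lemma mpoly_carrier_add:
  "p \<in> carrier (mpoly_ring k) \<Longrightarrow> q \<in> carrier (mpoly_ring k) \<Longrightarrow> p + q \<in> carrier (mpoly_ring k)"
  unfolding mpoly_ring_carrier using keys_add[of p q] by blast

lemma mpoly_carrier_uminus:
  "p \<in> carrier (mpoly_ring k) \<Longrightarrow> - p \<in> carrier (mpoly_ring k)"
  by (auto simp: mpoly_ring_carrier in_keys_iff)

lemma mpoly_carrier_diff:
  "p \<in> carrier (mpoly_ring k) \<Longrightarrow> q \<in> carrier (mpoly_ring k) \<Longrightarrow> p - q \<in> carrier (mpoly_ring k)"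
  using mpoly_carrier_add[of p k "- q"] mpoly_carrier_uminus[of q k] by simp

lemma exps_add: "supp (m + m' :: nat \<Rightarrow>\<^sub>0 nat) = supp m \<union> supp m'"
  by (auto simp: in_keys_iff lookup_add)

lemma mpoly_carrier_mult:
  assumes "p \<in> carrier (mpoly_ring k)" "q \<in> carrier (mpoly_ring k)"
  shows "p * q \<in> carrier (mpoly_ring k)"
  unfolding mpoly_ring_carrier
proof
  fix m assume "m \<in> supp (p * q)"
  then obtain b c where "m = b + c" "b \<in> supp p" "c \<in> supp q"
    using keys_mult[of p q] by blast
  then show "supp m \<subseteq> {1..k}"
    using assms unfolding mpoly_ring_carrier exps_add by (simp add: exps_add)
qed

lemma mpoly_carrier_mono: "k \<le> l \<Longrightarrow> p \<in> carrier (mpoly_ring k) \<Longrightarrow> p \<in> carrier (mpoly_ring l)"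
  unfolding mpoly_ring_carrier by fastforce

text \<open>A monomial is reached by induction on its total degree, peeling off one variable at a
  time. The resulting rule fits homomorphisms, whose values are prescribed on constants and
  variables.\<close>

lemma mpoly_ring_induct [consumes 1, case_names const add var]:
  assumes p: "p \<in> carrier (mpoly_ring n)"
    and const: "\<And>c. P (mconst c)"
    and add: "\<And>p q. p \<in> carrier (mpoly_ring n) \<Longrightarrow> q \<in> carrier (mpoly_ring n) \<Longrightarrow> P p \<Longrightarrow> P q \<Longrightarrow> P (p + q)"
    and var: "\<And>i p. i \<in> {1..n} \<Longrightarrow> p \<in> carrier (mpoly_ring n) \<Longrightarrow> P p \<Longrightarrow> P (mvar i * p)"
  shows "P p"
proof -
  have single: "P (sgl m c)" if "supp m \<subseteq> {1..n}" for m c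
    using that
  proof (induction "sum (lkp m) (supp m)" arbitrary: m rule: less_induct)
    case less
    show ?case
    proof (cases "m = 0")
      case True
      then show ?thesis using const[of c] by (simp add: mconst_def)
    next
      case False
      then obtain i where i: "i \<in> supp m" by (metis lookup_zero poly_mapping_eqI in_keys_iff)
      define m' where "m' = m - sgl i 1"
      have m: "m = sgl i 1 + m'"
        using i by (auto simp: m'_def lookup_add lookup_minus lookup_single when_def in_keys_iff intro!: poly_mapping_eqI)
      have sub: "supp m' \<subseteq> supp m" by (auto simp: m exps_add)
      have "sum (lkp m') (supp m') = sum (lkp m') (supp m)"
        by (rule sum.mono_neutral_left) (use sub in \<open>auto simp: in_keys_iff\<close>)
      also have "\<dots> < sum (lkp m) (supp m)"
        by (rule sum_strict_mono_ex1) (use i in \<open>auto simp: m lookup_add intro!: bexI[of _ i]\<close>)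
      finally have "P (sgl m' c)" using less sub by blast
      moreover have "sgl m c = mvar i * sgl m' c"
        by (simp add: mvar_def mult_single m)
      ultimately show ?thesis
        using var[of i "sgl m' c"] i less.prems sub mpoly_carrier_single[of m' n c] by force
    qed
  qed
  have "P p \<and> p \<in> carrier (mpoly_ring n)"
  proof (rule mpoly_induct[where p = p])
    fix m c assume "m \<in> supp p"
    then have "supp m \<subseteq> {1..n}" using p by (auto simp: mpoly_ring_carrier)
    then show "P (sgl m c) \<and> sgl m c \<in> carrier (mpoly_ring n)"
      using single mpoly_carrier_single by blast
  next
    show "P 0 \<and> 0 \<in> carrier (mpoly_ring n)" using const[of 0] by (simp add: mpoly_carrier_0)
  qed (use add mpoly_carrier_add in blast)
  then show ?thesis ..
qed

subsection \<open>Division by a monic polynomial in one variable\<close>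

definition linext :: "((nat \<Rightarrow>\<^sub>0 nat) \<Rightarrow> 'a::ring_1 mpoly) \<Rightarrow> 'a mpoly \<Rightarrow> 'a mpoly" where
  "linext B p = (\<Sum>m\<in>supp p. mconst (lkp p m) * B m)"

lemma linext_add: "linext B (p + q) = linext B p + linext B q"
  unfolding linext_def
  by (rule setsum_keys_plus_distrib[where f = "\<lambda>m c. mconst c * B m"])
    (auto simp: mconst_add algebra_simps)

lemma linext_0 [simp]: "linext B 0 = 0"
  by (simp add: linext_def)

lemma linext_single: "linext B (sgl m c) = mconst c * B m"
  by (simp add: linext_def)

lemma linext_sum: "linext B (sum g S) = (\<Sum>i\<in>S. linext B (g i))"
  by (induction S rule: infinite_finite_induct) (auto simp: linext_add)

text \<open>The remainder of X_k^m on division by X_k^d + (sum over j < d of F_j X_k^j): each step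
  replaces one factor X_k^d by minus the lower terms. The unconditional equation would loop as a
  rewrite rule, hence its removal from the simp set.\<close>

function rem_pow :: "nat \<Rightarrow> (nat \<Rightarrow> 'a::ring_1 mpoly) \<Rightarrow> nat \<Rightarrow> nat \<Rightarrow> 'a mpoly" where
  "rem_pow d F k m =
    (if m < d then mvar k ^ m else - (\<Sum>j\<in>{..<d}. F j * rem_pow d F k (m - d + j)))"
  by auto
termination by (relation "measure (\<lambda>(d, F, k, m). m)") auto

declare rem_pow.simps [simp del]

text \<open>Remainder modulo \<open>X\<^sub>k\<^sup>d + \<Sum>\<^sub>j\<^sub><\<^sub>d F\<^sub>j X\<^sub>k\<^sup>j\<close>, for \<open>F\<^sub>j\<close> not involving \<open>X\<^sub>k\<close>.\<close>

definition red :: "nat \<Rightarrow> (nat \<Rightarrow> 'a::ring_1 mpoly) \<Rightarrow> nat \<Rightarrow> 'a mpoly \<Rightarrow> 'a mpoly" where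
  "red d F k = linext (\<lambda>m. xmon (Poly_Mapping.update k 0 m) * rem_pow d F k (lkp m k))"

lemma update_0_add:
  "lkp b k = 0 \<Longrightarrow> Poly_Mapping.update k 0 (b + m) = (b :: nat \<Rightarrow>\<^sub>0 nat) + Poly_Mapping.update k 0 m"
  by (rule poly_mapping_eqI) (auto simp: lookup_add lookup_update)

lemma update_0_add_single:
  "Poly_Mapping.update k 0 m + sgl k (lkp m k) = (m :: nat \<Rightarrow>\<^sub>0 nat)"
  by (rule poly_mapping_eqI) (auto simp: lookup_add lookup_update lookup_single when_def)

lemma red_single_mult:
  assumes "lkp b k = 0"
  shows "red d F k (sgl b c * p) = sgl b c * red d F k p"
proof (rule mpoly_induct[where p = p])
  fix m e
  let ?r = "rem_pow d F k (lkp m k)"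
  have "red d F k (sgl b c * sgl m e) =
      mconst (c * e) * (xmon (b + Poly_Mapping.update k 0 m) * ?r)"
    using assms by (simp add: mult_single red_def linext_single update_0_add lookup_add)
  also have "\<dots> = sgl b c * (mconst e * (xmon (Poly_Mapping.update k 0 m) * ?r))"
    by (simp add: mconst_def mult_single flip: mult.assoc)
  finally show "red d F k (sgl b c * sgl m e) = sgl b c * red d F k (sgl m e)"
    by (simp add: red_def linext_single)
qed (auto simp: red_def linext_add algebra_simps)

text \<open>A factor free of X_k stays on the left of every term and does not change the exponent of
  X_k, so the remainder is linear over such factors even when coefficients do not commute.\<close>

lemma red_mult_free:
  assumes "\<And>b. b \<in> supp q \<Longrightarrow> lkp b k = 0"
  shows "red d F k (q * p) = q * red d F k p"
proof (rule mpoly_induct[where p = q])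
  show "red d F k (sgl m c * p) = sgl m c * red d F k p" if "m \<in> supp q" for m c
    using assms[OF that] by (rule red_single_mult)
qed (auto simp: algebra_simps red_def linext_add)

text \<open>The recursion for \<open>rem_pow\<close> says that the divisor times a power of X_k has
  remainder 0; linearity extends this to all multiples.\<close>

lemma red_monic_mult:
  assumes free: "\<And>j b. j < d \<Longrightarrow> b \<in> supp (F j) \<Longrightarrow> lkp b k = 0"
    and cent: "\<And>j. j < d \<Longrightarrow> central (F j)"
  shows "red d F k ((mvar k ^ d + (\<Sum>j<d. F j * mvar k ^ j)) * p) = 0"
proof (rule mpoly_induct[where p = p])
  fix m :: "nat \<Rightarrow>\<^sub>0 nat" and c :: 'a
  let ?u = "Poly_Mapping.update k 0 m"
  have pow: "red d F k (mvar k ^ j * sgl m c) = mconst c * xmon ?u * rem_pow d F k (lkp m k + j)" for j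
  proof -
    have "Poly_Mapping.update k 0 (sgl k j + m) = ?u"
      by (rule poly_mapping_eqI) (auto simp: lookup_update lookup_add lookup_single when_def)
    then show ?thesis
      by (simp add: mvar_power mult_single red_def linext_single lookup_add add.commute mult.assoc)
  qed
  have "red d F k ((mvar k ^ d + (\<Sum>j<d. F j * mvar k ^ j)) * sgl m c) =
    red d F k (mvar k ^ d * sgl m c) + (\<Sum>j<d. red d F k (F j * (mvar k ^ j * sgl m c)))"
    by (simp add: algebra_simps sum_distrib_left sum_distrib_right red_def linext_add linext_sum)
  also have "\<dots> = mconst c * xmon ?u * rem_pow d F k (lkp m k + d)
      + (\<Sum>j<d. F j * (mconst c * xmon ?u * rem_pow d F k (lkp m k + j)))"
    using free by (simp add: red_mult_free pow)
  \<comment> \<open>Collecting terms behind a common left factor moves each F_j past the coefficient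
    \<open>c\<close>; this is where centrality enters.\<close>
  also have "\<dots> = mconst c * xmon ?u *
      (rem_pow d F k (lkp m k + d) + (\<Sum>j<d. F j * rem_pow d F k (lkp m k + j)))"
    using cent by (auto simp: sum_distrib_left distrib_left central_left_commute intro!: sum.cong)
  also have "\<dots> = 0"
    by (subst rem_pow.simps) simp
  finally show "red d F k ((mvar k ^ d + (\<Sum>j<d. F j * mvar k ^ j)) * sgl m c) = 0" .
qed (simp_all add: distrib_left red_def linext_add)

lemma red_id:
  assumes "\<And>m. m \<in> supp p \<Longrightarrow> lkp m k < d"
  shows "red d F k p = p"
proof (rule mpoly_induct[where p = p])
  fix m c assume "m \<in> supp p"
  then show "red d F k (sgl m c) = sgl m c"
    using assms[of m]
    by (simp add: red_def linext_single rem_pow.simps mvar_power mult_single update_0_add_single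
        flip: single_eq)
qed (auto simp: red_def linext_add)

section \<open>Elementary symmetric polynomials in a ring\<close>

lemma (in monoid) foldr_mult_closed:
  "set xs \<subseteq> carrier G \<Longrightarrow> foldr (\<otimes>) xs \<one> \<in> carrier G"
  by (induction xs) auto

lemma (in monoid) foldr_mult_snoc:
  "set xs \<subseteq> carrier G \<Longrightarrow> y \<in> carrier G \<Longrightarrow> foldr (\<otimes>) (xs @ [y]) \<one> = foldr (\<otimes>) xs \<one> \<otimes> y"
  by (induction xs) (auto simp: m_assoc foldr_mult_closed)

lemma ordered_prod_0 [simp]: "ordered_prod G 0 x = \<one>\<^bsub>G\<^esub>"
  by (simp add: ordered_prod_def)

lemma (in monoid) ordered_prod_closed:
  "(\<And>i. i \<in> {1..k} \<Longrightarrow> x i \<in> carrier G) \<Longrightarrow> ordered_prod G k x \<in> carrier G"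
  unfolding ordered_prod_def by (rule foldr_mult_closed) auto

lemma (in monoid) ordered_prod_Suc:
  assumes "\<And>i. i \<in> {1..Suc k} \<Longrightarrow> x i \<in> carrier G"
  shows "ordered_prod G (Suc k) x = ordered_prod G k x \<otimes> x (Suc k)"
  using foldr_mult_snoc[of "map x [1..<Suc k]" "x (Suc k)"] assms
  unfolding ordered_prod_def by fastforce

lemma ordered_prod_cong:
  "(\<And>i. i \<in> {1..k} \<Longrightarrow> x i = y i) \<Longrightarrow> ordered_prod G k x = ordered_prod G k y"
  unfolding ordered_prod_def by (metis (no_types, lifting) map_cong atLeastLessThanSuc_atLeastAtMost set_upt)

context ring
begin

lemma elem_sym_0: "elem_sym R k 0 x = \<one>"
proof -
  have "{I. I \<subseteq> {1..k} \<and> card I = 0} = {{}}" by (auto dest: finite_subset)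
  then show ?thesis by (simp add: elem_sym_def)
qed

lemma elem_sym_eq_0: "k < i \<Longrightarrow> elem_sym R k i x = \<zero>"
proof -
  assume k: "k < i"
  have "\<not> (I \<subseteq> {1..k} \<and> card I = i)" for I
    using card_mono[of "{1..k}" I] k by auto
  then have "{I. I \<subseteq> {1..k} \<and> card I = i} = {}" by blast
  then show ?thesis unfolding elem_sym_def by (simp only: finsum_empty)
qed

lemma elem_sym_term_closed:
  fixes k :: nat
  assumes "\<And>i. i \<in> {1..k} \<Longrightarrow> x i \<in> carrier R" "I \<subseteq> {1..k}"
  shows "foldr (\<otimes>) (map x (sorted_list_of_set I)) \<one> \<in> carrier R"
proof -
  have "finite I" using assms(2) finite_subset by blast
  moreover have "x j \<in> carrier R" if "j \<in> I" for j using that assms by blast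
  ultimately show ?thesis by (intro foldr_mult_closed) (auto simp only: set_map set_sorted_list_of_set)
qed

lemma elem_sym_closed:
  assumes "\<And>i. i \<in> {1..k} \<Longrightarrow> x i \<in> carrier R"
  shows "elem_sym R k i x \<in> carrier R"
  unfolding elem_sym_def
  by (intro finsum_closed Pi_I elem_sym_term_closed[where k = k]) (use assms in auto)

lemma elem_sym_cong:
  assumes "\<And>i. i \<in> {1..k} \<Longrightarrow> x i = y i" "\<And>i. i \<in> {1..k} \<Longrightarrow> y i \<in> carrier R"
  shows "elem_sym R k i x = elem_sym R k i y"
  unfolding elem_sym_def
proof (rule finsum_cong')
  fix I assume "I \<in> {I. I \<subseteq> {1..k} \<and> card I = i}"
  then have "I \<subseteq> {1..k}" "finite I" by (auto dest: finite_subset)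
  then have "map x (sorted_list_of_set I) = map y (sorted_list_of_set I)"
    using assms by auto
  then show "foldr (\<otimes>) (map x (sorted_list_of_set I)) \<one> = foldr (\<otimes>) (map y (sorted_list_of_set I)) \<one>"
    by (simp only:)
next
  show "(\<lambda>I. foldr (\<otimes>) (map y (sorted_list_of_set I)) \<one>) \<in> {I. I \<subseteq> {1..k} \<and> card I = i} \<rightarrow> carrier R"
    by (intro Pi_I elem_sym_term_closed[where k = k]) (use assms in auto)
qed simp

text \<open>The index sets containing \<open>Suc k\<close> are split off. Factors are taken in
  increasing order, so \<open>x (Suc k)\<close> comes last and stands on the right without any
  commutation.\<close>

lemma elem_sym_Suc:
  assumes x: "\<And>i. i \<in> {1..Suc k} \<Longrightarrow> x i \<in> carrier R"
  shows "elem_sym R (Suc k) (Suc i) x = elem_sym R k (Suc i) x \<oplus> elem_sym R k i x \<otimes> x (Suc k)"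
proof -
  define t where "t = (\<lambda>I. foldr (\<otimes>) (map x (sorted_list_of_set I)) \<one>)"
  let ?S = "\<lambda>k i. {I. I \<subseteq> {1..k} \<and> card I = i}"
  have fin: "finite (?S k i)" for k i :: nat
    by (rule finite_subset[of _ "Pow {1..k}"]) auto
  have tc: "t I \<in> carrier R" if "I \<subseteq> {1..Suc k}" for I
    unfolding t_def using elem_sym_term_closed[OF x that] .
  have tk: "t I \<in> carrier R" and tck: "t (insert (Suc k) I) \<in> carrier R" if "I \<subseteq> {1..k}" for I
    using that by (auto intro!: tc)
  have tins: "t (insert (Suc k) I) = t I \<otimes> x (Suc k)" if "I \<subseteq> {1..k}" for I
  proof -
    have I: "finite I" "Suc k \<notin> I" using that finite_subset by auto
    have "sorted_list_of_set (insert (Suc k) I) = sorted_list_of_set I @ [Suc k]"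
      using I that by (subst sorted_list_of_set_unique[symmetric]) (auto simp: sorted_wrt_append)
    moreover have "set (map x (sorted_list_of_set I)) \<subseteq> carrier R"
      using I that x by auto
    ultimately show ?thesis
      unfolding t_def using foldr_mult_snoc[of "map x (sorted_list_of_set I)" "x (Suc k)"] x by simp
  qed
  have split: "?S (Suc k) (Suc i) = ?S k (Suc i) \<union> insert (Suc k) ` ?S k i"
  proof (intro equalityI subsetI)
    fix I assume "I \<in> ?S (Suc k) (Suc i)"
    then have I: "I \<subseteq> {1..Suc k}" "card I = Suc i" "finite I" by (auto dest: finite_subset)
    show "I \<in> ?S k (Suc i) \<union> insert (Suc k) ` ?S k i"
    proof (cases "Suc k \<in> I")
      case True
      then have "I = insert (Suc k) (I - {Suc k})" by auto
      moreover have "I - {Suc k} \<in> ?S k i" using I True by auto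
      ultimately show ?thesis by blast
    next
      case False
      then have "y \<in> {1..k}" if "y \<in> I" for y
        using that I(1) le_Suc_eq by (cases "y = Suc k") auto
      then have "I \<subseteq> {1..k}" by blast
      then show ?thesis using I by auto
    qed
  next
    fix I assume "I \<in> ?S k (Suc i) \<union> insert (Suc k) ` ?S k i"
    then consider "I \<in> ?S k (Suc i)" | J where "I = insert (Suc k) J" "J \<subseteq> {1..k}" "card J = i"
      by auto
    then show "I \<in> ?S (Suc k) (Suc i)"
    proof cases
      case 2
      then have "Suc k \<notin> J" "finite J" using finite_subset by auto
      then show ?thesis using 2 by auto
    qed auto
  qed
  have inj: "inj_on (insert (Suc k)) (?S k i)"
  proof (rule inj_onI)
    fix I J assume "I \<in> ?S k i" "J \<in> ?S k i" and eq: "insert (Suc k) I = insert (Suc k) J"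
    then have "Suc k \<notin> I" "Suc k \<notin> J" by auto
    then show "I = J" using eq insert_ident[of "Suc k" I J] by blast
  qed
  have "elem_sym R (Suc k) (Suc i) x = finsum R t (?S k (Suc i)) \<oplus> finsum R t (insert (Suc k) ` ?S k i)"
    unfolding elem_sym_def split t_def[symmetric]
  proof (rule finsum_Un_disjoint)
    show "t \<in> ?S k (Suc i) \<rightarrow> carrier R" "t \<in> insert (Suc k) ` ?S k i \<rightarrow> carrier R"
      using tk tck by auto
  qed (use fin in auto)
  also have "finsum R t (insert (Suc k) ` ?S k i) = (\<Oplus>I\<in>?S k i. t (insert (Suc k) I))"
    by (rule finsum_reindex) (use inj tck in auto)
  also have "\<dots> = (\<Oplus>I\<in>?S k i. t I \<otimes> x (Suc k))"
    by (rule finsum_cong') (use tins tk x in auto)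
  also have "\<dots> = finsum R t (?S k i) \<otimes> x (Suc k)"
    by (rule finsum_ldistr[symmetric]) (use fin x tk in auto)
  finally show ?thesis unfolding elem_sym_def t_def .
qed

lemma elem_sym_hom:
  assumes "ring S" "h \<in> ring_hom R S" and x: "\<And>i. i \<in> {1..k} \<Longrightarrow> x i \<in> carrier R"
  shows "h (elem_sym R k i x) = elem_sym S k i (\<lambda>j. h (x j))"
  using x
proof (induction k arbitrary: i)
  case 0
  interpret S: ring S by fact
  interpret h: ring_hom_ring R S h using assms(2) by (intro ring_hom_ringI2) (auto intro: assms(1) ring_axioms)
  show ?case
    by (cases "i = 0") (auto simp: elem_sym_0 S.elem_sym_0 elem_sym_eq_0 S.elem_sym_eq_0)
next
  case (Suc k)
  interpret S: ring S by fact
  interpret h: ring_hom_ring R S h using assms(2) by (intro ring_hom_ringI2) (auto intro: assms(1) ring_axioms)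
  show ?case
  proof (cases i)
    case 0
    then show ?thesis by (simp add: elem_sym_0 S.elem_sym_0)
  next
    case (Suc i')
    have c: "elem_sym R k j x \<in> carrier R" for j by (rule elem_sym_closed) (use Suc.prems in auto)
    have e: "elem_sym R (Suc k) (Suc i') x = elem_sym R k (Suc i') x \<oplus> elem_sym R k i' x \<otimes> x (Suc k)"
      by (rule elem_sym_Suc) (rule Suc.prems)
    have xs: "x (Suc k) \<in> carrier R" by (rule Suc.prems) simp
    have "h (elem_sym R (Suc k) (Suc i') x) =
        h (elem_sym R k (Suc i') x) \<oplus>\<^bsub>S\<^esub> h (elem_sym R k i' x) \<otimes>\<^bsub>S\<^esub> h (x (Suc k))"
      unfolding e using c xs by simp
    also have "\<dots> = elem_sym S (Suc k) (Suc i') (\<lambda>j. h (x j))"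
    proof -
      have "h (elem_sym R k j x) = elem_sym S k j (\<lambda>j. h (x j))" for j
        by (rule Suc.IH) (use Suc.prems in auto)
      moreover have "elem_sym S (Suc k) (Suc i') (\<lambda>j. h (x j)) = elem_sym S k (Suc i') (\<lambda>j. h (x j)) \<oplus>\<^bsub>S\<^esub>
          elem_sym S k i' (\<lambda>j. h (x j)) \<otimes>\<^bsub>S\<^esub> h (x (Suc k))"
        by (rule S.elem_sym_Suc) (rule h.hom_closed[OF Suc.prems])
      ultimately show ?thesis by simp
    qed
    finally show ?thesis using Suc by simp
  qed
qed

section \<open>Vieta's formulas in a noncommutative ring\<close>

lemma coeff_mult_monom_right:
  assumes p: "p \<in> carrier (UP R)" and c: "c \<in> carrier R"
  shows "up_ring.coeff (UP R) (p \<otimes>\<^bsub>UP R\<^esub> up_ring.monom (UP R) c k) d =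
    (if k \<le> d then up_ring.coeff (UP R) p (d - k) \<otimes> c else \<zero>)"
proof -
  interpret P: UP_ring R "UP R" by unfold_locales simp
  have cc: "up_ring.coeff (UP R) p i \<in> carrier R" for i using p by (rule P.coeff_closed)
  have "up_ring.coeff (UP R) (p \<otimes>\<^bsub>UP R\<^esub> up_ring.monom (UP R) c k) d =
      (\<Oplus>i\<in>{..d}. up_ring.coeff (UP R) p i \<otimes> (if k = d - i then c else \<zero>))"
    using p c by simp
  also have "\<dots> = (\<Oplus>i\<in>{..d}. if i = d - k then (if k \<le> d then up_ring.coeff (UP R) p i \<otimes> c else \<zero>) else \<zero>)"
    by (rule finsum_cong') (use cc c in auto)
  also have "\<dots> = (if k \<le> d then up_ring.coeff (UP R) p (d - k) \<otimes> c else \<zero>)"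
    by (subst add.finprod_singleton_swap) (use cc c in auto)
  finally show ?thesis .
qed

text \<open>Multiplying on the right by one more linear factor gives the coefficients the recurrence
  of \<open>elem_sym_Suc\<close>: the increasing order inside each monomial is the order of the
  factors.\<close>

lemma coeff_prod_linear_factors:
  assumes "\<And>i. i \<in> {1..k} \<Longrightarrow> x i \<in> carrier R"
  shows "up_ring.coeff (UP R) (ordered_prod (UP R) k
      (\<lambda>i. up_ring.monom (UP R) \<one> 1 \<ominus>\<^bsub>UP R\<^esub> up_ring.monom (UP R) (x i) 0)) d =
    (if d \<le> k then if even (k - d) then elem_sym R k (k - d) x else \<ominus> elem_sym R k (k - d) x else \<zero>)"
  using assms
proof (induction k arbitrary: d)
  case 0
  interpret P: UP_ring R "UP R" by unfold_locales simp
  show ?case by (auto simp: elem_sym_0)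
next
  case (Suc k)
  interpret P: UP_ring R "UP R" by unfold_locales simp
  define l where "l = (\<lambda>i. up_ring.monom (UP R) \<one> 1 \<ominus>\<^bsub>UP R\<^esub> up_ring.monom (UP R) (x i) 0)"
  define p where "p = ordered_prod (UP R) k l"
  have p: "p \<in> carrier (UP R)"
    unfolding p_def l_def by (rule P.P.ordered_prod_closed) (use Suc.prems in auto)
  have xs: "x (Suc k) \<in> carrier R" by (rule Suc.prems) simp
  have E: "elem_sym R k i x \<in> carrier R" for i by (rule elem_sym_closed) (use Suc.prems in auto)
  have e: "elem_sym R (Suc k) (Suc i) x = elem_sym R k (Suc i) x \<oplus> elem_sym R k i x \<otimes> x (Suc k)" for i
    by (rule elem_sym_Suc) (rule Suc.prems)
  have IH: "up_ring.coeff (UP R) p d = (if d \<le> k then if even (k - d) then elem_sym R k (k - d) x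
      else \<ominus> elem_sym R k (k - d) x else \<zero>)" for d
    unfolding p_def l_def by (rule Suc.IH) (use Suc.prems in auto)
  have "ordered_prod (UP R) (Suc k) l = p \<otimes>\<^bsub>UP R\<^esub> l (Suc k)"
    unfolding p_def l_def by (rule P.P.ordered_prod_Suc) (use Suc.prems in auto)
  also have "\<dots> = p \<otimes>\<^bsub>UP R\<^esub> up_ring.monom (UP R) \<one> 1 \<ominus>\<^bsub>UP R\<^esub> p \<otimes>\<^bsub>UP R\<^esub> up_ring.monom (UP R) (x (Suc k)) 0"
    unfolding l_def using p xs by (simp add: a_minus_def P.P.r_distr P.P.r_minus)
  finally have *: "up_ring.coeff (UP R) (ordered_prod (UP R) (Suc k) l) d =
     (if 1 \<le> d then up_ring.coeff (UP R) p (d - 1) else \<zero>) \<ominus> up_ring.coeff (UP R) p d \<otimes> x (Suc k)"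
    using p xs P.coeff_closed[OF p] by (simp add: coeff_mult_monom_right del: P.coeff_mult)
  \<comment> \<open>Only for \<open>0 < d \<le> k\<close> do both terms of the recurrence
    contribute.\<close>
  consider "d = 0" | "d = Suc k" | "d > Suc k" | i where "d = Suc i" "i < k"
    by (cases d) (force simp: not_less[symmetric])+
  then show ?case
  proof cases
    case 1
    have "elem_sym R k (Suc k) x = \<zero>" by (rule elem_sym_eq_0) simp
    then show ?thesis
      unfolding l_def[symmetric] *
      using 1 xs E[of k] by (simp add: IH e a_minus_def l_minus)
  next
    case 2
    then show ?thesis
      unfolding l_def[symmetric] * using xs by (simp add: IH elem_sym_0 a_minus_def)
  next
    case 3
    then show ?thesis
      unfolding l_def[symmetric] * using xs by (auto simp: IH a_minus_def)
  next
    case 4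
    then obtain m where m: "k = Suc (i + m)" using less_imp_Suc_add by blast
    have ki: "k - i = Suc m" "k - Suc i = m" by (simp_all add: m)
    have mc: "elem_sym R k m x \<otimes> x (Suc k) \<in> carrier R" using xs E by simp
    have c1: "up_ring.coeff (UP R) p (d - 1) =
        (if even (Suc m) then elem_sym R k (Suc m) x else \<ominus> elem_sym R k (Suc m) x)"
      and c2: "up_ring.coeff (UP R) p d = (if even m then elem_sym R k m x else \<ominus> elem_sym R k m x)"
      using 4 ki by (simp_all add: IH)
    have dk: "Suc k - d = Suc m" "1 \<le> d" "d \<le> Suc k" using 4 ki by auto
    have "up_ring.coeff (UP R) (ordered_prod (UP R) (Suc k) l) d =
      (if even (Suc m) then elem_sym R (Suc k) (Suc m) x else \<ominus> elem_sym R (Suc k) (Suc m) x)"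
      unfolding * c1 c2 e using dk xs E[of m] E[of "Suc m"] mc
      by (cases "even m") (simp_all add: a_minus_def l_minus minus_add)
    then show ?thesis
      unfolding l_def[symmetric] using dk by simp
  qed
qed

end

section \<open>The universal splitting ring as a quotient of the polynomial ring\<close>

lemma mpoly_ring_simps [simp]:
  "mult (mpoly_ring n) = (*)" "one (mpoly_ring n) = 1" "zero (mpoly_ring n) = 0" "add (mpoly_ring n) = (+)"
  by (simp_all add: mpoly_ring_def)

lemma ring_mpoly_ring: "ring (mpoly_ring n :: 'a::ring_1 mpoly ring)"
proof (rule ringI)
  show "abelian_group (mpoly_ring n :: 'a mpoly ring)"
  proof (rule abelian_groupI)
    fix p :: "'a mpoly" assume "p \<in> carrier (mpoly_ring n)"
    then show "\<exists>q\<in>carrier (mpoly_ring n). q \<oplus>\<^bsub>mpoly_ring n\<^esub> p = \<zero>\<^bsub>mpoly_ring n\<^esub>"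
      by (intro bexI[of _ "- p"]) (auto intro: mpoly_carrier_uminus)
  qed (auto intro: mpoly_carrier_add mpoly_carrier_0 simp: algebra_simps)
  show "Group.monoid (mpoly_ring n :: 'a mpoly ring)"
    by (rule monoidI) (auto intro: mpoly_carrier_mult mpoly_carrier_1 simp: mult.assoc)
qed (auto simp: algebra_simps)

lemma mpoly_carrier_power: "p \<in> carrier (mpoly_ring k) \<Longrightarrow> p ^ i \<in> carrier (mpoly_ring k)"
  by (induction i) (auto intro: mpoly_carrier_1 mpoly_carrier_mult)

section \<open>Closure properties of ideals of the polynomial ring\<close>

context
  fixes n :: nat and I :: "'a::ring_1 mpoly set"
  assumes I: "ideal I (mpoly_ring n)"
begin

lemma mpoly_ideal_carrier: "p \<in> I \<Longrightarrow> p \<in> carrier (mpoly_ring n)"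
  using ideal.Icarr[OF I] .

lemma mpoly_ideal_0: "0 \<in> I"
  using additive_subgroup.zero_closed[OF ideal.axioms(1)[OF I]] by simp

lemma mpoly_ideal_add: "p \<in> I \<Longrightarrow> q \<in> I \<Longrightarrow> p + q \<in> I"
  using additive_subgroup.a_closed[OF ideal.axioms(1)[OF I]] by simp

lemma mpoly_ideal_mult_left: "p \<in> I \<Longrightarrow> q \<in> carrier (mpoly_ring n) \<Longrightarrow> q * p \<in> I"
  and mpoly_ideal_mult_right: "p \<in> I \<Longrightarrow> q \<in> carrier (mpoly_ring n) \<Longrightarrow> p * q \<in> I"
  using ideal.I_l_closed[OF I] ideal.I_r_closed[OF I] by simp_all

lemma mpoly_ideal_uminus: "p \<in> I \<Longrightarrow> - p \<in> I"
  using mpoly_ideal_mult_left[of p "- 1"] by (simp add: mpoly_carrier_uminus mpoly_carrier_1)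

lemma mpoly_ideal_diff: "p \<in> I \<Longrightarrow> q \<in> I \<Longrightarrow> p - q \<in> I"
  using mpoly_ideal_add[of p "- q"] mpoly_ideal_uminus[of q] by simp

lemma mpoly_ideal_sum: "(\<And>i. i \<in> T \<Longrightarrow> g i \<in> I) \<Longrightarrow> sum g T \<in> I"
  by (induction T rule: infinite_finite_induct) (auto intro: mpoly_ideal_0 mpoly_ideal_add)

end

lemma mpoly_ideal_mult_sum_diff:
  assumes I: "ideal I (mpoly_ring n)"
    and "\<And>i. i \<in> T \<Longrightarrow> p i \<in> carrier (mpoly_ring n)" "\<And>i. i \<in> T \<Longrightarrow> q i - r i \<in> I"
  shows "(\<Sum>i\<in>T. p i * q i) - (\<Sum>i\<in>T. p i * r i) \<in> I"
proof -
  have "(\<Sum>i\<in>T. p i * (q i - r i)) \<in> I"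
    using assms by (intro mpoly_ideal_sum[OF I] mpoly_ideal_mult_left[OF I]) auto
  then show ?thesis by (simp add: right_diff_distrib sum_subtractf)
qed

text \<open>The first argument only fixes the ambient ring, so that the number \<open>k\<close> of
  variables can vary inside one ring.\<close>

definition esym :: "nat \<Rightarrow> nat \<Rightarrow> nat \<Rightarrow> 'a::ring_1 mpoly" where
  "esym n k i = elem_sym (mpoly_ring n) k i mvar"

lemma esym_0: "esym n k 0 = 1"
  using ring.elem_sym_0[OF ring_mpoly_ring] by (simp add: esym_def)

lemma esym_eq_0: "k < i \<Longrightarrow> esym n k i = 0"
  using ring.elem_sym_eq_0[OF ring_mpoly_ring] by (simp add: esym_def)

lemma esym_carrier: "k \<le> n \<Longrightarrow> esym n k i \<in> carrier (mpoly_ring n)"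
  unfolding esym_def
  by (rule ring.elem_sym_closed[OF ring_mpoly_ring]) (auto intro: mpoly_carrier_mvar)

lemma esym_Suc: "k < n \<Longrightarrow> esym n (Suc k) (Suc i) = esym n k (Suc i) + esym n k i * mvar (Suc k)"
  unfolding esym_def
  by (subst ring.elem_sym_Suc[OF ring_mpoly_ring]) (auto intro: mpoly_carrier_mvar)

text \<open>The coefficient of Z^(n-j) in f. The value 0 beyond \<open>n\<close> turns the
  coefficients into a power series, so that the partial quotients obey one recurrence for all
  indices.\<close>

definition signed_coeff :: "nat \<Rightarrow> (nat \<Rightarrow> 'a::ring_1) \<Rightarrow> nat \<Rightarrow> 'a" where
  "signed_coeff n a j = (if j = 0 then 1 else if j \<le> n then (- 1) ^ j * a j else 0)"

text \<open>For \<open>j \<le> n - k\<close>, the coefficient of \<open>Z\<^sup>n\<^sup>-\<^sup>k\<^sup>-\<^sup>j\<close> in the quotient of \<open>f(Z)\<close> by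
  \<open>(Z - X\<^sub>1) \<cdots> (Z - X\<^sub>k)\<close>, computed by synthetic division; for \<open>k > 0\<close> and \<open>j = n - k + 1\<close>
  this is the remainder of the last division. In general it is the coefficient of \<open>T\<^sup>j\<close> in the power
  series \<open>(\<Sum>\<^sub>i (-1)\<^sup>i a\<^sub>i T\<^sup>i) / \<Prod>\<^sub>i\<^sub>\<le>\<^sub>k (1 - X\<^sub>i T)\<close>.\<close>

fun cofac :: "nat \<Rightarrow> (nat \<Rightarrow> 'a::ring_1) \<Rightarrow> nat \<Rightarrow> nat \<Rightarrow> 'a mpoly" where
  "cofac n a 0 j = mconst (signed_coeff n a j)"
| "cofac n a (Suc k) 0 = 1"
| "cofac n a (Suc k) (Suc j) = cofac n a k (Suc j) + mvar (Suc k) * cofac n a (Suc k) j"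

lemma cofac_0_right [simp]: "cofac n a k 0 = 1"
  by (cases k) (auto simp: signed_coeff_def)

text \<open>Dividing the series by 1 - X_(k+1) T is convolution with the geometric series in X_(k+1)
  T.\<close>

lemma cofac_Suc_expand:
  "cofac n a (Suc k) j = (\<Sum>i\<le>j. mvar (Suc k) ^ (j - i) * cofac n a k i)"
proof (induction j)
  case (Suc j)
  have "mvar (Suc k) * (\<Sum>i\<le>j. mvar (Suc k) ^ (j - i) * cofac n a k i) =
      (\<Sum>i\<le>j. mvar (Suc k) ^ (Suc j - i) * cofac n a k i)"
    by (simp add: sum_distrib_left Suc_diff_le mult.assoc)
  then show ?case using Suc by simp
qed simp

lemma cofac_carrier: "cofac n a k j \<in> carrier (mpoly_ring k)"
proof (induction n a k j rule: cofac.induct)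
  case (3 n a k j)
  then show ?case
    using mpoly_carrier_mono[of k "Suc k" "cofac n a k (Suc j)"]
    by (auto intro!: mpoly_carrier_add mpoly_carrier_mult mpoly_carrier_mvar)
qed (auto intro: mpoly_carrier_1 mpoly_carrier_mconst)

lemma central_cofac:
  assumes "\<forall>i\<in>{1..n}. central (a i)"
  shows "central (cofac n a k j)"
proof -
  have sgn: "central ((- 1) ^ j :: 'a)" for j by (intro central_power central_uminus central_1)
  show ?thesis
    using assms
  proof (induction n a k j rule: cofac.induct)
    case (1 n a j)
    then show ?case
      using sgn
      by (auto simp: signed_coeff_def central_0 central_1 intro!: central_mconst central_mult)
  qed (auto intro!: central_1 central_add central_mult central_mvar)
qed

text \<open>For \<open>d = n - k\<close> this is f_(k+1) in the form on which \<open>red\<close>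
  operates: monic of degree n - k in X_(k+1), with lower coefficients free of X_(k+1).\<close>

lemma cofac_Suc_monic:
  "cofac n a (Suc k) d = mvar (Suc k) ^ d + (\<Sum>j<d. cofac n a k (d - j) * mvar (Suc k) ^ j)"
proof -
  have "(\<Sum>i\<le>d. mvar (Suc k) ^ (d - i) * cofac n a k i) = (\<Sum>i\<le>d. mvar (Suc k) ^ i * cofac n a k (d - i))"
    by (rule sum.reindex_bij_witness[of _ "\<lambda>i. d - i" "\<lambda>i. d - i"]) auto
  also have "\<dots> = (\<Sum>i<d. mvar (Suc k) ^ i * cofac n a k (d - i)) + mvar (Suc k) ^ d"
    by (simp add: lessThan_Suc_atMost[symmetric])
  also have "(\<Sum>i<d. mvar (Suc k) ^ i * cofac n a k (d - i)) = (\<Sum>i<d. cofac n a k (d - i) * mvar (Suc k) ^ i)"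
    by (intro sum.cong refl centralD[symmetric] central_power central_mvar)
  finally show ?thesis by (simp add: cofac_Suc_expand add.commute)
qed

text \<open>Coefficientwise form of the identity: the product of the 1 - X_i T over i <= k, times
  the series of the \<open>cofac n a k\<close>, is the series of f. The induction cancels one factor
  1 - X_(k+1) T at a time.\<close>

lemma esym_cofac:
  "k \<le> n \<Longrightarrow> (\<Sum>i\<le>j. (- 1) ^ i * esym n k i * cofac n a k (j - i)) = mconst (signed_coeff n a j)"
proof (induction k)
  case 0
  have "(\<Sum>i\<le>j. (- 1) ^ i * esym n 0 i * cofac n a 0 (j - i)) =
      (\<Sum>i\<in>{0}. (- 1) ^ i * esym n 0 i * cofac n a 0 (j - i))"
    by (rule sum.mono_neutral_right) (auto simp: esym_eq_0)
  then show ?case by (simp add: esym_0)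
next
  case (Suc k)
  show ?case
  proof (cases j)
    case 0
    then show ?thesis by (simp add: esym_0 signed_coeff_def)
  next
    case j: (Suc j0)
    let ?X = "mvar (Suc k) :: 'a mpoly"
    let ?c = "\<lambda>i. (- 1) ^ i * esym n k i :: 'a mpoly"
    have X: "x * ?X = ?X * x" for x by (rule centralD[OF central_mvar])
    have "(\<Sum>i\<le>Suc j0. (- 1) ^ i * esym n (Suc k) i * cofac n a (Suc k) (Suc j0 - i)) =
        cofac n a (Suc k) (Suc j0) +
        (\<Sum>i\<le>j0. - ((- 1) ^ i * (esym n k (Suc i) + esym n k i * ?X) * cofac n a (Suc k) (j0 - i)))"
      using \<open>Suc k \<le> n\<close> by (subst sum.atMost_Suc_shift) (simp add: esym_0 esym_Suc)
    also have "\<dots> = (cofac n a (Suc k) (Suc j0) + (\<Sum>i\<le>j0. ?c (Suc i) * cofac n a (Suc k) (j0 - i)))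
        - (\<Sum>i\<le>j0. ?c i * ?X * cofac n a (Suc k) (j0 - i))"
      by (simp add: algebra_simps sum.distrib sum_negf sum_subtractf)
    also have "cofac n a (Suc k) (Suc j0) + (\<Sum>i\<le>j0. ?c (Suc i) * cofac n a (Suc k) (j0 - i)) =
        (\<Sum>i\<le>Suc j0. ?c i * cofac n a (Suc k) (Suc j0 - i))"
      by (subst sum.atMost_Suc_shift) (simp add: esym_0)
    also have "\<dots> = (\<Sum>i\<le>j0. ?c i * cofac n a (Suc k) (Suc (j0 - i))) + ?c (Suc j0)"
      by (simp add: Suc_diff_le)
    \<comment> \<open>The recurrence of \<open>cofac\<close> produces the very sum in
      \<open>?X\<close> that is subtracted, so only the terms for \<open>k\<close> remain.\<close>
    also have "\<dots> = (\<Sum>i\<le>j0. ?c i * cofac n a k (Suc (j0 - i))) + ?c (Suc j0)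
        + (\<Sum>i\<le>j0. ?c i * ?X * cofac n a (Suc k) (j0 - i))"
      by (simp add: distrib_left sum.distrib mult.assoc)
    also have "(\<Sum>i\<le>j0. ?c i * cofac n a k (Suc (j0 - i))) + ?c (Suc j0) =
        (\<Sum>i\<le>Suc j0. ?c i * cofac n a k (Suc j0 - i))"
      by (simp add: Suc_diff_le)
    also have "\<dots> = mconst (signed_coeff n a (Suc j0))"
      using Suc.IH Suc.prems j by simp
    finally show ?thesis using j by simp
  qed
qed

subsection \<open>Two generating systems of the splitting ideal\<close>

lemma minus_one_power_carrier: "(- 1) ^ i \<in> carrier (mpoly_ring n)"
  by (intro mpoly_carrier_power mpoly_carrier_uminus mpoly_carrier_1)

lemma minus_one_power_mconst: "(- 1) ^ i = (mconst ((- 1) ^ i) :: 'a::ring_1 mpoly)"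
  by (induction i) (auto simp: mconst_mult mconst_uminus)

text \<open>At \<open>k = n\<close>, the terms (-1)^j \<sigma>_j and (-1)^j a_j of
  \<open>esym_cofac\<close> agree modulo I, both being read as 0 for \<open>j > n\<close>; the
  identity then expresses the quotient of index \<open>j\<close> through those of smaller positive
  index. Going down in \<open>k\<close>, the recurrence is solved for the quotient with one factor
  fewer.\<close>

lemma cofac_in_ideal_of_esym:
  assumes I: "ideal I (mpoly_ring n)"
    and gen: "\<And>i. i \<in> {1..n} \<Longrightarrow> esym n n i - mconst (a i) \<in> I"
  shows "k \<le> n \<Longrightarrow> n - k < j \<Longrightarrow> cofac n a k j \<in> I"
proof (induction arbitrary: j rule: inc_induct)
  case base
  show ?case
    using \<open>n - n < j\<close>
  proof (induction j rule: less_induct)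
    case (less j)
    let ?t = "\<lambda>i. (- 1) ^ i * esym n n i * cofac n a n (j - i)"
    have "{..j} = insert 0 (insert j {1..<j})" using less.prems by auto
    then have eq: "mconst (signed_coeff n a j) = cofac n a n j + ((- 1) ^ j * esym n n j + sum ?t {1..<j})"
      using esym_cofac[where k = n and n = n and j = j and a = a] less.prems by (simp add: esym_0)
    have "mconst (signed_coeff n a j) - (- 1) ^ j * esym n n j \<in> I"
    proof (cases "j \<le> n")
      case True
      have "- ((- 1) ^ j) * (esym n n j - mconst (a j)) \<in> I"
        using gen[of j] True less.prems
        by (intro mpoly_ideal_mult_left[OF I] mpoly_carrier_uminus minus_one_power_carrier) auto
      then show ?thesis
        using True less.prems
        by (simp add: signed_coeff_def mconst_mult minus_one_power_mconst algebra_simps)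
    next
      case False
      then show ?thesis by (simp add: signed_coeff_def esym_eq_0 mpoly_ideal_0[OF I])
    qed
    moreover have "sum ?t {1..<j} \<in> I"
      using less.IH
      by (intro mpoly_ideal_sum[OF I] mpoly_ideal_mult_left[OF I] mpoly_carrier_mult
          minus_one_power_carrier esym_carrier) auto
    moreover have "cofac n a n j = (mconst (signed_coeff n a j) - (- 1) ^ j * esym n n j) - sum ?t {1..<j}"
      using eq by (simp only: diff_diff_eq eq_diff_eq)
    ultimately show ?case
      by (simp only:) (rule mpoly_ideal_diff[OF I])
  qed
next
  case (step k)
  then obtain i where j: "j = Suc i" by (cases j) auto
  have "mvar (Suc k) * cofac n a (Suc k) i \<in> I" "cofac n a (Suc k) (Suc i) \<in> I"
    by (rule mpoly_ideal_mult_left[OF I] mpoly_carrier_mvar step.IH; use step j in simp)+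
  from mpoly_ideal_diff[OF I this(2,1)] show ?case by (simp add: j)
qed

text \<open>Each remainder f_(k+1) starts an induction on the index that puts all later coefficients
  for \<open>Suc k\<close> into I. At \<open>k = n\<close> this covers every positive index, so that
  modulo I only the last term (-1)^i \<sigma>_i of \<open>esym_cofac\<close> survives.\<close>

lemma esym_in_ideal_of_cofac:
  assumes I: "ideal I (mpoly_ring n)"
    and gen: "\<And>k. k < n \<Longrightarrow> cofac n a (Suc k) (n - k) \<in> I"
    and i: "i \<in> {1..n}"
  shows "esym n n i - mconst (a i) \<in> I"
proof -
  have cof: "cofac n a k j \<in> I" if "k \<le> n" "n - k < j" for k j
    using that
  proof (induction k arbitrary: j)
    case 0
    then show ?case by (simp add: signed_coeff_def mpoly_ideal_0[OF I])
  next
    case (Suc k)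
    from \<open>n - Suc k < j\<close> show ?case
    proof (induction j)
      case (Suc j)
      show ?case
      proof (cases "n - Suc k < j")
        case True
        then have "cofac n a k (Suc j) \<in> I" using Suc.prems \<open>Suc k \<le> n\<close>
          by (intro \<open>\<And>j. k \<le> n \<Longrightarrow> n - k < j \<Longrightarrow> cofac n a k j \<in> I\<close>) auto
        then show ?thesis
          using Suc.IH[OF True] \<open>Suc k \<le> n\<close>
          by (auto intro!: mpoly_ideal_add[OF I] mpoly_ideal_mult_left[OF I] mpoly_carrier_mvar)
      next
        case False
        then have "Suc j = n - k" using Suc.prems \<open>Suc k \<le> n\<close> by auto
        then show ?thesis using gen[of k] \<open>Suc k \<le> n\<close> by (metis Suc_le_eq)
      qed
    qed simp
  qed
  let ?t = "\<lambda>j. (- 1) ^ j * esym n n j * cofac n a n (i - j)"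
  have "sum ?t {..<i} \<in> I"
    by (intro mpoly_ideal_sum[OF I] mpoly_ideal_mult_left[OF I] mpoly_carrier_mult
        minus_one_power_carrier esym_carrier cof) auto
  moreover have "sum ?t {..<i} = mconst (signed_coeff n a i) - (- 1) ^ i * esym n n i"
    using esym_cofac[where k = n and n = n and j = i and a = a] by (simp add: lessThan_Suc_atMost[symmetric] algebra_simps)
  ultimately have "mconst (signed_coeff n a i) - (- 1) ^ i * esym n n i \<in> I" by simp
  then have "- ((- 1) ^ i) * (mconst (signed_coeff n a i) - (- 1) ^ i * esym n n i) \<in> I"
    by (intro mpoly_ideal_mult_left[OF I] mpoly_carrier_uminus minus_one_power_carrier)
  moreover have "mconst (signed_coeff n a i) = (- 1) ^ i * mconst (a i)"
    using i by (simp add: signed_coeff_def mconst_mult minus_one_power_mconst)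
  moreover have "(- 1) ^ i * ((- 1) ^ i * q) = (q :: 'a mpoly)" for q
    by (simp add: mult.assoc[symmetric] power_add[symmetric] mult_2[symmetric])
  ultimately show ?thesis by (simp add: right_diff_distrib)
qed

subsection \<open>Independence of the reduced monomials\<close>

text \<open>The highest variable is reduced first; \<open>n - k\<close> is the degree of f_(k+1) in
  its own variable.\<close>

fun normal :: "nat \<Rightarrow> (nat \<Rightarrow> 'a::ring_1) \<Rightarrow> nat \<Rightarrow> 'a mpoly \<Rightarrow> 'a mpoly" where
  "normal n a 0 p = p"
| "normal n a (Suc k) p =
    normal n a k (red (n - k) (\<lambda>j. cofac n a k (n - k - j)) (Suc k) p)"

lemma red_add: "red d F k (p + q) = red d F k p + red d F k q"
  by (simp add: red_def linext_add)

lemma red_0 [simp]: "red d F k 0 = 0"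
  by (simp add: red_def)

lemma normal_add: "normal n a k (p + q) = normal n a k p + normal n a k q"
  by (induction k arbitrary: p q) (auto simp: red_add)

lemma normal_0 [simp]: "normal n a k 0 = 0"
  by (induction k) auto

lemma mpoly_carrier_free: "p \<in> carrier (mpoly_ring k) \<Longrightarrow> m \<in> supp p \<Longrightarrow> k < i \<Longrightarrow> lkp m i = 0"
  unfolding mpoly_ring_carrier by (metis atLeastAtMost_iff in_keys_iff leD subsetD)

text \<open>f_(k+1) is free of the variables above X_(k+1), so it is carried as a left factor
  through their divisions until the division by f_(k+1) itself yields 0.\<close>

lemma normal_cofac_mult:
  assumes "\<forall>i\<in>{1..n}. central (a i)"
  shows "k < l \<Longrightarrow> normal n a l (cofac n a (Suc k) (n - k) * p) = 0"
proof (induction l arbitrary: p)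
  case (Suc l)
  let ?F = "\<lambda>j. cofac n a l (n - l - j)"
  show ?case
  proof (cases "k = l")
    case True
    have "red (n - l) ?F (Suc l) (cofac n a (Suc l) (n - l) * p) = 0"
      unfolding cofac_Suc_monic
      by (rule red_monic_mult)
        (auto intro: central_cofac[OF assms] mpoly_carrier_free[OF cofac_carrier])
    then show ?thesis using True by simp
  next
    case False
    have "red (n - l) ?F (Suc l) (cofac n a (Suc k) (n - k) * p) =
        cofac n a (Suc k) (n - k) * red (n - l) ?F (Suc l) p"
    proof (rule red_mult_free)
      fix b assume "b \<in> supp (cofac n a (Suc k) (n - k))"
      then show "lkp b (Suc l) = 0"
        by (rule mpoly_carrier_free[OF cofac_carrier]) (use False Suc.prems in simp)
    qed
    then show ?thesis using Suc.IH False Suc.prems by simp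
  qed
qed simp

text \<open>The bounds depend on \<open>n\<close> only, so that an induction on \<open>k\<close>
  adds one variable without changing the earlier conditions.\<close>

definition box :: "nat \<Rightarrow> nat \<Rightarrow> (nat \<Rightarrow>\<^sub>0 nat) set" where
  "box n k = {m. supp m \<subseteq> {1..k} \<and> (\<forall>i\<in>{1..k}. lkp m i \<le> n - i)}"

lemma normal_id: "k \<le> n \<Longrightarrow> supp p \<subseteq> box n n \<Longrightarrow> normal n a k p = p"
proof (induction k)
  case (Suc k)
  have "red (n - k) (\<lambda>j. cofac n a k (n - k - j)) (Suc k) p = p"
  proof (rule red_id)
    fix m assume "m \<in> supp p"
    then have "lkp m (Suc k) \<le> n - Suc k" using Suc.prems by (auto simp: box_def)
    then show "lkp m (Suc k) < n - k" using Suc.prems by linarith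
  qed
  then show ?case using Suc by simp
qed simp

lemma splitting_ideal_ideal: "ideal (splitting_ideal n a) (mpoly_ring n)"
proof -
  have "(\<lambda>i. elem_sym (mpoly_ring n) n i mvar - mconst (a i)) ` {1..n} \<subseteq> carrier (mpoly_ring n)"
    using esym_carrier[of n n] by (auto simp: esym_def intro!: mpoly_carrier_diff mpoly_carrier_mconst)
  then show ?thesis
    unfolding splitting_ideal_def by (rule ring.genideal_ideal[OF ring_mpoly_ring])
qed

lemma splitting_ideal_gen:
  assumes "i \<in> {1..n}" shows "esym n n i - mconst (a i) \<in> splitting_ideal n a"
proof -
  have "(\<lambda>i. elem_sym (mpoly_ring n) n i mvar - mconst (a i)) ` {1..n} \<subseteq> carrier (mpoly_ring n)"
    using esym_carrier[of n n] by (auto simp: esym_def intro!: mpoly_carrier_diff mpoly_carrier_mconst)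
  from ring.genideal_self[OF ring_mpoly_ring this] show ?thesis
    using assms unfolding splitting_ideal_def esym_def by blast
qed

lemma splitting_ideal_minimal:
  assumes "ideal I (mpoly_ring n)" "\<And>i. i \<in> {1..n} \<Longrightarrow> esym n n i - mconst (a i) \<in> I"
  shows "splitting_ideal n a \<subseteq> I"
  unfolding splitting_ideal_def
  by (rule ring.genideal_minimal[OF ring_mpoly_ring assms(1)]) (use assms(2) in \<open>auto simp: esym_def\<close>)

lemma cofac_in_splitting_ideal: "k \<le> n \<Longrightarrow> n - k < j \<Longrightarrow> cofac n a k j \<in> splitting_ideal n a"
  by (rule cofac_in_ideal_of_esym[OF splitting_ideal_ideal]) (auto intro: splitting_ideal_gen)

theorem box_independent:
  assumes cent: "\<forall>i\<in>{1..n}. central (a i)"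
    and p: "p \<in> splitting_ideal n a" "supp p \<subseteq> box n n"
  shows "p = 0"
proof -
  \<comment> \<open>Closing the kernel of \<open>normal\<close> under multiplication makes it an ideal for free.\<close>
  define K where "K = {p \<in> carrier (mpoly_ring n). \<forall>g h. normal n a n (g * p * h) = 0}"
  have "ideal K (mpoly_ring n)"
  proof (rule idealI[OF ring_mpoly_ring])
    show "subgroup K (add_monoid (mpoly_ring n))"
    proof (rule group.subgroupI)
      show "group (add_monoid (mpoly_ring n :: 'a mpoly ring))"
        using abelian_group.a_group[OF ring.is_abelian_group[OF ring_mpoly_ring]] .
      show "K \<subseteq> carrier (add_monoid (mpoly_ring n))" by (auto simp: K_def)
      show "K \<noteq> {}" by (auto simp: K_def intro!: exI[of _ 0] mpoly_carrier_0)
      fix p assume p: "p \<in> K"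
      interpret ring "mpoly_ring n :: 'a mpoly ring" by (rule ring_mpoly_ring)
      have "inv\<^bsub>add_monoid (mpoly_ring n)\<^esub> p = \<ominus>\<^bsub>mpoly_ring n\<^esub> p" by (simp add: a_inv_def)
      also have "\<dots> = - p"
        using p by (intro minus_equality) (auto simp: K_def intro: mpoly_carrier_uminus)
      finally have *: "inv\<^bsub>add_monoid (mpoly_ring n)\<^esub> p = - p" .
      have "normal n a n (g * (- p) * h) = 0" for g h
        using p by (simp add: K_def) (metis (no_types, lifting) minus_mult_commute mult_minus_left)
      then show "inv\<^bsub>add_monoid (mpoly_ring n)\<^esub> p \<in> K"
        unfolding * using p by (auto simp: K_def intro: mpoly_carrier_uminus)
    qed (auto simp: K_def distrib_left distrib_right normal_add intro: mpoly_carrier_add)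
    show "x \<otimes>\<^bsub>mpoly_ring n\<^esub> q \<in> K" "q \<otimes>\<^bsub>mpoly_ring n\<^esub> x \<in> K"
      if "q \<in> K" "x \<in> carrier (mpoly_ring n)" for q x
    proof -
      have "g * (x * q) * h = (g * x) * q * h" "g * (q * x) * h = g * q * (x * h)" for g h
        by (simp_all add: mult.assoc)
      then show "x \<otimes>\<^bsub>mpoly_ring n\<^esub> q \<in> K" "q \<otimes>\<^bsub>mpoly_ring n\<^esub> x \<in> K"
        using that unfolding K_def by (auto intro: mpoly_carrier_mult simp only: mpoly_ring_simps mem_Collect_eq)
    qed
  qed
  moreover have "cofac n a (Suc k) (n - k) \<in> K" if "k < n" for k
  proof -
    \<comment> \<open>Being central, f_(k+1) moves to the front of the two-sided product, where
      \<open>normal_cofac_mult\<close> applies.\<close>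
    have "normal n a n (g * cofac n a (Suc k) (n - k) * h) = 0" for g h
      using normal_cofac_mult[OF cent that, of "g * h"] centralD[OF central_cofac[OF cent]]
      by (metis mult.assoc)
    then show ?thesis
      using that mpoly_carrier_mono[OF _ cofac_carrier, of "Suc k" n] by (simp add: K_def del: cofac.simps)
  qed
  ultimately have "splitting_ideal n a \<subseteq> K"
    by (intro splitting_ideal_minimal) (auto intro: esym_in_ideal_of_cofac)
  then have "p \<in> K" using p by blast
  then have "normal n a n (1 * p * 1) = 0" unfolding K_def by blast
  then show ?thesis using normal_id[of n n p a] p by simp
qed

subsection \<open>Reduction of monomials with control of the coefficients\<close>

definition coeffs_upto_sign :: "nat \<Rightarrow> (nat \<Rightarrow> 'a::ring_1) \<Rightarrow> 'a set" where
  "coeffs_upto_sign n a = {c. c = 0 \<or> (\<exists>j\<le>n. c = signed_coeff n a j \<or> c = - signed_coeff n a j)}"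

text \<open>What a column of one of the matrices may contain when \<open>k = n\<close>: reduced
  monomials, with coefficients that (iv) allows.\<close>

definition good :: "nat \<Rightarrow> (nat \<Rightarrow> 'a::ring_1) \<Rightarrow> nat \<Rightarrow> 'a mpoly set" where
  "good n a k = {r. range (lkp r) \<subseteq> coeffs_upto_sign n a \<and> supp r \<subseteq> box n k}"

lemma box_carrier: "supp r \<subseteq> box n k \<Longrightarrow> r \<in> carrier (mpoly_ring k)"
  by (auto simp: box_def mpoly_ring_carrier)

lemma good_uminus: "r \<in> good n a k \<Longrightarrow> - r \<in> good n a k"
proof -
  have "- c \<in> coeffs_upto_sign n a" if "c \<in> coeffs_upto_sign n a" for c
    using that by (auto simp: coeffs_upto_sign_def)
  then show "r \<in> good n a k \<Longrightarrow> - r \<in> good n a k"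
    by (auto simp: good_def in_keys_iff image_subset_iff)
qed

lemma lookup_mvar_power_mult:
  assumes "\<And>b. b \<in> supp r \<Longrightarrow> lkp b k = 0"
  shows "lkp (mvar k ^ e * r) m = (if lkp m k = e then lkp r (Poly_Mapping.update k 0 m) else 0)"
proof (rule mpoly_induct[where p = r])
  fix b :: "nat \<Rightarrow>\<^sub>0 nat" and c :: 'a
  assume "b \<in> supp r"
  then have b: "lkp b k = 0" by (rule assms)
  have "sgl k e + b = m \<longleftrightarrow> lkp m k = e \<and> b = Poly_Mapping.update k 0 m"
  proof
    assume "sgl k e + b = m"
    then show "lkp m k = e \<and> b = Poly_Mapping.update k 0 m"
      using b by (auto simp: lookup_add lookup_single lookup_update when_def intro!: poly_mapping_eqI)
  next
    assume "lkp m k = e \<and> b = Poly_Mapping.update k 0 m"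
    then show "sgl k e + b = m" using update_0_add_single[of k m] by (simp add: add.commute)
  qed
  then show "lkp (mvar k ^ e * sgl b c) m =
      (if lkp m k = e then lkp (sgl b c) (Poly_Mapping.update k 0 m) else 0)"
    by (auto simp: mvar_power mult_single lookup_single when_def)
qed (auto simp: lookup_add distrib_left)

text \<open>The summands carry distinct powers of X_(k+1) and are otherwise free of it, so their
  monomials are disjoint and no two coefficients are ever added.\<close>

lemma good_sum:
  assumes r: "\<And>i. i \<in> T \<Longrightarrow> r i \<in> good n a k" and fin: "finite T" and inj: "inj_on e T"
    and e: "\<And>i. i \<in> T \<Longrightarrow> e i \<le> n - Suc k"
  shows "(\<Sum>i\<in>T. mvar (Suc k) ^ e i * r i) \<in> good n a (Suc k)"
proof -
  let ?s = "\<Sum>i\<in>T. mvar (Suc k) ^ e i * r i"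
  have lk: "lkp ?s m = (\<Sum>i\<in>T. if lkp m (Suc k) = e i then lkp (r i) (Poly_Mapping.update (Suc k) 0 m) else 0)" for m
    unfolding lookup_sum
    by (intro sum.cong refl lookup_mvar_power_mult mpoly_carrier_free[OF box_carrier])
      (use r in \<open>auto simp: good_def\<close>)
  have one: "lkp ?s m = 0 \<or> (\<exists>i\<in>T. lkp m (Suc k) = e i \<and> lkp ?s m = lkp (r i) (Poly_Mapping.update (Suc k) 0 m))" for m
  proof (cases "\<exists>i\<in>T. lkp m (Suc k) = e i")
    case True
    then obtain i where i: "i \<in> T" "lkp m (Suc k) = e i" by blast
    have "lkp ?s m = (\<Sum>j\<in>T. if j = i then lkp (r j) (Poly_Mapping.update (Suc k) 0 m) else 0)"
      unfolding lk using i inj by (intro sum.cong) (auto dest: inj_onD)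
    then show ?thesis using i fin by auto
  next
    case False
    then have "lkp ?s m = 0" unfolding lk by (intro sum.neutral) auto
    then show ?thesis by blast
  qed
  have "lkp ?s m \<in> coeffs_upto_sign n a" for m
    using one[of m] r by (auto simp: good_def coeffs_upto_sign_def)
  moreover have "m \<in> box n (Suc k)" if "m \<in> supp ?s" for m
  proof -
    have "lkp ?s m \<noteq> 0" using that by (simp only: in_keys_iff not_False_eq_True)
    then obtain i where i: "i \<in> T" "lkp m (Suc k) = e i" "lkp (r i) (Poly_Mapping.update (Suc k) 0 m) \<noteq> 0"
      using one[of m] by auto
    then have "Poly_Mapping.update (Suc k) 0 m \<in> box n k"
      using r[OF i(1)] by (auto simp: good_def in_keys_iff)
    then have u: "supp m - {Suc k} \<subseteq> {1..k}" "\<forall>j\<in>{1..k}. lkp m j \<le> n - j"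
      by (auto simp: box_def lookup_update keys_update)
    then have "supp m \<subseteq> insert (Suc k) {1..k}" by blast
    then have "supp m \<subseteq> {1..Suc k}" by auto
    then show ?thesis using u e[OF i(1)] i(2) by (auto simp: box_def le_Suc_eq)
  qed
  ultimately show ?thesis by (auto simp: good_def)
qed

text \<open>When \<open>e + j\<close> is too large, \<open>X\<^sub>k\<^sub>+\<^sub>1\<^sup>e\<close> times the leading segment of \<open>f\<^sub>k\<^sub>+\<^sub>1\<close> up to \<open>j\<close> is
  replaced by minus the complementary segment.\<close>

lemma reduce_step:
  assumes IH: "\<And>b j. b \<in> box n k \<Longrightarrow> j \<le> n - k \<Longrightarrow>
      \<exists>r\<in>good n a k. xmon b * cofac n a k j - r \<in> splitting_ideal n a"
    and k: "k < n" and b: "b \<in> box n k" and ej: "n - Suc k < e + j" and jk: "j \<le> n - Suc k"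
    and e: "e \<le> n - Suc k \<or> j = 0 \<and> e = n - k"
  shows "\<exists>r\<in>good n a (Suc k). mvar (Suc k) ^ e * (xmon b * cofac n a (Suc k) j) - r \<in> splitting_ideal n a"
proof -
  let ?X = "mvar (Suc k) :: 'a mpoly"
  let ?c = "\<lambda>i. xmon b * cofac n a k i"
  define T where "T = {j<..n - k}"
  note I = splitting_ideal_ideal[of n a]
  obtain r where r: "r i \<in> good n a k" "?c i - r i \<in> splitting_ideal n a" if "i \<le> n - k" for i
    using IH[OF b] by metis
  let ?r = "\<Sum>i\<in>T. ?X ^ (e + j - i) * (- r i)"
  have X: "?X \<in> carrier (mpoly_ring n)" using k by (intro mpoly_carrier_mvar) auto
  have Xc: "xmon b * (?X ^ i * p) = ?X ^ i * (xmon b * p)" for i p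
    by (rule central_left_commute[OF central_power[OF central_mvar]])
  have good: "?r \<in> good n a (Suc k)"
  proof (rule good_sum)
    \<comment> \<open>Subtraction does not truncate here, since i <= n - k <= e + j on
      \<open>T\<close>. As i > j, the exponent lies below \<open>e\<close>, which leaves room for e
      = n - k.\<close>
    show "inj_on (\<lambda>i. e + j - i) T" using ej by (intro inj_onI) (auto simp: T_def)
    show "e + j - i \<le> n - Suc k" if "i \<in> T" for i using that e by (auto simp: T_def)
  qed (auto simp: T_def intro: good_uminus r)
  \<comment> \<open>This multiple of f_(k+1) is shifted so that its terms with index up to
    \<open>j\<close> form the product to be reduced.\<close>
  have f: "?X ^ (e + j - (n - k)) * xmon b * cofac n a (Suc k) (n - k) \<in> splitting_ideal n a"
    using k b by (intro mpoly_ideal_mult_left[OF I] cofac_in_splitting_ideal mpoly_carrier_mult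
        mpoly_carrier_power X mpoly_carrier_single) (auto simp: box_def)
  have "?X ^ (e + j - (n - k)) * xmon b * cofac n a (Suc k) (n - k) = (\<Sum>i\<le>n - k. ?X ^ (e + j - i) * ?c i)"
    unfolding cofac_Suc_expand sum_distrib_left mult.assoc Xc
    using ej k by (intro sum.cong) (auto simp: mult.assoc[symmetric] power_add[symmetric])
  also have "{..n - k} = {..j} \<union> T" using jk k by (auto simp: T_def)
  also have "(\<Sum>i\<in>{..j} \<union> T. ?X ^ (e + j - i) * ?c i) =
      (\<Sum>i\<le>j. ?X ^ (e + j - i) * ?c i) + (\<Sum>i\<in>T. ?X ^ (e + j - i) * ?c i)"
    by (rule sum.union_disjoint) (auto simp: T_def)
  also have "(\<Sum>i\<le>j. ?X ^ (e + j - i) * ?c i) = ?X ^ e * (xmon b * cofac n a (Suc k) j)"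
    unfolding cofac_Suc_expand sum_distrib_left Xc
    by (intro sum.cong) (auto simp: mult.assoc[symmetric] power_add[symmetric])
  finally have eq: "?X ^ e * (xmon b * cofac n a (Suc k) j) =
      ?X ^ (e + j - (n - k)) * xmon b * cofac n a (Suc k) (n - k) - (\<Sum>i\<in>T. ?X ^ (e + j - i) * ?c i)"
    by (simp only: eq_diff_eq)
  have "(\<Sum>i\<in>T. ?X ^ (e + j - i) * ?c i) - (\<Sum>i\<in>T. ?X ^ (e + j - i) * r i) \<in> splitting_ideal n a"
    by (rule mpoly_ideal_mult_sum_diff[OF I]) (auto simp: T_def intro: r mpoly_carrier_power X)
  from mpoly_ideal_diff[OF I f this]
  have "?X ^ e * (xmon b * cofac n a (Suc k) j) - ?r \<in> splitting_ideal n a"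
    unfolding eq by (simp add: sum_negf algebra_simps)
  then show ?thesis using good by blast
qed

lemma box_Suc:
  assumes "m \<in> box n (Suc k)"
  shows "Poly_Mapping.update (Suc k) 0 m \<in> box n k" "lkp m (Suc k) \<le> n - Suc k"
    "xmon m = mvar (Suc k) ^ lkp m (Suc k) * xmon (Poly_Mapping.update (Suc k) 0 m)"
proof -
  show "lkp m (Suc k) \<le> n - Suc k" using assms by (auto simp: box_def)
  have "i \<in> {1..k}" if "i \<in> supp m" "i \<noteq> Suc k" for i
    using that assms by (fastforce simp: box_def le_Suc_eq)
  then show "Poly_Mapping.update (Suc k) 0 m \<in> box n k"
    using assms by (auto simp: box_def lookup_update keys_update)
  show "xmon m = mvar (Suc k) ^ lkp m (Suc k) * xmon (Poly_Mapping.update (Suc k) 0 m)"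
    using update_0_add_single[of "Suc k" m] by (simp add: mvar_power mult_single add.commute)
qed

text \<open>A claim about monomials alone would not be inductive: expanding in X_(k+1) leaves lower
  monomials times partial quotients for \<open>k\<close>, so these products are what must be
  reduced. For \<open>k = 0\<close> they are single coefficients of f.\<close>

lemma reduce_cofac:
  "k \<le> n \<Longrightarrow> b \<in> box n k \<Longrightarrow> j \<le> n - k \<Longrightarrow>
    \<exists>r\<in>good n a k. xmon b * cofac n a k j - r \<in> splitting_ideal n a"
proof (induction k arbitrary: b j)
  case 0
  then have "b = 0" by (auto simp: box_def)
  moreover have "mconst (signed_coeff n a j) \<in> good n a 0"
    using 0 by (auto simp: good_def mconst_def lookup_single when_def coeffs_upto_sign_def box_def)
  ultimately show ?case
    by (intro bexI[of _ "mconst (signed_coeff n a j)"]) (auto simp: mpoly_ideal_0[OF splitting_ideal_ideal])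
next
  case (Suc k)
  note I = splitting_ideal_ideal[of n a]
  let ?X = "mvar (Suc k) :: 'a mpoly"
  define b' where "b' = Poly_Mapping.update (Suc k) 0 b"
  define e where "e = lkp b (Suc k)"
  have b: "b' \<in> box n k" "e \<le> n - Suc k" "xmon b = ?X ^ e * xmon b'"
    unfolding b'_def e_def by (rule box_Suc[OF Suc.prems(2)])+
  have IH: "\<exists>r\<in>good n a k. xmon c * cofac n a k i - r \<in> splitting_ideal n a"
    if "c \<in> box n k" "i \<le> n - k" for c i
    using Suc.IH[OF _ that] Suc.prems(1) by simp
  show ?case
  proof (cases "n - Suc k < e + j")
    case True
    then show ?thesis
      using reduce_step[OF IH _ b(1) True Suc.prems(3)] b(2,3) Suc.prems(1) by (simp add: mult.assoc)
  next
    \<comment> \<open>No power of X_(k+1) in the expansion exceeds n - k - 1, so only its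
      coefficients in the lower variables need reducing.\<close>
    case False
    let ?c = "\<lambda>i. xmon b' * cofac n a k i"
    obtain r where r: "r i \<in> good n a k" "?c i - r i \<in> splitting_ideal n a" if "i \<le> n - k" for i
      using IH[OF b(1)] by metis
    have X: "?X \<in> carrier (mpoly_ring n)" using Suc.prems by (intro mpoly_carrier_mvar) auto
    have Xc: "xmon b' * (?X ^ i * p) = ?X ^ i * (xmon b' * p)" for i p
      by (rule central_left_commute[OF central_power[OF central_mvar]])
    have jk: "i \<le> n - k" if "i \<le> j" for i using that Suc.prems by auto
    have "xmon b * cofac n a (Suc k) j = (\<Sum>i\<le>j. ?X ^ (e + j - i) * ?c i)"
      unfolding cofac_Suc_expand sum_distrib_left b(3) mult.assoc Xc
      by (intro sum.cong) (auto simp: mult.assoc[symmetric] power_add[symmetric])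
    moreover have "(\<Sum>i\<le>j. ?X ^ (e + j - i) * ?c i) - (\<Sum>i\<le>j. ?X ^ (e + j - i) * r i) \<in> splitting_ideal n a"
      by (rule mpoly_ideal_mult_sum_diff[OF I]) (auto intro: r mpoly_carrier_power X jk)
    moreover have "(\<Sum>i\<le>j. ?X ^ (e + j - i) * r i) \<in> good n a (Suc k)"
    proof (rule good_sum)
      show "inj_on (\<lambda>i. e + j - i) {..j}" by (intro inj_onI) auto
    qed (use False in \<open>auto intro: r jk\<close>)
    ultimately show ?thesis by metis
  qed
qed

lemma coeff_0_upto_sign: "0 \<in> coeffs_upto_sign n a" and coeff_1_upto_sign: "1 \<in> coeffs_upto_sign n a"
  by (auto simp: coeffs_upto_sign_def signed_coeff_def intro!: exI[of _ 0])

text \<open>Only an exponent at its bound n - i needs work. The product is split into the variables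
  below X_i, the power X_i^(n-i+1) and the variables above X_i; the reduction takes place in the
  first two parts, and the last one merely shifts exponents.\<close>

theorem reduce_mvar_mult:
  assumes i: "i \<in> {1..n}" and m: "m \<in> box n n"
  shows "\<exists>r\<in>good n a n. mvar i * xmon m - r \<in> splitting_ideal n a"
proof (cases "lkp m i < n - i")
  case True
  have "sgl i 1 + m \<in> box n n"
    using i m True by (auto simp: box_def exps_add lookup_add lookup_single when_def)
  then have "xmon (sgl i 1 + m) \<in> good n a n"
    by (auto simp: good_def lookup_single when_def coeff_0_upto_sign coeff_1_upto_sign)
  then show ?thesis
    by (intro bexI[of _ "xmon (sgl i 1 + m)"])
      (auto simp: mvar_def mult_single mpoly_ideal_0[OF splitting_ideal_ideal])
next
  case False
  note I = splitting_ideal_ideal[of n a]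
  define restr where "restr S = (\<Sum>j\<in>supp m \<inter> S. sgl j (lkp m j))" for S
  have lk: "lkp (restr S) j = (if j \<in> S then lkp m j else 0)" for S j
    by (simp add: restr_def lookup_sum lookup_single when_def sum.delta in_keys_iff)
  obtain k where k: "i = Suc k" "k < n" using i by (cases i) auto
  have mi: "lkp m i = n - i" using False m i by (force simp: box_def)
  define b where "b = restr {..k}"
  define g where "g = restr {i<..}"
  have b: "b \<in> box n k"
    unfolding box_def
  proof (intro CollectI conjI ballI subsetI)
    fix j assume "j \<in> supp b"
    then have "j \<le> k" "j \<in> supp m" by (auto simp: b_def lk in_keys_iff split: if_splits)
    then show "j \<in> {1..k}" using m by (auto simp: box_def)
  next
    fix j assume "j \<in> {1..k}"
    then show "lkp b j \<le> n - j" using m k by (auto simp: b_def lk box_def)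
  qed
  have "sgl i 1 + m = g + (sgl i (n - k) + b)"
  proof (rule poly_mapping_eqI)
    fix j
    show "lkp (sgl i 1 + m) j = lkp (g + (sgl i (n - k) + b)) j"
      by (cases "j = i") (use mi k in \<open>auto simp: lookup_add lookup_single when_def g_def b_def lk\<close>)
  qed
  \<comment> \<open>The trivial quotient \<open>cofac n a (Suc k) 0\<close>, which is 1, is inserted
    to match \<open>reduce_step\<close> with \<open>j = 0\<close> and
    \<open>e = n - k\<close>.\<close>
  then have eq: "mvar i * xmon m = xmon g * (mvar i ^ (n - k) * (xmon b * cofac n a (Suc k) 0))"
    by (simp add: mvar_power) (simp add: mvar_def mult_single)
  have "\<exists>r\<in>good n a (Suc k). mvar (Suc k) ^ (n - k) * (xmon b * cofac n a (Suc k) 0) - r \<in> splitting_ideal n a"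
    by (rule reduce_step[OF reduce_cofac _ b]) (use k in auto)
  then obtain r where r: "r \<in> good n a i"
      "mvar i ^ (n - k) * (xmon b * cofac n a (Suc k) 0) - r \<in> splitting_ideal n a"
    using k by blast
  have "supp g \<subseteq> {1..n}"
    using m by (auto simp: box_def g_def lk in_keys_iff split: if_splits)
  then have "xmon g * (mvar i ^ (n - k) * (xmon b * cofac n a (Suc k) 0) - r) \<in> splitting_ideal n a"
    by (intro mpoly_ideal_mult_left[OF I r(2)] mpoly_carrier_single)
  then have "mvar i * xmon m - xmon g * r \<in> splitting_ideal n a"
    by (simp only: eq right_diff_distrib)
  moreover have "xmon g * r \<in> good n a n"
  proof -
    have "lkp (xmon g * r) m' \<in> coeffs_upto_sign n a \<and> (m' \<in> supp (xmon g * r) \<longrightarrow> m' \<in> box n n)" for m'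
    proof (cases "m' \<in> supp (xmon g * r)")
      case True
      then obtain l where l: "m' = g + l" "l \<in> supp r"
        using supp_single_mult[of g 1 r] by auto
      then have lb: "l \<in> box n i" using r by (auto simp: good_def)
      have "lkp (xmon g * r) m' = lkp r l" by (simp add: l lookup_single_mult)
      moreover have "m' \<in> box n n"
        unfolding box_def l
      proof (intro CollectI conjI ballI)
        show "supp (g + l) \<subseteq> {1..n}"
          using \<open>supp g \<subseteq> {1..n}\<close> lb i by (auto simp: exps_add box_def)
        fix j assume j: "j \<in> {1..n}"
        show "lkp (g + l) j \<le> n - j"
        proof (cases "j \<le> i")
          case True
          then show ?thesis using lb j by (auto simp: lookup_add g_def lk box_def)
        next
          case False
          then have "lkp l j = 0" using lb by (auto simp: box_def in_keys_iff)
          then show ?thesis using m j by (auto simp: lookup_add g_def lk box_def)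
        qed
      qed
      ultimately show ?thesis using r by (auto simp: good_def)
    next
      case False
      then show ?thesis by (simp add: in_keys_iff coeff_0_upto_sign)
    qed
    then show ?thesis by (auto simp: good_def)
  qed
  ultimately show ?thesis by blast
qed

text \<open>Multiplication by a variable is the only case with content: the variable is central, so
  it moves past the coefficients to the reduced monomials, where \<open>reduce_mvar_mult\<close>
  applies.\<close>

theorem box_spanning:
  assumes "p \<in> carrier (mpoly_ring n)"
  shows "\<exists>r. supp r \<subseteq> box n n \<and> p - r \<in> splitting_ideal n a"
  using assms
proof (induction rule: mpoly_ring_induct)
  case (const c)
  have "supp (mconst c) \<subseteq> box n n" by (auto simp: mconst_def box_def)
  then show ?case
    by (intro exI[of _ "mconst c"]) (auto simp: mpoly_ideal_0[OF splitting_ideal_ideal])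
next
  case (add p q)
  then obtain r s where r: "supp r \<subseteq> box n n" "supp s \<subseteq> box n n"
      "p - r \<in> splitting_ideal n a" "q - s \<in> splitting_ideal n a" by blast
  have "p + q - (r + s) \<in> splitting_ideal n a"
    using mpoly_ideal_add[OF splitting_ideal_ideal r(3,4)] by (simp add: algebra_simps)
  then show ?case using r keys_add[of r s] by blast
next
  case (var i p)
  note I = splitting_ideal_ideal[of n a]
  obtain r where r: "supp r \<subseteq> box n n" "p - r \<in> splitting_ideal n a" using var by blast
  obtain s where s: "s m \<in> good n a n" "mvar i * xmon m - s m \<in> splitting_ideal n a"
    if "m \<in> box n n" for m
    using reduce_mvar_mult[OF var(1), of _ a] by metis
  let ?c = "\<lambda>m. mconst (lkp r m)"
  have "mvar i * (p - r) \<in> splitting_ideal n a"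
    using r var by (intro mpoly_ideal_mult_left[OF I] mpoly_carrier_mvar)
  moreover have "(\<Sum>m\<in>supp r. ?c m * (mvar i * xmon m)) - (\<Sum>m\<in>supp r. ?c m * s m) \<in> splitting_ideal n a"
    by (rule mpoly_ideal_mult_sum_diff[OF I]) (use s r in \<open>auto intro: mpoly_carrier_mconst\<close>)
  moreover have "(\<Sum>m\<in>supp r. ?c m * (mvar i * xmon m)) = mvar i * r"
    by (subst (4) mpoly_sum_singles)
      (simp add: sum_distrib_left single_eq[symmetric] central_left_commute[OF central_mvar])
  ultimately have "mvar i * p - (\<Sum>m\<in>supp r. ?c m * s m) \<in> splitting_ideal n a"
    using mpoly_ideal_add[OF I] by (fastforce simp: right_diff_distrib)
  moreover have "supp (\<Sum>m\<in>supp r. ?c m * s m) \<subseteq> box n n"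
  proof
    fix l assume "l \<in> supp (\<Sum>m\<in>supp r. ?c m * s m)"
    then have "(\<Sum>m\<in>supp r. lkp (?c m * s m) l) \<noteq> 0" by (simp add: in_keys_iff lookup_sum)
    then obtain m where m: "m \<in> supp r" "lkp (?c m * s m) l \<noteq> 0" by (rule sum.not_neutral_contains_not_neutral)
    then have "l \<in> supp (s m)"
      using supp_single_mult[of 0 "lkp r m" "s m"] by (auto simp: mconst_def in_keys_iff)
    then show "l \<in> box n n" using s(1)[of m] m r by (auto simp: good_def)
  qed
  ultimately show ?case by blast
qed

section \<open>Evaluation of polynomials\<close>

context monoid
begin

lemma pow_commute:
  assumes "x \<in> carrier G" "y \<in> carrier G" "x \<otimes> y = y \<otimes> x"
  shows "x [^] (k :: nat) \<otimes> y = y \<otimes> x [^] k"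
proof (induction k)
  case (Suc k)
  have "x [^] Suc k \<otimes> y = x [^] k \<otimes> y \<otimes> x" using assms by (simp add: m_assoc)
  also have "\<dots> = y \<otimes> x [^] Suc k" using assms Suc by (simp add: m_assoc)
  finally show ?case .
qed (use assms in simp)

lemma ordered_prod_commute:
  assumes "\<And>i. i \<in> {1..k} \<Longrightarrow> x i \<in> carrier G" "y \<in> carrier G"
    and "\<And>i. i \<in> {1..k} \<Longrightarrow> x i \<otimes> y = y \<otimes> x i"
  shows "ordered_prod G k x \<otimes> y = y \<otimes> ordered_prod G k x"
  using assms
proof (induction k)
  case (Suc k)
  have c: "ordered_prod G k x \<in> carrier G" "x (Suc k) \<in> carrier G"
    using Suc.prems by (auto intro!: ordered_prod_closed)
  have IH: "ordered_prod G k x \<otimes> y = y \<otimes> ordered_prod G k x"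
    by (rule Suc.IH) (use Suc.prems in auto)
  have xy: "x (Suc k) \<otimes> y = y \<otimes> x (Suc k)" by (rule Suc.prems) simp
  have e: "ordered_prod G (Suc k) x = ordered_prod G k x \<otimes> x (Suc k)"
    by (rule ordered_prod_Suc) (rule Suc.prems)
  have "ordered_prod G (Suc k) x \<otimes> y = ordered_prod G k x \<otimes> y \<otimes> x (Suc k)"
    unfolding e using c \<open>y \<in> carrier G\<close> xy by (simp add: m_assoc)
  also have "\<dots> = y \<otimes> ordered_prod G (Suc k) x"
    unfolding e using c \<open>y \<in> carrier G\<close> IH by (simp add: m_assoc)
  finally show ?case .
qed simp

lemma ordered_prod_mult:
  assumes x: "\<And>i. i \<in> {1..k} \<Longrightarrow> x i \<in> carrier G" and y: "\<And>i. i \<in> {1..k} \<Longrightarrow> y i \<in> carrier G"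
    and xy: "\<And>i j. i \<in> {1..k} \<Longrightarrow> j \<in> {1..k} \<Longrightarrow> y i \<otimes> x j = x j \<otimes> y i"
  shows "ordered_prod G k (\<lambda>i. x i \<otimes> y i) = ordered_prod G k x \<otimes> ordered_prod G k y"
  using assms
proof (induction k)
  case (Suc k)
  let ?x = "x (Suc k)" and ?y = "y (Suc k)" and ?p = "ordered_prod G k x" and ?q = "ordered_prod G k y"
  have c: "?p \<in> carrier G" "?q \<in> carrier G" "?x \<in> carrier G" "?y \<in> carrier G"
    using Suc.prems by (auto intro!: ordered_prod_closed)
  have IH: "ordered_prod G k (\<lambda>i. x i \<otimes> y i) = ?p \<otimes> ?q"
    by (rule Suc.IH) (use Suc.prems in auto)
  have qx: "?q \<otimes> ?x = ?x \<otimes> ?q"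
    by (rule ordered_prod_commute) (use Suc.prems in auto)
  have "ordered_prod G (Suc k) (\<lambda>i. x i \<otimes> y i) = ?p \<otimes> ?q \<otimes> (?x \<otimes> ?y)"
    unfolding IH[symmetric] by (rule ordered_prod_Suc) (use Suc.prems in auto)
  also have "\<dots> = ?p \<otimes> (?q \<otimes> ?x) \<otimes> ?y" using c by (simp add: m_assoc)
  also have "\<dots> = (?p \<otimes> ?x) \<otimes> (?q \<otimes> ?y)" unfolding qx using c by (simp add: m_assoc)
  also have "?p \<otimes> ?x = ordered_prod G (Suc k) x"
    by (rule ordered_prod_Suc[symmetric]) (rule Suc.prems(1))
  also have "?q \<otimes> ?y = ordered_prod G (Suc k) y"
    by (rule ordered_prod_Suc[symmetric]) (rule Suc.prems(2))
  finally show ?case .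
qed simp

lemma ordered_prod_delta:
  assumes "i \<ge> 1" "y \<in> carrier G"
  shows "ordered_prod G k (\<lambda>j. if j = i then y else \<one>) = (if i \<le> k then y else \<one>)"
proof (induction k)
  case (Suc k)
  have "ordered_prod G (Suc k) (\<lambda>j. if j = i then y else \<one>) =
      ordered_prod G k (\<lambda>j. if j = i then y else \<one>) \<otimes> (if Suc k = i then y else \<one>)"
    by (rule ordered_prod_Suc) (use assms in auto)
  then show ?case using Suc assms by auto
qed (use assms in auto)

lemma ordered_prod_cong:
  assumes "\<And>i. i \<in> {1..k} \<Longrightarrow> x i = y i"
  shows "ordered_prod G k x = ordered_prod G k y"
proof -
  have "map x [1..<Suc k] = map y [1..<Suc k]" using assms by auto
  then show ?thesis unfolding ordered_prod_def by (simp only:)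
qed

end

text \<open>The data of a homomorphism from R[X_1, ..., X_n] for noncommutative R: the images of the
  variables commute with one another and with the image of R, which itself may be noncommutative.
  The instances are the matrices and the roots in a splitting field, in any order.\<close>

locale evaluation = ring S for S :: "('b, 'm) ring_scheme" (structure) +
  fixes n :: nat and \<psi> :: "'r::ring_1 \<Rightarrow> 'b" and x :: "nat \<Rightarrow> 'b"
  assumes psi_closed [simp]: "\<psi> r \<in> carrier S"
    and psi_add: "\<psi> (r + s) = \<psi> r \<oplus> \<psi> s"
    and psi_mult: "\<psi> (r * s) = \<psi> r \<otimes> \<psi> s"
    and psi_1: "\<psi> 1 = \<one>"
    and x_closed [simp]: "i \<in> {1..n} \<Longrightarrow> x i \<in> carrier S"
    and x_commute: "i \<in> {1..n} \<Longrightarrow> j \<in> {1..n} \<Longrightarrow> x i \<otimes> x j = x j \<otimes> x i"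
    and x_psi_commute: "i \<in> {1..n} \<Longrightarrow> x i \<otimes> \<psi> r = \<psi> r \<otimes> x i"
begin

lemma psi_0: "\<psi> 0 = \<zero>"
  using psi_add[of 0 0] by (metis add.r_cancel_one' add_0 psi_closed)

definition mpow :: "(nat \<Rightarrow>\<^sub>0 nat) \<Rightarrow> 'b" where
  "mpow m = ordered_prod S n (\<lambda>i. x i [^] lkp m i)"

definition ev :: "'r mpoly \<Rightarrow> 'b" where
  "ev p = (\<Oplus>m\<in>supp p. \<psi> (lkp p m) \<otimes> mpow m)"

lemma mpow_closed [simp]: "mpow m \<in> carrier S"
  unfolding mpow_def by (rule ordered_prod_closed) auto

lemma mpow_add: "mpow (m + m') = mpow m \<otimes> mpow m'"
proof -
  have "mpow (m + m') = ordered_prod S n (\<lambda>i. x i [^] lkp m i \<otimes> x i [^] lkp m' i)"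
    unfolding mpow_def by (rule ordered_prod_cong) (simp add: lookup_add nat_pow_mult x_closed)
  also have "\<dots> = mpow m \<otimes> mpow m'"
    unfolding mpow_def
  proof (rule ordered_prod_mult)
    fix i j assume ij: "i \<in> {1..n}" "j \<in> {1..n}"
    have "x j \<otimes> x i [^] lkp m' i = x i [^] lkp m' i \<otimes> x j"
      by (rule pow_commute[symmetric]) (use ij in \<open>auto intro: x_commute\<close>)
    then show "x i [^] lkp m' i \<otimes> x j [^] lkp m j = x j [^] lkp m j \<otimes> x i [^] lkp m' i"
      using ij by (subst pow_commute[of "x j" "x i [^] lkp m' i"]) auto
  qed auto
  finally show ?thesis .
qed

lemma mpow_0 [simp]: "mpow 0 = \<one>"
proof -
  have "mpow 0 = ordered_prod S n (\<lambda>i. if i = Suc n then \<one> else \<one>)"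
    by (simp add: mpow_def)
  also have "\<dots> = \<one>" by (subst ordered_prod_delta) auto
  finally show ?thesis .
qed

lemma mpow_single: "i \<in> {1..n} \<Longrightarrow> mpow (sgl i 1) = x i"
proof -
  assume i: "i \<in> {1..n}"
  have "mpow (sgl i 1) = ordered_prod S n (\<lambda>j. if j = i then x i else \<one>)"
    unfolding mpow_def by (rule ordered_prod_cong) (auto simp: lookup_single when_def x_closed)
  also have "\<dots> = x i" using i by (subst ordered_prod_delta) auto
  finally show ?thesis .
qed

lemma mpow_psi_commute: "mpow m \<otimes> \<psi> r = \<psi> r \<otimes> mpow m"
  unfolding mpow_def
  by (rule ordered_prod_commute) (auto intro!: pow_commute intro: x_psi_commute)

lemma ev_superset:
  assumes "finite T" "supp p \<subseteq> T"
  shows "ev p = (\<Oplus>m\<in>T. \<psi> (lkp p m) \<otimes> mpow m)"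
  unfolding ev_def
  by (rule add.finprod_mono_neutral_cong_left)
    (use assms in \<open>auto simp: in_keys_iff psi_0\<close>)

lemma ev_closed [simp]: "ev p \<in> carrier S"
  unfolding ev_def by (rule finsum_closed) auto

lemma ev_add: "ev (p + q) = ev p \<oplus> ev q"
proof -
  let ?T = "supp p \<union> supp q"
  have "ev (p + q) = (\<Oplus>m\<in>?T. \<psi> (lkp (p + q) m) \<otimes> mpow m)"
    by (rule ev_superset) (use keys_add[of p q] in auto)
  also have "\<dots> = (\<Oplus>m\<in>?T. \<psi> (lkp p m) \<otimes> mpow m \<oplus> \<psi> (lkp q m) \<otimes> mpow m)"
    by (rule finsum_cong') (auto simp: lookup_add psi_add l_distr)
  also have "\<dots> = (\<Oplus>m\<in>?T. \<psi> (lkp p m) \<otimes> mpow m) \<oplus> (\<Oplus>m\<in>?T. \<psi> (lkp q m) \<otimes> mpow m)"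
    by (rule finsum_addf) auto
  also have "\<dots> = ev p \<oplus> ev q"
    using ev_superset[of ?T p] ev_superset[of ?T q] by simp
  finally show ?thesis .
qed

lemma ev_0 [simp]: "ev 0 = \<zero>"
  by (simp add: ev_def)

lemma ev_single: "ev (sgl m c) = \<psi> c \<otimes> mpow m"
proof -
  have "ev (sgl m c) = (\<Oplus>l\<in>{m}. \<psi> (lkp (sgl m c) l) \<otimes> mpow l)"
    by (rule ev_superset) auto
  then show ?thesis by (simp add: finsum_insert)
qed

lemma ev_mconst [simp]: "ev (mconst c) = \<psi> c"
  by (simp add: mconst_def ev_single)

lemma ev_mvar [simp]: "i \<in> {1..n} \<Longrightarrow> ev (mvar i) = x i"
  by (simp only: mvar_def ev_single mpow_single psi_1) (simp add: x_closed)

lemma ev_mult: "ev (p * q) = ev p \<otimes> ev q"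
proof (rule mpoly_induct[where p = p])
  fix m :: "nat \<Rightarrow>\<^sub>0 nat" and c :: 'r
  show "ev (sgl m c * q) = ev (sgl m c) \<otimes> ev q"
  proof (rule mpoly_induct[where p = q])
    fix m' d
    have "ev (sgl m c * sgl m' d) = \<psi> c \<otimes> (\<psi> d \<otimes> mpow m) \<otimes> mpow m'"
      by (simp add: mult_single ev_single psi_mult mpow_add m_assoc)
    \<comment> \<open>The second coefficient has to pass the first monomial, which
      \<open>x_psi_commute\<close> permits.\<close>
    also have "\<dots> = ev (sgl m c) \<otimes> ev (sgl m' d)"
      unfolding mpow_psi_commute[symmetric] by (simp add: ev_single m_assoc)
    finally show "ev (sgl m c * sgl m' d) = ev (sgl m c) \<otimes> ev (sgl m' d)" .
  qed (simp_all add: distrib_left ev_add r_distr)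
qed (simp_all add: distrib_right ev_add l_distr)

lemma ev_ring_hom: "ev \<in> ring_hom (mpoly_ring k) S"
  by (rule ring_hom_memI) (auto simp: ev_add ev_mult psi_1 simp flip: mconst_1)

lemma ev_uminus: "ev (- p) = \<ominus> ev p"
  using ev_add[of "- p" p] by (simp add: minus_equality)

lemma ev_esym: "ev (esym n n i) = elem_sym S n i x"
proof -
  have "ev (esym n n i) = elem_sym S n i (\<lambda>j. ev (mvar j))"
    unfolding esym_def
    by (rule ring.elem_sym_hom[OF ring_mpoly_ring])
      (auto intro: ring_axioms ev_ring_hom mpoly_carrier_mvar)
  also have "\<dots> = elem_sym S n i x" by (rule elem_sym_cong) auto
  finally show ?thesis .
qed

lemma ev_unique:
  assumes "h \<in> ring_hom (mpoly_ring n) S" "\<And>r. h (mconst r) = \<psi> r" "\<And>i. i \<in> {1..n} \<Longrightarrow> h (mvar i) = x i"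
    and "p \<in> carrier (mpoly_ring n)"
  shows "h p = ev p"
  using assms(4)
proof (induction rule: mpoly_ring_induct)
  case (add p q)
  then show ?case using ring_hom_add[OF assms(1), of p q] by (simp add: ev_add)
next
  case (var i p)
  then show ?case
    using ring_hom_mult[OF assms(1), of "mvar i" p] by (simp add: ev_mult assms(3) mpoly_carrier_mvar)
qed (simp add: assms)

lemma ev_splitting_ideal:
  assumes roots: "\<And>i. i \<in> {1..n} \<Longrightarrow> elem_sym S n i x = \<psi> (a i)"
    and p: "p \<in> splitting_ideal n a"
  shows "ev p = \<zero>"
proof -
  interpret h: ring_hom_ring "mpoly_ring n" S ev
    by (rule ring_hom_ringI2[OF ring_mpoly_ring ring_axioms ev_ring_hom])
  have "splitting_ideal n a \<subseteq> a_kernel (mpoly_ring n) S ev"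
  proof (rule splitting_ideal_minimal)
    show "ideal (a_kernel (mpoly_ring n) S ev) (mpoly_ring n)" by (rule h.kernel_is_ideal)
    fix i assume i: "i \<in> {1..n}"
    have "ev (esym n n i - mconst (a i)) = ev (esym n n i) \<oplus> \<ominus> \<psi> (a i)"
      using ev_add[of "esym n n i" "- mconst (a i)"] by (simp add: ev_uminus)
    then have "ev (esym n n i - mconst (a i)) = \<zero>" using roots[OF i] by (simp add: ev_esym r_neg)
    moreover have "esym n n i - mconst (a i) \<in> carrier (mpoly_ring n)"
      by (intro mpoly_carrier_diff mpoly_carrier_mconst esym_carrier order_refl)
    ultimately show "esym n n i - mconst (a i) \<in> a_kernel (mpoly_ring n) S ev"
      unfolding a_kernel_def' by blast
  qed
  then show ?thesis using p unfolding a_kernel_def' by blast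
qed

lemma ev_image_subring: "subring (ev ` carrier (mpoly_ring n)) S"
proof -
  interpret h: ring_hom_ring "mpoly_ring n" S ev
    by (rule ring_hom_ringI2[OF ring_mpoly_ring ring_axioms ev_ring_hom])
  show ?thesis by (rule h.img_is_subring[OF ring.carrier_is_subring[OF ring_mpoly_ring]])
qed

lemma ev_image: "ev ` carrier (mpoly_ring n) = generate_ring S (\<psi> ` UNIV \<union> x ` {1..n})"
proof
  have sub: "\<psi> ` UNIV \<union> x ` {1..n} \<subseteq> carrier S" by auto
  have gen: "subring (generate_ring S (\<psi> ` UNIV \<union> x ` {1..n})) S"
    using generate_ring_is_subring[OF sub] .
  have incl: "\<psi> ` UNIV \<union> x ` {1..n} \<subseteq> generate_ring S (\<psi> ` UNIV \<union> x ` {1..n})"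
    by (blast intro: generate_ring.incl)
  show "ev ` carrier (mpoly_ring n) \<subseteq> generate_ring S (\<psi> ` UNIV \<union> x ` {1..n})"
  proof
    fix y assume "y \<in> ev ` carrier (mpoly_ring n)"
    then obtain p where p: "p \<in> carrier (mpoly_ring n)" "y = ev p" by blast
    have "ev p \<in> generate_ring S (\<psi> ` UNIV \<union> x ` {1..n})"
      using p(1)
    proof (induction rule: mpoly_ring_induct)
      case (add p q)
      then show ?case using subringE(7)[OF gen] by (simp add: ev_add)
    next
      case (var i p)
      moreover have "x i \<in> generate_ring S (\<psi> ` UNIV \<union> x ` {1..n})" using var incl by blast
      ultimately show ?case using subringE(6)[OF gen] by (simp add: ev_mult)
    qed (use incl in auto)
    then show "y \<in> generate_ring S (\<psi> ` UNIV \<union> x ` {1..n})" using p by simp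
  qed
  have "\<psi> r \<in> ev ` carrier (mpoly_ring n)" for r
    by (rule image_eqI[of _ _ "mconst r"]) (auto intro: mpoly_carrier_mconst)
  moreover have "x i \<in> ev ` carrier (mpoly_ring n)" if "i \<in> {1..n}" for i
    by (rule image_eqI[of _ _ "mvar i"]) (use that in \<open>auto intro: mpoly_carrier_mvar\<close>)
  ultimately show "generate_ring S (\<psi> ` UNIV \<union> x ` {1..n}) \<subseteq> ev ` carrier (mpoly_ring n)"
    by (intro generate_ring_min_subring1[OF sub ev_image_subring]) auto
qed

end

subsection \<open>Splitting in terms of elementary symmetric polynomials\<close>

lemma base_ring_simps [simp]:
  "carrier (base_ring :: 'a::ring_1 ring) = UNIV" "mult (base_ring :: 'a ring) = (*)"
  "one (base_ring :: 'a ring) = 1" "zero (base_ring :: 'a ring) = 0" "add (base_ring :: 'a ring) = (+)"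
  by (auto simp: ring_of_type_algebra_def)

lemma ring_base_ring: "ring (base_ring :: 'a::ring_1 ring)"
proof (rule ringI)
  show "abelian_group (base_ring :: 'a ring)"
  proof (rule abelian_groupI)
    fix p :: 'a
    show "\<exists>q\<in>carrier base_ring. q \<oplus>\<^bsub>base_ring\<^esub> p = \<zero>\<^bsub>base_ring\<^esub>"
      by (intro bexI[of _ "- p"]) auto
  qed (auto simp: algebra_simps)
  show "Group.monoid (base_ring :: 'a ring)" by (rule monoidI) (auto simp: mult.assoc)
qed (auto simp: algebra_simps)

lemma finsum_base_ring: "finsum (base_ring :: 'a::ring_1 ring) g T = sum g T"
proof -
  interpret ring "base_ring :: 'a ring" by (rule ring_base_ring)
  show ?thesis by (induction T rule: infinite_finite_induct) (auto simp: finsum_infinite)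
qed

lemma coeff_signed_poly:
  "up_ring.coeff (UP base_ring) (signed_poly n a) d = (if d \<le> n then signed_coeff n a (n - d) else 0)"
proof -
  interpret R: ring "base_ring :: 'a ring" by (rule ring_base_ring)
  interpret P: UP_ring "base_ring :: 'a ring" "UP (base_ring :: 'a ring)" by unfold_locales simp
  let ?m = "\<lambda>i. up_ring.monom (UP base_ring) ((- 1) ^ i * a i) (n - i)"
  have c: "?m \<in> {1..n} \<rightarrow> carrier (UP (base_ring :: 'a ring))" by auto
  then have "up_ring.coeff (UP base_ring) (finsum (UP base_ring) ?m {1..n}) d =
      (\<Sum>i\<in>{1..n}. if n - i = d then (- 1) ^ i * a i else 0)"
    by (subst P.coeff_finsum) (auto simp: finsum_base_ring cong: if_cong)
  also have "\<dots> = (\<Sum>i\<in>{1..n}. if i = n - d then (if d < n then (- 1) ^ i * a i else 0) else 0)"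
    by (rule sum.cong) auto
  also have "\<dots> = (if d < n then (- 1) ^ (n - d) * a (n - d) else 0)"
    by auto
  finally have "up_ring.coeff (UP base_ring) (finsum (UP base_ring) ?m {1..n}) d =
      (if d < n then (- 1) ^ (n - d) * a (n - d) else 0)" .
  moreover have "finsum (UP base_ring) ?m {1..n} \<in> carrier (UP (base_ring :: 'a ring))"
    using c by (rule P.P.finsum_closed)
  ultimately show ?thesis
    unfolding signed_poly_def by (subst P.coeff_add) (auto simp: signed_coeff_def)
qed

text \<open>Comparing coefficients by Vieta's formulas turns a factorisation into values of
  elementary symmetric polynomials, the form to which I_f refers.\<close>

lemma (in ring) splits_as_signed_poly_iff:
  assumes closed: "\<And>r. \<psi> r \<in> carrier R" and add: "\<And>r s. \<psi> (r + s) = \<psi> r \<oplus> \<psi> s" and one: "\<psi> (1::'r::ring_1) = \<one>"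
  shows "splits_as base_ring (signed_poly n a) R \<psi> n x \<longleftrightarrow>
    (\<forall>i\<in>{1..n}. x i \<in> carrier R) \<and> (\<forall>i\<in>{1..n}. elem_sym R n i x = \<psi> (a i))"
proof (cases "\<forall>i\<in>{1..n}. x i \<in> carrier R")
  case True
  have zero: "\<psi> 0 = \<zero>"
    using add[of 0 0] by (metis add.r_cancel_one' add_0 closed)
  have uminus: "\<psi> (- r) = \<ominus> \<psi> r" for r
    using add[of "- r" r] by (simp add: closed zero minus_equality)
  have sgn: "\<psi> ((- 1) ^ i * r) = (if even i then \<psi> r else \<ominus> \<psi> r)" for i r
    by (cases "even i") (simp_all add: uminus)
  have E: "elem_sym R n i x \<in> carrier R" for i by (rule elem_sym_closed) (use True in auto)
  have co: "up_ring.coeff (UP R) (ordered_prod (UP R) n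
      (\<lambda>i. up_ring.monom (UP R) \<one> 1 \<ominus>\<^bsub>UP R\<^esub> up_ring.monom (UP R) (x i) 0)) d =
    (if d \<le> n then if even (n - d) then elem_sym R n (n - d) x else \<ominus> elem_sym R n (n - d) x else \<zero>)" for d
    by (rule coeff_prod_linear_factors) (use True in auto)
  have inj: "\<ominus> y = \<ominus> z \<longleftrightarrow> y = z" if "y \<in> carrier R" "z \<in> carrier R" for y z
    using that by (metis minus_minus)
  \<comment> \<open>Index 0 belongs to the leading coefficient, where both sides are 1 and no
    condition arises.\<close>
  have eq: "\<psi> (signed_coeff n a i) = (if even i then elem_sym R n i x else \<ominus> elem_sym R n i x) \<longleftrightarrow>
      i = 0 \<or> elem_sym R n i x = \<psi> (a i)" if "i \<le> n" for i
  proof (cases "i = 0")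
    case True
    then show ?thesis by (simp add: signed_coeff_def one elem_sym_0)
  next
    case False
    then have "\<psi> (signed_coeff n a i) = (if even i then \<psi> (a i) else \<ominus> \<psi> (a i))"
      using that by (simp only: signed_coeff_def sgn if_False if_True)
    moreover have "((if even i then \<psi> (a i) else \<ominus> \<psi> (a i)) =
        (if even i then elem_sym R n i x else \<ominus> elem_sym R n i x)) \<longleftrightarrow> \<psi> (a i) = elem_sym R n i x"
      using inj[OF closed[of "a i"] E[of i]] by presburger
    ultimately show ?thesis
      by (simp only: False simp_thms) (rule eq_commute)
  qed
  have "(\<psi> (if d \<le> n then signed_coeff n a (n - d) else 0) =
      (if d \<le> n then if even (n - d) then elem_sym R n (n - d) x else \<ominus> elem_sym R n (n - d) x else \<zero>)) \<longleftrightarrow>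
      (d \<le> n \<longrightarrow> n - d = 0 \<or> elem_sym R n (n - d) x = \<psi> (a (n - d)))" for d
  proof (cases "d \<le> n")
    case True
    then show ?thesis by (simp only: if_True eq[OF diff_le_self] simp_thms)
  next
    case False
    then show ?thesis by (simp only: if_False zero simp_thms)
  qed
  then have "splits_as base_ring (signed_poly n a) R \<psi> n x \<longleftrightarrow>
      (\<forall>d\<le>n. n - d = 0 \<or> elem_sym R n (n - d) x = \<psi> (a (n - d)))"
    unfolding splits_as_def co coeff_signed_poly by (simp only:) (use True in blast)
  also have "\<dots> \<longleftrightarrow> (\<forall>i\<in>{1..n}. elem_sym R n i x = \<psi> (a i))"
  proof (intro iffI ballI allI impI)
    fix i assume H: "\<forall>d\<le>n. n - d = 0 \<or> elem_sym R n (n - d) x = \<psi> (a (n - d))" and i: "i \<in> {1..n}"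
    then show "elem_sym R n i x = \<psi> (a i)" using H[rule_format, of "n - i"] by simp
  next
    fix d assume "\<forall>i\<in>{1..n}. elem_sym R n i x = \<psi> (a i)" "d \<le> n"
    then show "n - d = 0 \<or> elem_sym R n (n - d) x = \<psi> (a (n - d))" by (cases "n - d = 0") auto
  qed
  finally show ?thesis using True by blast
qed (auto simp: splits_as_def)

subsection \<open>Enumeration of the reduced monomials\<close>

text \<open>Condition (iii) is indexed by functions on \<open>{1..n}\<close>, polynomials by
  finitely supported exponent vectors; this map translates the former into the latter.\<close>

definition expo :: "nat \<Rightarrow> (nat \<Rightarrow> nat) \<Rightarrow> (nat \<Rightarrow>\<^sub>0 nat)" where
  "expo n \<alpha> = (\<Sum>i\<in>{1..n}. sgl i (\<alpha> i))"

lemma lookup_expo: "lkp (expo n \<alpha>) i = (if i \<in> {1..n} then \<alpha> i else 0)"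
  unfolding expo_def lookup_sum by (simp add: lookup_single when_def)

lemma bij_betw_expo: "bij_betw (expo n) (\<Pi>\<^sub>E i\<in>{1..n}. {0..n - i}) (box n n)"
proof (rule bij_betwI[where g = "\<lambda>m. restrict (lkp m) {1..n}"])
  show "expo n \<in> (\<Pi>\<^sub>E i\<in>{1..n}. {0..n - i}) \<rightarrow> box n n"
    by (auto simp: box_def lookup_expo in_keys_iff PiE_def Pi_def split: if_splits)
  show "(\<lambda>m. restrict (lkp m) {1..n}) \<in> box n n \<rightarrow> (\<Pi>\<^sub>E i\<in>{1..n}. {0..n - i})"
    by (auto simp: box_def)
  show "restrict (lkp (expo n \<alpha>)) {1..n} = \<alpha>" if "\<alpha> \<in> (\<Pi>\<^sub>E i\<in>{1..n}. {0..n - i})" for \<alpha>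
    using that by (auto simp: lookup_expo restrict_def PiE_def extensional_def fun_eq_iff)
  show "expo n (restrict (lkp m) {1..n}) = m" if "m \<in> box n n" for m
    using that by (intro poly_mapping_eqI) (auto simp: lookup_expo box_def in_keys_iff)
qed

lemma finite_box: "finite (box n n)"
  using bij_betw_finite[OF bij_betw_expo[of n]] by (simp add: finite_PiE)

lemma card_box: "card (box n n) = fact n"
proof -
  have "card (box n n) = (\<Prod>i\<in>{1..n}. card {0..n - i})"
    using bij_betw_same_card[OF bij_betw_expo[of n]] by (simp add: card_PiE)
  also have "\<dots> = (\<Prod>i\<in>{1..n}. i)"
    by (rule prod.reindex_bij_witness[of _ "\<lambda>i. Suc n - i" "\<lambda>i. Suc n - i"]) auto
  also have "\<dots> = fact n" by (simp add: fact_prod)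
  finally show ?thesis .
qed

text \<open>An arbitrary ordering of the basis: none of (i) to (iv) depends on it.\<close>

definition box_enum :: "nat \<Rightarrow> nat \<Rightarrow> (nat \<Rightarrow>\<^sub>0 nat)" where
  "box_enum n = (SOME e. bij_betw e {..<fact n} (box n n))"

lemma bij_betw_box_enum: "bij_betw (box_enum n) {..<fact n} (box n n)"
proof -
  have "\<exists>e :: nat \<Rightarrow> _. bij_betw e {..<fact n} (box n n)"
    using ex_bij_betw_nat_finite[OF finite_box[of n]] by (simp add: card_box atLeast0LessThan)
  then show ?thesis unfolding box_enum_def by (rule someI_ex)
qed

lemma box_enum_in_box: "s < fact n \<Longrightarrow> box_enum n s \<in> box n n"
  using bij_betwE[OF bij_betw_box_enum[of n]] by simp

lemma box_enum_eq_iff: "r < fact n \<Longrightarrow> s < fact n \<Longrightarrow> box_enum n r = box_enum n s \<longleftrightarrow> r = s"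
  using bij_betw_imp_inj_on[OF bij_betw_box_enum[of n]] by (auto dest: inj_onD)

lemma box_enum_surj: "m \<in> box n n \<Longrightarrow> \<exists>s<fact n. box_enum n s = m"
  using bij_betw_imp_surj_on[OF bij_betw_box_enum[of n]] by (metis imageE lessThan_iff)

subsection \<open>Normal forms\<close>

text \<open>Existence is \<open>box_spanning\<close> and uniqueness is
  \<open>box_independent\<close>, so \<open>nf_eqI\<close> yields the algebraic rules for it without
  a return to the division algorithm.\<close>

definition nf :: "nat \<Rightarrow> (nat \<Rightarrow> 'a::ring_1) \<Rightarrow> 'a mpoly \<Rightarrow> 'a mpoly" where
  "nf n a p = (SOME r. supp r \<subseteq> box n n \<and> p - r \<in> splitting_ideal n a)"

lemma nf_spec:
  assumes "p \<in> carrier (mpoly_ring n)"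
  shows "supp (nf n a p) \<subseteq> box n n" "p - nf n a p \<in> splitting_ideal n a"
  using someI_ex[OF box_spanning[OF assms, of a]] unfolding nf_def by blast+

lemma nf_eqI:
  assumes cent: "\<forall>i\<in>{1..n}. central (a i)"
    and p: "p \<in> carrier (mpoly_ring n)" and r: "supp r \<subseteq> box n n" "p - r \<in> splitting_ideal n a"
  shows "nf n a p = r"
proof -
  have "(p - nf n a p) - (p - r) \<in> splitting_ideal n a"
    using mpoly_ideal_diff[OF splitting_ideal_ideal nf_spec(2)[OF p] r(2)] .
  then have "r - nf n a p \<in> splitting_ideal n a" by simp
  moreover have "supp (r - nf n a p) \<subseteq> box n n"
    using keys_diff[of r "nf n a p"] r(1) nf_spec(1)[OF p, of a] by blast
  ultimately have "r - nf n a p = 0" by (rule box_independent[OF cent])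
  then show ?thesis by simp
qed

lemma lookup_mult_mconst: "lkp (p * mconst c) m = lkp p m * c"
proof (rule mpoly_induct[where p = p])
qed (auto simp: mconst_def mult_single lookup_single when_def lookup_add distrib_right)

lemma lookup_mconst_mult: "lkp (mconst c * p) m = c * lkp p m"
  using lookup_single_mult[of 0 c p m] by (simp add: mconst_def)

lemma box_subset_carrier: "m \<in> box n n \<Longrightarrow> xmon m \<in> carrier (mpoly_ring n)"
  by (rule mpoly_carrier_single) (auto simp: box_def)

subsection \<open>The matrices of multiplication\<close>

text \<open>Column \<open>s\<close> holds the coordinates of \<open>p\<close> times the reduced
  monomial number \<open>s\<close>. Left multiplication by \<open>p\<close> is linear for
  coefficients on the right, so composition is the ordinary matrix product even over noncommutative
  R.\<close>

definition mult_mat :: "nat \<Rightarrow> (nat \<Rightarrow> 'a::ring_1) \<Rightarrow> 'a mpoly \<Rightarrow> 'a mat" where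
  "mult_mat n a p =
    mat (fact n) (fact n) (\<lambda>(r, s). lkp (nf n a (p * xmon (box_enum n s))) (box_enum n r))"

section \<open>The matrix ring and its scalar matrices\<close>

lemma ring_fact_mat_ring: "ring (fact_mat_ring n :: 'a::ring_1 mat ring)"
proof -
  interpret semiring "fact_mat_ring n :: 'a mat ring" by (rule semiring_mat)
  show ?thesis
  proof (rule ringI)
    show "abelian_group (fact_mat_ring n :: 'a mat ring)"
    proof (rule abelian_groupI)
      fix A :: "'a mat" assume "A \<in> carrier (fact_mat_ring n)"
      then show "\<exists>B\<in>carrier (fact_mat_ring n). B \<oplus>\<^bsub>fact_mat_ring n\<^esub> A = \<zero>\<^bsub>fact_mat_ring n\<^esub>"
        by (intro bexI[of _ "- A"]) (auto simp: ring_mat_simps)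
    qed (auto simp: a_ac)
    show "Group.monoid (fact_mat_ring n :: 'a mat ring)" ..
  qed (auto simp: l_distr r_distr)
qed

lemma scalar_mult_mat:
  assumes "B \<in> carrier_mat (fact n) k"
  shows "scalar n r * B = r \<cdot>\<^sub>m B"
proof (rule eq_matI)
  fix i j assume ij: "i < dim_row (r \<cdot>\<^sub>m B)" "j < dim_col (r \<cdot>\<^sub>m B)"
  have "scalar n r \<in> carrier_mat (fact n) (fact n)" by (simp add: scalar_def)
  then have "(scalar n r * B) $$ (i, j) = (\<Sum>l = 0..<fact n. scalar n r $$ (i, l) * B $$ (l, j))"
    using ij assms by (auto simp: scalar_prod_def intro!: sum.cong)
  also have "\<dots> = (\<Sum>l = 0..<fact n. (if i = l then r * B $$ (l, j) else 0))"
    by (rule sum.cong) (use ij assms in \<open>auto simp: scalar_def\<close>)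
  finally show "(scalar n r * B) $$ (i, j) = (r \<cdot>\<^sub>m B) $$ (i, j)"
    using ij assms by simp
qed (use assms in \<open>auto simp: scalar_def\<close>)

lemma scalar_carrier [simp]: "scalar n r \<in> carrier_mat (fact n) (fact n)"
  by (simp add: scalar_def)

lemma scalar_add: "scalar n (r + s) = scalar n r + scalar n s"
  by (rule eq_matI) (auto simp: scalar_def distrib_right)

lemma scalar_mult: "scalar n (r * s) = scalar n r * scalar n s"
  by (subst scalar_mult_mat[of _ _ "fact n"]) (auto simp: scalar_def mult.assoc intro!: eq_matI)

lemma scalar_1: "scalar n 1 = 1\<^sub>m (fact n)"
  by (rule eq_matI) (auto simp: scalar_def)

lemma finsum_mpoly_ring:
  "g \<in> T \<rightarrow> carrier (mpoly_ring n) \<Longrightarrow> finsum (mpoly_ring n) g T = (sum g T :: 'a::ring_1 mpoly)"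
proof (induction T rule: infinite_finite_induct)
  case (insert i T)
  interpret ring "mpoly_ring n :: 'a mpoly ring" by (rule ring_mpoly_ring)
  show ?case using insert by (subst finsum_insert) auto
next
  interpret ring "mpoly_ring n :: 'a mpoly ring" by (rule ring_mpoly_ring)
  case (infinite T)
  then show ?case by (simp add: finsum_infinite)
next
  interpret ring "mpoly_ring n :: 'a mpoly ring" by (rule ring_mpoly_ring)
  case empty
  then show ?case by simp
qed

context
  fixes n :: nat and a :: "nat \<Rightarrow> 'a::ring_1"
  assumes cent: "\<forall>i\<in>{1..n}. central (a i)"
begin

lemma mult_mat_carrier: "mult_mat n a p \<in> carrier_mat (fact n) (fact n)"
  by (simp add: mult_mat_def)

lemma nf_add:
  assumes p: "p \<in> carrier (mpoly_ring n)" and q: "q \<in> carrier (mpoly_ring n)"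
  shows "nf n a (p + q) = nf n a p + nf n a q"
proof (rule nf_eqI[OF cent mpoly_carrier_add[OF p q]])
  show "supp (nf n a p + nf n a q) \<subseteq> box n n"
    using keys_add[of "nf n a p" "nf n a q"] nf_spec(1)[OF p, of a] nf_spec(1)[OF q, of a] by blast
  have "(p - nf n a p) + (q - nf n a q) \<in> splitting_ideal n a"
    by (intro mpoly_ideal_add[OF splitting_ideal_ideal] nf_spec p q)
  then show "p + q - (nf n a p + nf n a q) \<in> splitting_ideal n a" by (simp add: algebra_simps)
qed

lemma nf_box: "supp p \<subseteq> box n n \<Longrightarrow> nf n a p = p"
  by (rule nf_eqI[OF cent]) (auto intro: box_carrier mpoly_ideal_0[OF splitting_ideal_ideal])

lemma nf_splitting_ideal: "p \<in> splitting_ideal n a \<Longrightarrow> nf n a p = 0"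
  by (rule nf_eqI[OF cent]) (auto intro: mpoly_ideal_carrier[OF splitting_ideal_ideal])

text \<open>Right R-linearity on the quotient: \<open>q\<close> is replaced by its normal form, and
  then each product of \<open>p\<close> with a reduced monomial by its own.\<close>

lemma nf_mult:
  assumes p: "p \<in> carrier (mpoly_ring n)" and q: "q \<in> carrier (mpoly_ring n)"
  shows "nf n a (p * q) = (\<Sum>m\<in>box n n. nf n a (p * xmon m) * mconst (lkp (nf n a q) m))"
proof (rule nf_eqI[OF cent mpoly_carrier_mult[OF p q]])
  note I = splitting_ideal_ideal[of n a]
  let ?u = "nf n a q"
  let ?r = "\<Sum>m\<in>box n n. nf n a (p * xmon m) * mconst (lkp ?u m)"
  have pm: "p * xmon m \<in> carrier (mpoly_ring n)" if "m \<in> box n n" for m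
    using p box_subset_carrier[OF that] by (rule mpoly_carrier_mult)
  show "supp ?r \<subseteq> box n n"
  proof
    fix l assume "l \<in> supp ?r"
    then have "(\<Sum>m\<in>box n n. lkp (nf n a (p * xmon m) * mconst (lkp ?u m)) l) \<noteq> 0"
      by (simp add: in_keys_iff lookup_sum)
    then obtain m where m: "m \<in> box n n" "lkp (nf n a (p * xmon m) * mconst (lkp ?u m)) l \<noteq> 0"
      by (rule sum.not_neutral_contains_not_neutral)
    then have "l \<in> supp (nf n a (p * xmon m))" by (auto simp: lookup_mult_mconst in_keys_iff)
    then show "l \<in> box n n" using nf_spec(1)[OF pm[OF m(1)]] by blast
  qed
  have "?u = (\<Sum>m\<in>supp ?u. sgl m (lkp ?u m))" by (rule mpoly_sum_singles)
  also have "\<dots> = (\<Sum>m\<in>box n n. sgl m (lkp ?u m))"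
    using nf_spec(1)[OF q] finite_box by (intro sum.mono_neutral_left) (auto simp: in_keys_iff)
  also have "\<dots> = (\<Sum>m\<in>box n n. xmon m * mconst (lkp ?u m))" by (simp add: mconst_def mult_single)
  finally have "p * ?u = p * (\<Sum>m\<in>box n n. xmon m * mconst (lkp ?u m))" by (rule arg_cong)
  then have u: "p * ?u = (\<Sum>m\<in>box n n. p * xmon m * mconst (lkp ?u m))"
    by (simp only: sum_distrib_left mult.assoc)
  have "p * (q - ?u) + (\<Sum>m\<in>box n n. (p * xmon m - nf n a (p * xmon m)) * mconst (lkp ?u m)) \<in> splitting_ideal n a"
    by (intro mpoly_ideal_add[OF I] mpoly_ideal_mult_left[OF I] mpoly_ideal_sum[OF I]
        mpoly_ideal_mult_right[OF I] nf_spec p q pm mpoly_carrier_mconst)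
  then show "p * q - ?r \<in> splitting_ideal n a"
    by (simp add: right_diff_distrib left_diff_distrib sum_subtractf flip: u)
qed

lemma mult_mat_mult:
  assumes p: "p \<in> carrier (mpoly_ring n)" and q: "q \<in> carrier (mpoly_ring n)"
  shows "mult_mat n a (p * q) = mult_mat n a p * mult_mat n a q"
proof (rule eq_matI)
  fix r s assume "r < dim_row (mult_mat n a p * mult_mat n a q)" "s < dim_col (mult_mat n a p * mult_mat n a q)"
  then have rs: "r < fact n" "s < fact n" by (simp_all add: mult_mat_def)
  let ?e = "box_enum n"
  let ?g = "\<lambda>m. lkp (nf n a (p * xmon m)) (?e r) * lkp (nf n a (q * xmon (?e s))) m"
  have qs: "q * xmon (?e s) \<in> carrier (mpoly_ring n)"
    using q box_subset_carrier[OF box_enum_in_box[OF rs(2)]] by (rule mpoly_carrier_mult)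
  have "mult_mat n a (p * q) $$ (r, s) = lkp (nf n a (p * (q * xmon (?e s)))) (?e r)"
    using rs by (simp add: mult_mat_def mult.assoc)
  also have "\<dots> = sum ?g (box n n)"
    unfolding nf_mult[OF p qs] by (simp add: lookup_sum lookup_mult_mconst)
  also have "\<dots> = (\<Sum>t<fact n. ?g (?e t))"
    by (rule sum.reindex_bij_betw[OF bij_betw_box_enum, symmetric])
  also have "\<dots> = (mult_mat n a p * mult_mat n a q) $$ (r, s)"
    using rs by (simp add: mult_mat_def scalar_prod_def atLeast0LessThan)
  finally show "mult_mat n a (p * q) $$ (r, s) = (mult_mat n a p * mult_mat n a q) $$ (r, s)" .
qed (simp_all add: mult_mat_def)

lemma mult_mat_add:
  assumes p: "p \<in> carrier (mpoly_ring n)" and q: "q \<in> carrier (mpoly_ring n)"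
  shows "mult_mat n a (p + q) = mult_mat n a p + mult_mat n a q"
proof (rule eq_matI)
  fix r s assume "r < dim_row (mult_mat n a p + mult_mat n a q)" "s < dim_col (mult_mat n a p + mult_mat n a q)"
  then have rs: "r < fact n" "s < fact n" by (simp_all add: mult_mat_def)
  note s = box_subset_carrier[OF box_enum_in_box[OF rs(2)]]
  show "mult_mat n a (p + q) $$ (r, s) = (mult_mat n a p + mult_mat n a q) $$ (r, s)"
    using rs by (simp add: mult_mat_def distrib_right lookup_add
        nf_add[OF mpoly_carrier_mult[OF p s] mpoly_carrier_mult[OF q s]])
qed (simp_all add: mult_mat_def)

lemma mult_mat_mconst: "mult_mat n a (mconst c) = scalar n c"
proof (rule eq_matI)
  fix r s assume "r < dim_row (scalar n c)" "s < dim_col (scalar n c)"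
  then have rs: "r < fact n" "s < fact n" by (simp_all add: scalar_def)
  have "nf n a (mconst c * xmon (box_enum n s)) = mconst c * xmon (box_enum n s)"
    by (rule nf_box) (use box_enum_in_box[OF rs(2)] in \<open>auto simp: mconst_def mult_single\<close>)
  then show "mult_mat n a (mconst c) $$ (r, s) = scalar n c $$ (r, s)"
    using rs by (auto simp: mult_mat_def scalar_def lookup_mconst_mult lookup_single when_def box_enum_eq_iff)
qed (simp_all add: mult_mat_def scalar_def)

lemma mult_mat_ring_hom: "mult_mat n a \<in> ring_hom (mpoly_ring n) (fact_mat_ring n)"
proof (rule ring_hom_memI)
  show "mult_mat n a \<one>\<^bsub>mpoly_ring n\<^esub> = \<one>\<^bsub>fact_mat_ring n\<^esub>"
    using mult_mat_mconst[of 1] by (simp add: ring_mat_simps scalar_1)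
qed (auto simp: ring_mat_simps mult_mat_carrier mult_mat_mult mult_mat_add)

lemma mult_mat_splitting_ideal:
  assumes p: "p \<in> splitting_ideal n a"
  shows "mult_mat n a p = 0\<^sub>m (fact n) (fact n)"
proof (rule eq_matI)
  fix r s assume "r < dim_row (0\<^sub>m (fact n) (fact n) :: 'a mat)" "s < dim_col (0\<^sub>m (fact n) (fact n) :: 'a mat)"
  then have rs: "r < fact n" "s < fact n" by simp_all
  have "p * xmon (box_enum n s) \<in> splitting_ideal n a"
    by (rule mpoly_ideal_mult_right[OF splitting_ideal_ideal p box_subset_carrier[OF box_enum_in_box[OF rs(2)]]])
  then show "mult_mat n a p $$ (r, s) = 0\<^sub>m (fact n) (fact n) $$ (r, s)"
    using rs by (simp add: mult_mat_def nf_splitting_ideal)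
qed (simp_all add: mult_mat_def)

text \<open>The column belonging to the monomial 1 lists the coefficients of \<open>p\<close>
  itself.\<close>

lemma mult_mat_box_eq_0:
  assumes p: "supp p \<subseteq> box n n" "mult_mat n a p = 0\<^sub>m (fact n) (fact n)"
  shows "p = 0"
proof (rule poly_mapping_eqI)
  fix m
  show "lkp p m = lkp 0 m"
  proof (cases "m \<in> box n n")
    case True
    then obtain r where r: "r < fact n" "box_enum n r = m" using box_enum_surj by blast
    obtain s where s: "s < fact n" "box_enum n s = 0"
      using box_enum_surj[of 0 n] by (auto simp: box_def)
    have "mult_mat n a p $$ (r, s) = lkp p m"
      using r s p(1) by (simp add: mult_mat_def nf_box)
    moreover have "mult_mat n a p $$ (r, s) = 0" using p(2) r s by simp
    ultimately show ?thesis by simp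
  qed (use p in \<open>auto simp: in_keys_iff\<close>)
qed

interpretation mult_mat_eval: evaluation "fact_mat_ring n :: 'a mat ring" n "scalar n" "\<lambda>i. mult_mat n a (mvar i)"
proof (intro evaluation.intro ring_fact_mat_ring evaluation_axioms.intro)
  note c = mpoly_carrier_mvar mpoly_carrier_mconst
  fix i j r assume i: "i \<in> {1..n}"
  show "mult_mat n a (mvar i) \<otimes>\<^bsub>fact_mat_ring n\<^esub> scalar n r = scalar n r \<otimes>\<^bsub>fact_mat_ring n\<^esub> mult_mat n a (mvar i)"
    using i centralD[OF central_mvar[of i], of "mconst r"]
    by (simp add: ring_mat_simps c mult_mat_mconst[symmetric] mult_mat_mult[symmetric])
  assume "j \<in> {1..n}"
  then show "mult_mat n a (mvar i) \<otimes>\<^bsub>fact_mat_ring n\<^esub> mult_mat n a (mvar j) =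
      mult_mat n a (mvar j) \<otimes>\<^bsub>fact_mat_ring n\<^esub> mult_mat n a (mvar i)"
    using i arg_cong[OF centralD[OF central_mvar[of i], of "mvar j"], of "mult_mat n a"]
    by (simp add: ring_mat_simps c mult_mat_mult)
qed (auto simp: ring_mat_simps scalar_add scalar_mult scalar_1 mult_mat_carrier)

lemma mult_mat_eq_eval:
  "p \<in> carrier (mpoly_ring n) \<Longrightarrow> mult_mat n a p = mult_mat_eval.ev p"
  by (rule mult_mat_eval.ev_unique[OF mult_mat_ring_hom mult_mat_mconst]) auto

lemma mat_monomial_mult_mat:
  "mat_monomial n (\<lambda>i. mult_mat n a (mvar i)) \<alpha> = mult_mat n a (xmon (expo n \<alpha>))"
proof -
  have "mat_monomial n (\<lambda>i. mult_mat n a (mvar i)) \<alpha> = mult_mat_eval.mpow (expo n \<alpha>)"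
    unfolding mat_monomial_def mult_mat_eval.mpow_def
    by (rule mult_mat_eval.ordered_prod_cong) (simp add: lookup_expo)
  also have "\<dots> = mult_mat_eval.ev (xmon (expo n \<alpha>))"
    by (simp add: mult_mat_eval.ev_single mult_mat_eval.psi_1)
  also have "\<dots> = mult_mat n a (xmon (expo n \<alpha>))"
    by (rule mult_mat_eq_eval[symmetric], rule mpoly_carrier_single)
      (auto simp: in_keys_iff lookup_expo split: if_splits)
  finally show ?thesis .
qed

lemma mult_mat_splitting_matrices: "splitting_matrices n a (\<lambda>i. mult_mat n a (mvar i))"
  unfolding splitting_matrices_def
proof (intro conjI ballI allI impI)
  let ?A = "\<lambda>i. mult_mat n a (mvar i)"
  fix i assume i: "i \<in> {1..n}"
  show "?A i \<in> carrier_mat (fact n) (fact n)" by (rule mult_mat_carrier)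
  show "?A i * scalar n r = scalar n r * ?A i" for r
    using mult_mat_eval.x_psi_commute[OF i] by (simp add: ring_mat_simps)
  show "?A i * ?A j = ?A j * ?A i" if "j \<in> {1..n}" for j
    using mult_mat_eval.x_commute[OF i that] by (simp add: ring_mat_simps)
  have "esym n n i - mconst (a i) \<in> splitting_ideal n a" using i by (rule splitting_ideal_gen)
  then have "mult_mat n a (esym n n i) = mult_mat n a (mconst (a i))"
    using mult_mat_add[of "esym n n i - mconst (a i)" "mconst (a i)"] mult_mat_carrier[of "mconst (a i)"]
    by (simp add: mult_mat_splitting_ideal mpoly_carrier_diff mpoly_carrier_mconst esym_carrier)
  then show "elem_sym (fact_mat_ring n) n i ?A = scalar n (a i)"
    using mult_mat_eval.ev_esym[of i] by (simp add: mult_mat_mconst mult_mat_eq_eval[symmetric] esym_carrier)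
  fix r s assume rs: "r < fact n" "s < fact n" and nz: "?A i $$ (r, s) \<noteq> 0"
  let ?p = "mvar i * xmon (box_enum n s) :: 'a mpoly"
  obtain g where g: "g \<in> good n a n" "?p - g \<in> splitting_ideal n a"
    using reduce_mvar_mult[OF i box_enum_in_box[OF rs(2)], of a] by blast
  \<comment> \<open>Uniqueness identifies the representative with controlled coefficients with the
    column that defines the matrix.\<close>
  have "nf n a ?p = g"
    using i g box_enum_in_box[OF rs(2)]
    by (intro nf_eqI[OF cent] mpoly_carrier_mult mpoly_carrier_mvar box_subset_carrier) (auto simp: good_def)
  then have "?A i $$ (r, s) \<in> coeffs_upto_sign n a"
    using g(1) rs by (auto simp: mult_mat_def good_def)
  then obtain j where "j \<le> n" "?A i $$ (r, s) = signed_coeff n a j \<or> ?A i $$ (r, s) = - signed_coeff n a j"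
    using nz by (auto simp: coeffs_upto_sign_def)
  then show "\<exists>d\<le>n. ?A i $$ (r, s) = up_ring.coeff (UP base_ring) (signed_poly n a) d \<or>
      ?A i $$ (r, s) = - up_ring.coeff (UP base_ring) (signed_poly n a) d"
    by (intro exI[of _ "n - j"]) (simp add: coeff_signed_poly)
next
  let ?A = "\<lambda>i. mult_mat n a (mvar i)"
  let ?B = "\<Pi>\<^sub>E i\<in>{1..n}. {0..n - i}"
  fix c :: "(nat \<Rightarrow> nat) \<Rightarrow> 'a" and \<alpha>
  assume z: "(\<Oplus>\<^bsub>fact_mat_ring n\<^esub>\<alpha>\<in>?B. c \<alpha> \<cdot>\<^sub>m mat_monomial n ?A \<alpha>) = 0\<^sub>m (fact n) (fact n)"
    and \<alpha>: "\<alpha> \<in> ?B"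
  have fin: "finite ?B" by (simp add: finite_PiE)
  have box: "expo n \<beta> \<in> box n n" if "\<beta> \<in> ?B" for \<beta>
    using bij_betwE[OF bij_betw_expo] that by blast
  \<comment> \<open>The coefficient family becomes one polynomial supported in the box, and the
    linear relation becomes the vanishing of its multiplication matrix.\<close>
  define p where "p = (\<Sum>\<beta>\<in>?B. sgl (expo n \<beta>) (c \<beta>))"
  have pc: "sgl (expo n \<beta>) (c \<beta>) \<in> carrier (mpoly_ring n)" if "\<beta> \<in> ?B" for \<beta>
    using box[OF that] by (intro mpoly_carrier_single) (auto simp: box_def)
  interpret h: ring_hom_ring "mpoly_ring n" "fact_mat_ring n" "mult_mat n a"
    by (rule ring_hom_ringI2[OF ring_mpoly_ring ring_fact_mat_ring mult_mat_ring_hom])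
  let ?g = "\<lambda>\<beta>. sgl (expo n \<beta>) (c \<beta>)"
  have "finsum (mpoly_ring n) ?g ?B = p"
    unfolding p_def by (rule finsum_mpoly_ring) (use pc in blast)
  moreover have "mult_mat n a (finsum (mpoly_ring n) ?g ?B) = finsum (fact_mat_ring n) (mult_mat n a \<circ> ?g) ?B"
    by (rule h.hom_finsum) (use pc in blast)
  ultimately have "mult_mat n a p = (\<Oplus>\<^bsub>fact_mat_ring n\<^esub>\<beta>\<in>?B. mult_mat n a (sgl (expo n \<beta>) (c \<beta>)))"
    by (simp only: o_def)
  also have "\<dots> = (\<Oplus>\<^bsub>fact_mat_ring n\<^esub>\<beta>\<in>?B. c \<beta> \<cdot>\<^sub>m mat_monomial n ?A \<beta>)"
  proof (rule mult_mat_eval.finsum_cong')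
    fix \<beta> assume \<beta>: "\<beta> \<in> ?B"
    show "mult_mat n a (sgl (expo n \<beta>) (c \<beta>)) = c \<beta> \<cdot>\<^sub>m mat_monomial n ?A \<beta>"
      unfolding single_eq[of "expo n \<beta>" "c \<beta>"] mat_monomial_mult_mat
      by (simp add: mult_mat_mult mpoly_carrier_mconst box_subset_carrier[OF box[OF \<beta>]] mult_mat_mconst
          scalar_mult_mat[OF mult_mat_carrier])
  qed (auto simp: ring_mat_simps mat_monomial_mult_mat mult_mat_carrier)
  finally have "mult_mat n a p = 0\<^sub>m (fact n) (fact n)" using z by simp
  moreover have lk: "lkp p m = (\<Sum>\<beta>\<in>?B. c \<beta> when expo n \<beta> = m)" for m
    by (simp add: p_def lookup_sum lookup_single)
  have "supp p \<subseteq> box n n"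
  proof
    fix m assume "m \<in> supp p"
    then have "(\<Sum>\<beta>\<in>?B. c \<beta> when expo n \<beta> = m) \<noteq> 0" by (simp add: in_keys_iff lk)
    then obtain \<beta> where "\<beta> \<in> ?B" "(c \<beta> when expo n \<beta> = m) \<noteq> 0" by (rule sum.not_neutral_contains_not_neutral)
    then show "m \<in> box n n" using box by auto
  qed
  ultimately have "p = 0" using mult_mat_box_eq_0 by blast
  moreover have "lkp p (expo n \<alpha>) = (\<Sum>\<beta>\<in>?B. if \<beta> = \<alpha> then c \<beta> else 0)"
    unfolding lk
    using bij_betw_imp_inj_on[OF bij_betw_expo[of n]] \<alpha> by (intro sum.cong) (auto simp: when_def dest: inj_onD)
  ultimately show "c \<alpha> = 0" using fin \<alpha> by simp
qed

end

section \<open>Universality\<close>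

text \<open>Modulo I_f, where evaluation vanishes, every polynomial is reduced. The target is left
  open so that the lemma serves both the matrices and the splitting field.\<close>

lemma (in evaluation) ev_kernel:
  assumes roots: "\<And>i. i \<in> {1..n} \<Longrightarrow> elem_sym S n i x = \<psi> (a i)"
    and indep: "\<And>r. supp r \<subseteq> box n n \<Longrightarrow> ev r = \<zero> \<Longrightarrow> r = 0"
  shows "a_kernel (mpoly_ring n) S ev = splitting_ideal n a"
proof
  show "splitting_ideal n a \<subseteq> a_kernel (mpoly_ring n) S ev"
    using mpoly_ideal_carrier[OF splitting_ideal_ideal] ev_splitting_ideal[OF roots]
    unfolding a_kernel_def' by blast
  show "a_kernel (mpoly_ring n) S ev \<subseteq> splitting_ideal n a"
  proof
    fix p assume "p \<in> a_kernel (mpoly_ring n) S ev"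
    then have p: "p \<in> carrier (mpoly_ring n)" "ev p = \<zero>" unfolding a_kernel_def' by auto
    obtain r where r: "supp r \<subseteq> box n n" "p - r \<in> splitting_ideal n a"
      using box_spanning[OF p(1)] by blast
    have "ev (p - r) = \<zero>" by (rule ev_splitting_ideal[OF roots r(2)])
    then have "ev (p - r + r) = ev r" unfolding ev_add by simp
    then have "ev r = \<zero>" using p(2) by simp
    then have "r = 0" by (rule indep[OF r(1)])
    then show "p \<in> splitting_ideal n a" using r by simp
  qed
qed

context
  fixes n :: nat and a :: "nat \<Rightarrow> 'a::ring_1" and A :: "nat \<Rightarrow> 'a mat"
  assumes A: "splitting_matrices n a A"
begin

lemma splitting_matrices_evaluation: "evaluation (fact_mat_ring n) n (scalar n) A"
  using A unfolding splitting_matrices_def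
  by (intro evaluation.intro ring_fact_mat_ring evaluation_axioms.intro)
    (auto simp: ring_mat_simps scalar_add scalar_mult scalar_1)

interpretation A: evaluation "fact_mat_ring n :: 'a mat ring" n "scalar n" A
  by (rule splitting_matrices_evaluation)

lemma splitting_matrices_ev_box:
  assumes r: "supp r \<subseteq> box n n" "A.ev r = 0\<^sub>m (fact n) (fact n)"
  shows "r = 0"
proof -
  let ?B = "\<Pi>\<^sub>E i\<in>{1..n}. {0..n - i}"
  have mono: "mat_monomial n A \<alpha> = A.mpow (expo n \<alpha>)" for \<alpha>
    unfolding mat_monomial_def A.mpow_def by (rule A.ordered_prod_cong) (simp add: lookup_expo)
  have mc: "A.mpow m \<in> carrier_mat (fact n) (fact n)" for m
    using A.mpow_closed[of m] by (simp add: ring_mat_simps)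
  let ?t = "\<lambda>m. scalar n (lkp r m) \<otimes>\<^bsub>fact_mat_ring n\<^esub> A.mpow m"
  have img: "expo n ` ?B = box n n" and inj: "inj_on (expo n) ?B"
    using bij_betw_expo[of n] by (auto simp: bij_betw_def)
  have "A.ev r = finsum (fact_mat_ring n) ?t (expo n ` ?B)"
    unfolding img by (rule A.ev_superset[OF finite_box r(1)])
  also have "\<dots> = (\<Oplus>\<^bsub>fact_mat_ring n\<^esub>\<alpha>\<in>?B. ?t (expo n \<alpha>))"
    by (rule A.finsum_reindex[OF _ inj]) auto
  also have "\<dots> = (\<Oplus>\<^bsub>fact_mat_ring n\<^esub>\<alpha>\<in>?B. lkp r (expo n \<alpha>) \<cdot>\<^sub>m mat_monomial n A \<alpha>)"
  proof (rule A.finsum_cong')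
    show "?t (expo n \<alpha>) = lkp r (expo n \<alpha>) \<cdot>\<^sub>m mat_monomial n A \<alpha>" for \<alpha>
      by (simp add: mono scalar_mult_mat[OF mc] ring_mat_simps)
  qed (auto simp: mono mc ring_mat_simps)
  finally have z: "(\<Oplus>\<^bsub>fact_mat_ring n\<^esub>\<alpha>\<in>?B. lkp r (expo n \<alpha>) \<cdot>\<^sub>m mat_monomial n A \<alpha>) = 0\<^sub>m (fact n) (fact n)"
    using r(2) by (simp only:)
  have "(\<Oplus>\<^bsub>fact_mat_ring n\<^esub>\<alpha>\<in>?B. c \<alpha> \<cdot>\<^sub>m mat_monomial n A \<alpha>) = 0\<^sub>m (fact n) (fact n) \<longrightarrow>
      (\<forall>\<alpha>\<in>?B. c \<alpha> = 0)" for c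
    by (rule A[unfolded splitting_matrices_def, THEN conjunct2, THEN conjunct2, THEN conjunct2,
          THEN conjunct1, THEN spec])
  from this[of "\<lambda>\<alpha>. lkp r (expo n \<alpha>)"] z have "\<forall>\<alpha>\<in>?B. lkp r (expo n \<alpha>) = 0" by (rule mp)
  then have "lkp r m = 0" if "m \<in> box n n" for m
    using that unfolding img[symmetric] by (elim imageE) simp
  then show "r = 0" using r(1) by (intro poly_mapping_eqI) (auto simp: in_keys_iff)
qed

lemma splitting_matrices_roots: "i \<in> {1..n} \<Longrightarrow> elem_sym (fact_mat_ring n) n i A = scalar n (a i)"
  using A unfolding splitting_matrices_def by blast

lemma splitting_matrices_kernel:
  "a_kernel (mpoly_ring n) (fact_mat_ring n) A.ev = splitting_ideal n a"
  by (rule A.ev_kernel[OF splitting_matrices_roots])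
    (auto intro: splitting_matrices_ev_box simp: ring_mat_simps)

lemma splitting_matrices_image: "A.ev ` carrier (mpoly_ring n) = carrier (adjoin n A)"
  unfolding A.ev_image by (simp add: adjoin_def)

lemma splitting_matrices_universal: "universal_splitting_ring n a A"
  unfolding universal_splitting_ring_def
proof (intro conjI exI[of _ A.ev] allI impI ballI)
  show "extends_eval n A A.ev"
    by (simp add: extends_eval_def A.ev_ring_hom)
  show "h' p = A.ev p" if "extends_eval n A h'" "p \<in> carrier (mpoly_ring n)" for h' p
    using that by (intro A.ev_unique) (auto simp: extends_eval_def)
  have sub: "range (scalar n) \<union> A ` {1..n} \<subseteq> carrier (fact_mat_ring n)"
    using A.psi_closed A.x_closed by blast
  interpret B: ring "adjoin n A"
    unfolding adjoin_def by (rule A.generate_ring_is_ring[OF sub])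
  have s: "scalar n r \<in> carrier (adjoin n A)" for r
    by (auto simp: adjoin_def intro: generate_ring.incl)
  have Ac: "A i \<in> carrier (adjoin n A)" if "i \<in> {1..n}" for i
    using that by (auto simp: adjoin_def intro: generate_ring.incl)
  \<comment> \<open>As the inclusion is a homomorphism, elementary symmetric polynomials computed in
    the subring agree with those in the full matrix ring.\<close>
  have "id \<in> ring_hom (adjoin n A) (fact_mat_ring n)"
  proof (rule ring_hom_memI)
    show "id y \<in> carrier (fact_mat_ring n)" if "y \<in> carrier (adjoin n A)" for y
      using that A.generate_ring_in_carrier[OF sub] by (simp add: adjoin_def)
  qed (auto simp: adjoin_def)
  from B.elem_sym_hom[OF A.ring_axioms this, where x = A and k = n] Ac
  have "elem_sym (adjoin n A) n i A = scalar n (a i)" if "i \<in> {1..n}" for i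
    using splitting_matrices_roots[OF that] by simp
  moreover have "scalar n 1 = \<one>\<^bsub>adjoin n A\<^esub>" "scalar n (r + t) = scalar n r \<oplus>\<^bsub>adjoin n A\<^esub> scalar n t" for r t
    by (simp_all add: adjoin_def ring_mat_simps scalar_1 scalar_add)
  ultimately show "splits_as base_ring (signed_poly n a) (adjoin n A) (scalar n) n A"
    using s Ac by (subst B.splits_as_signed_poly_iff) auto
qed (simp_all only: splitting_matrices_image splitting_matrices_kernel)

end

text \<open>Sending \<open>f p\<close> to \<open>g p\<close> is well defined and injective because
  \<open>f\<close> and \<open>g\<close> identify the same pairs: both images are the same quotient
  of \<open>R\<close>, which need not be formed.\<close>

lemma ring_iso_of_equal_kernels:
  assumes "ring R" "ring S" "ring T"
    and f: "f \<in> ring_hom R S" and g: "g \<in> ring_hom R T"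
    and ker: "\<And>p. p \<in> carrier R \<Longrightarrow> f p = \<zero>\<^bsub>S\<^esub> \<longleftrightarrow> g p = \<zero>\<^bsub>T\<^esub>"
    and surj: "g ` carrier R = carrier T"
  shows "\<exists>h\<in>ring_iso (S\<lparr>carrier := f ` carrier R\<rparr>) T. \<forall>p\<in>carrier R. h (f p) = g p"
proof -
  interpret R: ring R by fact
  interpret f: ring_hom_ring R S f using assms by (intro ring_hom_ringI2)
  interpret g: ring_hom_ring R T g using assms by (intro ring_hom_ringI2)
  define h where "h y = g (SOME p. p \<in> carrier R \<and> f p = y)" for y
  have eq: "f p = f q \<longleftrightarrow> g p = g q" if "p \<in> carrier R" "q \<in> carrier R" for p q
  proof -
    have "f p = f q \<longleftrightarrow> f (p \<ominus>\<^bsub>R\<^esub> q) = \<zero>\<^bsub>S\<^esub>"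
      using that f.S.r_right_minus_eq[of "f p" "f q"] by (simp add: a_minus_def)
    also have "\<dots> \<longleftrightarrow> g (p \<ominus>\<^bsub>R\<^esub> q) = \<zero>\<^bsub>T\<^esub>" using that by (intro ker) simp
    also have "\<dots> \<longleftrightarrow> g p = g q"
      using that g.S.r_right_minus_eq[of "g p" "g q"] by (simp add: a_minus_def)
    finally show ?thesis .
  qed
  have h: "h (f p) = g p" if "p \<in> carrier R" for p
  proof -
    have "(SOME q. q \<in> carrier R \<and> f q = f p) \<in> carrier R \<and> f (SOME q. q \<in> carrier R \<and> f q = f p) = f p"
      by (rule someI[of _ p]) (use that in simp)
    then show ?thesis using eq that unfolding h_def by blast
  qed
  have "h \<in> ring_iso (S\<lparr>carrier := f ` carrier R\<rparr>) T"
  proof (rule ring_iso_memI)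
    show "bij_betw h (carrier (S\<lparr>carrier := f ` carrier R\<rparr>)) (carrier T)"
      unfolding bij_betw_def
    proof
      show "inj_on h (carrier (S\<lparr>carrier := f ` carrier R\<rparr>))"
        using eq by (intro inj_onI) (auto simp: h)
      show "h ` carrier (S\<lparr>carrier := f ` carrier R\<rparr>) = carrier T"
        using surj h by (auto simp: image_image)
    qed
    fix y z assume "y \<in> carrier (S\<lparr>carrier := f ` carrier R\<rparr>)" "z \<in> carrier (S\<lparr>carrier := f ` carrier R\<rparr>)"
    then obtain p q where pq: "p \<in> carrier R" "q \<in> carrier R" "y = f p" "z = f q" by auto
    show "h (y \<otimes>\<^bsub>S\<lparr>carrier := f ` carrier R\<rparr>\<^esub> z) = h y \<otimes>\<^bsub>T\<^esub> h z"
      using pq h[of "p \<otimes>\<^bsub>R\<^esub> q"] by (simp add: h)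
    show "h (y \<oplus>\<^bsub>S\<lparr>carrier := f ` carrier R\<rparr>\<^esub> z) = h y \<oplus>\<^bsub>T\<^esub> h z"
      using pq h[of "p \<oplus>\<^bsub>R\<^esub> q"] by (simp add: h)
  next
    show "h \<one>\<^bsub>S\<lparr>carrier := f ` carrier R\<rparr>\<^esub> = \<one>\<^bsub>T\<^esub>" using h[of "\<one>\<^bsub>R\<^esub>"] by simp
  qed (auto simp: h)
  then show ?thesis using h by blast
qed

section \<open>Splitting fields with full symmetric Galois group\<close>

lemma (in ring) list_eval_map_rev:
  assumes "\<And>i. i < m \<Longrightarrow> c i \<in> carrier R" "y \<in> carrier R"
  shows "ring.eval R (map c (rev [0..<m])) y = (\<Oplus>i\<in>{..<m}. c i \<otimes> y [^] i)"
  using assms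
proof (induction m)
  case (Suc m)
  then have c: "c m \<in> carrier R" "\<And>i. i < m \<Longrightarrow> c i \<in> carrier R" by auto
  have "ring.eval R (map c (rev [0..<Suc m])) y = c m \<otimes> y [^] m \<oplus> (\<Oplus>i\<in>{..<m}. c i \<otimes> y [^] i)"
    using Suc.IH[OF c(2) \<open>y \<in> carrier R\<close>] by simp
  also have "\<dots> = (\<Oplus>i\<in>{..<Suc m}. c i \<otimes> y [^] i)"
    using c \<open>y \<in> carrier R\<close> unfolding lessThan_Suc by (subst finsum_insert) auto
  finally show ?case .
qed simp

lemma (in field) coeffs_eq_0_of_many_roots:
  assumes c: "\<And>i. i \<le> d \<Longrightarrow> c i \<in> carrier R" and T: "T \<subseteq> carrier R" "finite T" "d < card T"
    and roots: "\<And>t. t \<in> T \<Longrightarrow> (\<Oplus>i\<in>{..<Suc d}. c i \<otimes> t [^] i) = \<zero>" and i: "i \<le> d"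
  shows "c i = \<zero>"
proof -
  define p where "p = map c (rev [0..<Suc d])"
  \<comment> \<open>The top coefficients may vanish, whereas list polynomials need a non-zero head;
    an empty normalization means that all coefficients are zero.\<close>
  define q where "q = normalize p"
  have p: "set p \<subseteq> carrier R" unfolding p_def using c by (auto simp del: upt_Suc)
  have q: "q \<in> carrier (poly_ring R)"
    using normalize_gives_polynomial[OF p] unfolding q_def by (simp add: univ_poly_carrier)
  have ev: "ring.eval R q t = \<zero>" if "t \<in> T" for t
  proof -
    have t: "t \<in> carrier R" using that T by blast
    have "ring.eval R q t = ring.eval R p t" unfolding q_def by (rule eval_normalize[OF p t])
    also have "\<dots> = (\<Oplus>i\<in>{..<Suc d}. c i \<otimes> t [^] i)"
      unfolding p_def by (rule list_eval_map_rev) (use c t in auto)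
    finally show ?thesis using roots[OF that] by simp
  qed
  have "q = []"
  proof (rule ccontr)
    assume "q \<noteq> []"
    then have "T \<subseteq> set_mset (roots q)"
      using ev T unfolding subset_iff roots_mem_iff_is_root[OF q] is_root_def by blast
    then have "card T \<le> card (set_mset (roots q))" by (intro card_mono) auto
    also have "\<dots> = (\<Sum>t\<in>set_mset (roots q). 1)" by simp
    also have "\<dots> \<le> (\<Sum>t\<in>set_mset (roots q). count (roots q) t)"
      by (rule sum_mono) (simp add: Suc_le_eq)
    also have "\<dots> = size (roots q)" by (simp add: size_multiset_overloaded_eq)
    also have "\<dots> \<le> length q - 1" by (rule size_roots_le_degree[OF q])
    also have "\<dots> \<le> d" using normalize_length_le[of p] by (simp add: q_def p_def del: upt_Suc)
    finally show False using T by simp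
  qed
  then have "p = replicate (length p) \<zero>" using normalize_trick[of p] by (simp add: q_def)
  moreover have "c i \<in> set p" unfolding p_def using i by (auto simp del: upt_Suc)
  ultimately show ?thesis by (metis in_set_replicate)
qed

lemma ordered_prod_hom:
  assumes "Group.monoid G" "Group.monoid H" "h \<in> hom G H" "h \<one>\<^bsub>G\<^esub> = \<one>\<^bsub>H\<^esub>"
    and "\<And>i. i \<in> {1..k} \<Longrightarrow> x i \<in> carrier G"
  shows "h (ordered_prod G k x) = ordered_prod H k (\<lambda>i. h (x i))"
  using assms(5)
proof (induction k)
  case (Suc k)
  have c: "ordered_prod G k x \<in> carrier G"
    by (rule monoid.ordered_prod_closed[OF assms(1)]) (use Suc.prems in auto)
  have "h (ordered_prod G (Suc k) x) = h (ordered_prod G k x) \<otimes>\<^bsub>H\<^esub> h (x (Suc k))"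
    using monoid.ordered_prod_Suc[OF assms(1), where x = x and k = k] Suc.prems hom_mult[OF assms(3) c] by simp
  also have "\<dots> = ordered_prod H (Suc k) (\<lambda>i. h (x i))"
    using Suc hom_in_carrier[OF assms(3)] by (subst monoid.ordered_prod_Suc[OF assms(2)]) auto
  finally show ?case .
qed (use assms in simp)

lemma (in domain) ordered_prod_eq_0:
  "(\<And>i. i \<in> {1..k} \<Longrightarrow> x i \<in> carrier R) \<Longrightarrow> ordered_prod R k x = \<zero> \<longleftrightarrow> (\<exists>i\<in>{1..k}. x i = \<zero>)"
proof (induction k)
  case (Suc k)
  have c: "ordered_prod R k x \<in> carrier R"
    by (rule ordered_prod_closed) (use Suc.prems in auto)
  have IH: "ordered_prod R k x = \<zero> \<longleftrightarrow> (\<exists>i\<in>{1..k}. x i = \<zero>)" by (rule Suc.IH) (use Suc.prems in auto)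
  have "ordered_prod R (Suc k) x = ordered_prod R k x \<otimes> x (Suc k)"
    by (rule ordered_prod_Suc) (rule Suc.prems)
  moreover have "x (Suc k) \<in> carrier R" using Suc.prems by auto
  moreover have "{1..Suc k} = insert (Suc k) {1..k}" by auto
  ultimately show ?case using c IH by (auto simp: integral_iff)
qed simp

section \<open>Products of linear factors over a domain\<close>

context domain
begin

lemma eval_prod_linear_factors:
  assumes x: "\<And>i. i \<in> {1..n} \<Longrightarrow> x i \<in> carrier R" and y: "y \<in> carrier R"
  shows "UnivPoly.eval R R id y (ordered_prod (UP R) n
      (\<lambda>i. up_ring.monom (UP R) \<one> 1 \<ominus>\<^bsub>UP R\<^esub> up_ring.monom (UP R) (x i) 0)) =
    ordered_prod R n (\<lambda>i. y \<ominus> x i)"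
proof -
  interpret E: UP_pre_univ_prop R R id "UP R"
    using UP_pre_univ_propI[OF is_cring is_cring id_ring_hom] by simp
  let ?ev = "UnivPoly.eval R R id y"
  interpret ev: ring_hom_ring "UP R" R ?ev
    by (rule ring_hom_ringI2[OF E.P.ring_axioms ring_axioms E.eval_ring_hom[OF y]])
  let ?l = "\<lambda>i. up_ring.monom (UP R) \<one> 1 \<ominus>\<^bsub>UP R\<^esub> up_ring.monom (UP R) (x i) 0"
  have l: "?ev (?l i) = y \<ominus> x i" if "i \<in> {1..n}" for i
  proof -
    have "?ev (up_ring.monom (UP R) \<one> 1) = y" by (rule E.eval_monom1[OF y])
    moreover have "?ev (up_ring.monom (UP R) (x i) 0) = x i"
      using E.eval_const[OF y x[OF that]] by simp
    ultimately show ?thesis using x[OF that] by (simp add: a_minus_def)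
  qed
  have "?ev (ordered_prod (UP R) n ?l) = ordered_prod R n (\<lambda>i. ?ev (?l i))"
  proof (rule ordered_prod_hom[where h = ?ev and x = ?l])
    show "?ev \<in> hom (UP R) R" by (auto simp: hom_def)
  qed (use x in \<open>auto intro: E.P.monoid_axioms monoid_axioms\<close>)
  also have "\<dots> = ordered_prod R n (\<lambda>i. y \<ominus> x i)" by (rule ordered_prod_cong) (rule l)
  finally show ?thesis .
qed

text \<open>The two products have the same coefficients, so the one built from \<open>x\<close>
  vanishes at \<open>y j\<close>, and in a domain some factor is zero. It serves twice: to see that
  automorphisms permute the roots, and to carry separability from one list of roots to
  another.\<close>

lemma splits_as_root:
  assumes x: "splits_as F f R \<phi> n x" and y: "splits_as F f R \<phi> n y" and j: "j \<in> {1..n}"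
  shows "y j \<in> x ` {1..n}"
proof -
  interpret P: UP_ring R "UP R" by unfold_locales simp
  define P where "P z = ordered_prod (UP R) n
    (\<lambda>i. up_ring.monom (UP R) \<one> 1 \<ominus>\<^bsub>UP R\<^esub> up_ring.monom (UP R) (z i) 0)" for z
  have c: "\<And>i. i \<in> {1..n} \<Longrightarrow> x i \<in> carrier R" "\<And>i. i \<in> {1..n} \<Longrightarrow> y i \<in> carrier R"
    using x y by (auto simp: splits_as_def)
  have Pc: "P x \<in> carrier (UP R)" "P y \<in> carrier (UP R)"
    unfolding P_def by (rule P.P.ordered_prod_closed; use c in simp)+
  have "up_ring.coeff (UP R) (P x) d = up_ring.coeff (UP R) (P y) d" for d
    using x y unfolding splits_as_def P_def by metis
  then have "P x = P y" using P.up_eqI Pc by blast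
  then have "ordered_prod R n (\<lambda>i. y j \<ominus> x i) = ordered_prod R n (\<lambda>i. y j \<ominus> y i)"
    using eval_prod_linear_factors[where n = n and x = x, OF c(1) c(2)[OF j]]
      eval_prod_linear_factors[where n = n and x = y, OF c(2) c(2)[OF j]]
    by (simp add: P_def)
  moreover have "ordered_prod R n (\<lambda>i. y j \<ominus> y i) = \<zero>"
    using c j by (subst ordered_prod_eq_0) (auto intro!: bexI[of _ j] simp: a_minus_def r_neg)
  ultimately have "\<exists>i\<in>{1..n}. y j \<ominus> x i = \<zero>"
    using c j by (subst ordered_prod_eq_0[symmetric]) auto
  then show ?thesis using c j by (auto simp: r_right_minus_eq)
qed

text \<open>Provides the equation that makes each root algebraic in
  \<open>splitting_image\<close>.\<close>

lemma splits_as_eval_0: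
  assumes x: "splits_as F f R \<phi> n x" and j: "j \<in> {1..n}"
  shows "(\<Oplus>i\<in>{..<Suc n}. \<phi> (up_ring.coeff (UP F) f i) \<otimes> x j [^] i) = \<zero>"
proof -
  interpret P: UP_cring R "UP R" by unfold_locales simp
  define P where "P = ordered_prod (UP R) n
    (\<lambda>i. up_ring.monom (UP R) \<one> 1 \<ominus>\<^bsub>UP R\<^esub> up_ring.monom (UP R) (x i) 0)"
  have c: "\<And>i. i \<in> {1..n} \<Longrightarrow> x i \<in> carrier R" using x by (auto simp: splits_as_def)
  have Pc: "P \<in> carrier (UP R)"
    unfolding P_def by (rule P.P.ordered_prod_closed) (use c in simp)
  have co: "\<phi> (up_ring.coeff (UP F) f d) = up_ring.coeff (UP R) P d" for d
    using x by (simp add: splits_as_def P_def)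
  have "up_ring.coeff (UP R) P m = \<zero>" if "n < m" for m
    unfolding P_def using that c by (subst coeff_prod_linear_factors) auto
  then have deg: "deg R P \<le> n" using Pc by (intro P.deg_aboveI) auto
  have "UnivPoly.eval R R id (x j) P = (\<Oplus>i\<in>{..deg R P}. up_ring.coeff (UP R) P i \<otimes> x j [^] i)"
    using P.eval_on_carrier[OF Pc, of R id "x j"] by simp
  also have "\<dots> = (\<Oplus>i\<in>{..<Suc n}. up_ring.coeff (UP R) P i \<otimes> x j [^] i)"
    using deg c[OF j] P.coeff_closed[OF Pc] P.deg_aboveD[OF _ Pc]
    by (intro add.finprod_mono_neutral_cong_left) auto
  finally have "(\<Oplus>i\<in>{..<Suc n}. up_ring.coeff (UP R) P i \<otimes> x j [^] i) = ordered_prod R n (\<lambda>i. x j \<ominus> x i)"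
    using eval_prod_linear_factors[where n = n and x = x, OF c c[OF j]] by (simp add: P_def)
  also have "\<dots> = \<zero>"
    using c j by (subst ordered_prod_eq_0) (auto intro!: bexI[of _ j] simp: a_minus_def r_neg)
  finally show ?thesis by (simp only: co)
qed

end

section \<open>Reduced polynomials vanishing at all injective choices of roots\<close>

lemma box_mono: "k \<le> n \<Longrightarrow> box n k \<subseteq> box n n"
proof
  fix m assume k: "k \<le> n" and m: "m \<in> box n k"
  have "lkp m i \<le> n - i" if "i \<in> {1..n}" for i
  proof (cases "i \<le> k")
    case False
    then have "i \<notin> supp m" using m by (auto simp: box_def)
    then show ?thesis by (simp add: in_keys_iff)
  qed (use m that in \<open>simp add: box_def\<close>)
  moreover have "{1..k} \<subseteq> {1..n}" using k by auto
  ultimately show "m \<in> box n n" using m by (auto simp: box_def)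
qed

lemma box_Suc_eq:
  "k < n \<Longrightarrow> box n (Suc k) = (\<Union>b\<in>{..<Suc (n - Suc k)}. (\<lambda>m. m + sgl (Suc k) b) ` box n k)"
proof (intro equalityI subsetI)
  fix m assume m: "m \<in> box n (Suc k)"
  show "m \<in> (\<Union>b\<in>{..<Suc (n - Suc k)}. (\<lambda>m. m + sgl (Suc k) b) ` box n k)"
    using box_Suc[OF m] update_0_add_single[of "Suc k" m, symmetric] by (auto simp: less_Suc_eq_le)
next
  fix m assume "k < n" "m \<in> (\<Union>b\<in>{..<Suc (n - Suc k)}. (\<lambda>m. m + sgl (Suc k) b) ` box n k)"
  then obtain b l where l: "m = l + sgl (Suc k) b" "b \<le> n - Suc k" "l \<in> box n k" by auto
  then have "lkp l (Suc k) = 0" by (auto simp: box_def in_keys_iff)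
  then show "m \<in> box n (Suc k)"
    using l by (auto simp: box_def exps_add lookup_add lookup_single when_def le_Suc_eq)
qed

text \<open>Peel off the last variable: once \<open>X\<^sub>1, \<dots>, X\<^sub>k\<close> are fixed, \<open>X\<^sub>k\<^sub>+\<^sub>1\<close> has degree at most
  \<open>n - k - 1\<close> but still takes \<open>n - k\<close> values.\<close>

lemma (in field) box_sum_vanish:
  assumes inj: "inj_on x {1..n}" and xc: "\<And>i. i \<in> {1..n} \<Longrightarrow> x i \<in> carrier R"
  shows "k \<le> n \<Longrightarrow> (\<And>m. m \<in> box n k \<Longrightarrow> c m \<in> carrier R) \<Longrightarrow>
    (\<And>\<sigma>. inj_on \<sigma> {1..k} \<Longrightarrow> \<sigma> ` {1..k} \<subseteq> {1..n} \<Longrightarrow>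
      (\<Oplus>m\<in>box n k. c m \<otimes> ordered_prod R k (\<lambda>i. x (\<sigma> i) [^] lkp m i)) = \<zero>) \<Longrightarrow>
    m \<in> box n k \<Longrightarrow> c m = \<zero>"
proof (induction k arbitrary: c m)
  case 0
  have box: "box n 0 = {0}" by (auto simp: box_def)
  show ?case using 0(3)[of id] 0(2)[of 0] 0(4) by (simp add: box finsum_insert)
next
  case (Suc k)
  let ?d = "n - Suc k"
  let ?P = "\<lambda>\<sigma> (m :: nat \<Rightarrow>\<^sub>0 nat). ordered_prod R k (\<lambda>i. x (\<sigma> i) [^] lkp m i)"
  let ?e = "\<lambda>b m. m + sgl (Suc k) b"
  have kn: "k < n" using Suc.prems by simp
  have fin: "finite (box n k)" using finite_subset[OF box_mono finite_box] kn by simp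
  have cc: "c (?e b l) \<in> carrier R" if "b \<le> ?d" "l \<in> box n k" for b l
    using that by (intro Suc.prems(2)) (auto simp: box_Suc_eq[OF kn])
  have lke: "lkp (?e b l) (Suc k) = b" if "l \<in> box n k" for b l
  proof -
    have "lkp l (Suc k) = 0" using that by (auto simp: box_def in_keys_iff)
    then show ?thesis by (simp add: lookup_add)
  qed
  \<comment> \<open>The induction hypothesis is applied to the coefficient of X_(k+1)^b, separately
    for each \<open>b\<close>.\<close>
  have zero: "c (?e b l) = \<zero>" if b: "b \<le> ?d" and l: "l \<in> box n k" for b l
  proof (rule Suc.IH[of "\<lambda>l. c (?e b l)", OF _ _ _ l])
    fix \<sigma> assume \<sigma>: "inj_on \<sigma> {1..k}" "\<sigma> ` {1..k} \<subseteq> {1..n}"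
    define S where "S b = (\<Oplus>l\<in>box n k. c (?e b l) \<otimes> ?P \<sigma> l)" for b
    have "x (\<sigma> i) \<in> carrier R" if "i \<in> {1..k}" for i
      by (rule xc) (use that \<sigma>(2) in blast)
    then have Pc: "?P \<sigma> l \<in> carrier R" for l
      by (intro ordered_prod_closed nat_pow_closed)
    have Sc: "S b \<in> carrier R" if "b \<le> ?d" for b
      unfolding S_def using cc[OF that] Pc by (intro finsum_closed) auto
    define T where "T = x ` ({1..n} - \<sigma> ` {1..k})"
    have "card T = card ({1..n} - \<sigma> ` {1..k})"
      unfolding T_def by (rule card_image) (rule inj_on_subset[OF inj], blast)
    also have "\<dots> = n - k" using \<sigma> by (simp add: card_Diff_subset card_image)
    finally have cardT: "?d < card T" using kn by simp
    have "S b = \<zero>"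
    proof (rule coeffs_eq_0_of_many_roots[OF Sc _ _ cardT _ b])
      fix t assume "t \<in> T"
      then obtain j where j: "j \<in> {1..n}" "j \<notin> \<sigma> ` {1..k}" "t = x j" by (auto simp: T_def)
      have tc: "t \<in> carrier R" using j xc by simp
      define \<tau> where "\<tau> = \<sigma>(Suc k := j)"
      let ?t = "\<lambda>m. c m \<otimes> ordered_prod R (Suc k) (\<lambda>i. x (\<tau> i) [^] lkp m i)"
      have ins: "{1..Suc k} = insert (Suc k) {1..k}" by auto
      have \<tau>: "inj_on \<tau> {1..Suc k}" "\<tau> ` {1..Suc k} \<subseteq> {1..n}"
      proof -
        have "\<tau> ` {1..k} = \<sigma> ` {1..k}" by (rule image_cong) (simp_all add: \<tau>_def)
        moreover have "inj_on \<tau> {1..k}"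
          using \<sigma>(1) by (subst inj_on_cong[where g = \<sigma>]) (simp_all add: \<tau>_def)
        moreover have "\<tau> (Suc k) = j" by (simp add: \<tau>_def)
        ultimately show "inj_on \<tau> {1..Suc k}" "\<tau> ` {1..Suc k} \<subseteq> {1..n}"
          unfolding ins using \<sigma>(2) j(1,2) by simp_all
      qed
      have xt: "x (\<tau> i) \<in> carrier R" if "i \<in> {1..Suc k}" for i
        by (rule xc) (use that \<tau>(2) in blast)
      have tm: "?t (?e b l) = c (?e b l) \<otimes> ?P \<sigma> l \<otimes> t [^] b" if bl: "b \<le> ?d" "l \<in> box n k" for b l
      proof -
        have "ordered_prod R (Suc k) (\<lambda>i. x (\<tau> i) [^] lkp (?e b l) i) =
            ordered_prod R k (\<lambda>i. x (\<tau> i) [^] lkp (?e b l) i) \<otimes> x (\<tau> (Suc k)) [^] lkp (?e b l) (Suc k)"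
          by (rule ordered_prod_Suc) (intro nat_pow_closed xt)
        also have "ordered_prod R k (\<lambda>i. x (\<tau> i) [^] lkp (?e b l) i) = ?P \<sigma> l"
          by (rule ordered_prod_cong) (simp add: \<tau>_def lookup_add lookup_single when_def)
        also have "x (\<tau> (Suc k)) [^] lkp (?e b l) (Suc k) = t [^] b"
          using lke[OF bl(2)] by (simp add: \<tau>_def j)
        finally show ?thesis using cc[OF bl] Pc tc by (simp add: m_assoc)
      qed
      have tcl: "?t (?e b l) \<in> carrier R" if "b \<le> ?d" "l \<in> box n k" for b l
        using tm[OF that] cc[OF that] Pc tc by simp
      have "(\<Oplus>m\<in>box n (Suc k). ?t m) = \<zero>" by (rule Suc.prems(3)[OF \<tau>])
      moreover have "(\<Oplus>m\<in>box n (Suc k). ?t m) = (\<Oplus>b\<in>{..<Suc ?d}. finsum R ?t (?e b ` box n k))"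
        unfolding box_Suc_eq[OF kn]
      proof (rule add.finprod_UN_disjoint)
        show "pairwise (\<lambda>b b'. disjnt (?e b ` box n k) (?e b' ` box n k)) {..<Suc ?d}"
        proof (intro pairwiseI, unfold disjnt_iff, intro allI notI, elim conjE imageE)
          fix b b' m l l'
          assume "b \<noteq> b'" "l \<in> box n k" "l' \<in> box n k" "m = ?e b l" "m = ?e b' l'"
          then show False using lke[of l b] lke[of l' b'] by metis
        qed
      qed (use fin tcl in \<open>auto simp: less_Suc_eq_le\<close>)
      moreover have "\<dots> = (\<Oplus>b\<in>{..<Suc ?d}. S b \<otimes> t [^] b)"
      proof (rule finsum_cong')
        fix b assume "b \<in> {..<Suc ?d}"
        then have b: "b \<le> ?d" by simp
        have "finsum R ?t (?e b ` box n k) = (\<Oplus>l\<in>box n k. ?t (?e b l))"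
          by (rule finsum_reindex) (use tcl[OF b] in \<open>auto intro: inj_onI\<close>)
        also have "\<dots> = (\<Oplus>l\<in>box n k. c (?e b l) \<otimes> ?P \<sigma> l \<otimes> t [^] b)"
          by (rule finsum_cong') (use tm[OF b] cc[OF b] Pc tc in auto)
        also have "\<dots> = S b \<otimes> t [^] b"
          unfolding S_def by (rule finsum_ldistr[symmetric]) (use fin cc[OF b] Pc tc in auto)
        finally show "finsum R ?t (?e b ` box n k) = S b \<otimes> t [^] b" .
      qed (use Sc tc in auto)
      ultimately show "(\<Oplus>b\<in>{..<Suc ?d}. S b \<otimes> t [^] b) = \<zero>" by simp
    qed (auto simp: T_def xc)
    then show "(\<Oplus>l\<in>box n k. c (?e b l) \<otimes> ?P \<sigma> l) = \<zero>" by (simp add: S_def)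
  qed (use kn cc[OF b] in auto)
  show ?case using Suc.prems(4) zero by (auto simp: box_Suc_eq[OF kn] less_Suc_eq_le)
qed

section \<open>The Galois group acting on the roots\<close>

context
  fixes L :: "('l, 'm) ring_scheme" and n :: nat and a :: "nat \<Rightarrow> 'a::ring_1"
    and \<phi> :: "'a \<Rightarrow> 'l" and x :: "nat \<Rightarrow> 'l"
  assumes base: "field (base_ring :: 'a ring)" and L: "field L"
    and hom: "\<phi> \<in> ring_hom base_ring L"
    and splits: "splits_as base_ring (signed_poly n a) L \<phi> n x"
begin

interpretation L: field L by (rule L)

lemma splitting_hom:
  "\<phi> r \<in> carrier L" "\<phi> (r + s) = \<phi> r \<oplus>\<^bsub>L\<^esub> \<phi> s" "\<phi> (r * s) = \<phi> r \<otimes>\<^bsub>L\<^esub> \<phi> s" "\<phi> 1 = \<one>\<^bsub>L\<^esub>"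
  using ring_hom_closed[OF hom] ring_hom_add[OF hom] ring_hom_mult[OF hom] ring_hom_one[OF hom]
  by auto

lemma splits_iff:
  "splits_as base_ring (signed_poly n a) L \<phi> n y \<longleftrightarrow>
    (\<forall>i\<in>{1..n}. y i \<in> carrier L) \<and> (\<forall>i\<in>{1..n}. elem_sym L n i y = \<phi> (a i))"
  by (rule L.splits_as_signed_poly_iff) (rule splitting_hom)+

lemma splitting_root_closed: "i \<in> {1..n} \<Longrightarrow> x i \<in> carrier L"
  using splits splits_iff by blast

lemma splitting_evaluation: "(\<And>i. i \<in> {1..n} \<Longrightarrow> y i \<in> carrier L) \<Longrightarrow> evaluation L n \<phi> y"
  by (intro evaluation.intro L.ring_axioms evaluation_axioms.intro)
    (auto simp: splitting_hom L.m_comm)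

interpretation X: evaluation L n \<phi> x
  by (rule splitting_evaluation) (rule splitting_root_closed)

interpretation phi: ring_hom_ring base_ring L \<phi>
  by (rule ring_hom_ringI2[OF ring_base_ring L.ring_axioms hom])

text \<open>The roots are algebraic over the image of F, so adjoining them as a ring already gives a
  field, and the field they generate lies in the image of evaluation.\<close>

lemma splitting_image:
  assumes gen: "carrier L = generate_field L (\<phi> ` carrier base_ring \<union> x ` {1..n})"
  shows "X.ev ` carrier (mpoly_ring n) = carrier L"
proof -
  let ?K = "range \<phi>" and ?xs = "map x [1..<Suc n]"
  have K: "subfield ?K L"
    using phi.img_is_subfield(2)[OF field.carrier_is_subfield[OF base]] by simp
  have xs: "set ?xs = x ` {1..n}" by auto
  have xsc: "set ?xs \<subseteq> carrier L" unfolding xs using splitting_root_closed by blast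
  have sub: "subfield (L.finite_extension ?K ?xs) L"
  proof (rule L.finite_extension_is_subfield[OF K xsc])
    fix y assume "y \<in> set ?xs"
    then obtain j where j: "j \<in> {1..n}" "y = x j" unfolding xs by blast
    let ?c = "\<lambda>i. \<phi> (up_ring.coeff (UP base_ring) (signed_poly n a) i)"
    let ?p = "map ?c (rev [0..<Suc n])"
    have "polynomial\<^bsub>L\<^esub> ?K ?p"
    proof -
      have "set ?p \<subseteq> range \<phi>" unfolding set_map by blast
      moreover have "hd ?p = \<one>\<^bsub>L\<^esub>" by (simp add: coeff_signed_poly signed_coeff_def splitting_hom(4))
      ultimately show ?thesis using L.one_not_zero unfolding polynomial_def by metis
    qed
    then have p: "?p \<in> carrier (?K [X]\<^bsub>L\<^esub>)" by (simp only: univ_poly_carrier)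
    have "L.eval ?p y = (\<Oplus>\<^bsub>L\<^esub>i\<in>{..<Suc n}. ?c i \<otimes>\<^bsub>L\<^esub> y [^]\<^bsub>L\<^esub> i)"
      by (rule L.list_eval_map_rev) (use j splitting_root_closed splitting_hom(1) in auto)
    also have "\<dots> = \<zero>\<^bsub>L\<^esub>" unfolding j(2) by (rule L.splits_as_eval_0[OF splits j(1)])
    finally show "(L.algebraic over ?K) y" using p by (intro L.algebraicI[OF p]) auto
  qed
  have Kc: "?K \<subseteq> carrier L" using splitting_hom(1) by blast
  have "range \<phi> \<union> x ` {1..n} \<subseteq> L.finite_extension ?K ?xs"
    using L.finite_extension_incl[OF Kc xsc] L.finite_extension_mem[OF subfieldE(1)[OF K] xsc]
    unfolding xs by blast
  then have "carrier L \<subseteq> L.finite_extension ?K ?xs"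
    using L.generate_field_min_subfield1[OF _ sub, of "range \<phi> \<union> x ` {1..n}"] Kc xsc gen
    unfolding xs by simp
  also have "\<dots> \<subseteq> X.ev ` carrier (mpoly_ring n)"
  proof (rule L.finite_extension_subring_incl[OF X.ev_image_subring])
    show "?K \<subseteq> X.ev ` carrier (mpoly_ring n)"
      by (auto intro!: image_eqI[of _ _ "mconst _"] mpoly_carrier_mconst)
    show "set ?xs \<subseteq> X.ev ` carrier (mpoly_ring n)"
      unfolding xs by (auto intro!: image_eqI[of _ _ "mvar _"] mpoly_carrier_mvar)
  qed
  finally show ?thesis using X.ev_closed by blast
qed

text \<open>The abstract isomorphism does not tell how the group acts on the roots, but it fixes the
  order as n!. Each automorphism permutes the distinct roots and is determined by this permutation,
  since F and the roots generate L; an injection between finite sets of equal size is onto.\<close>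

lemma automorphism_of_permutation:
  assumes inj: "inj_on x {1..n}" and surj: "X.ev ` carrier (mpoly_ring n) = carrier L"
    and gal: "galois_group L (\<phi> ` carrier base_ring) \<cong> sym_group n"
    and \<pi>: "\<pi> permutes {1..n}"
  shows "\<exists>g\<in>ring_hom L L. (\<forall>r. g (\<phi> r) = \<phi> r) \<and> (\<forall>i\<in>{1..n}. g (x i) = x (\<pi> i))"
proof -
  define G where "G = carrier (galois_group L (\<phi> ` carrier base_ring))"
  have G: "g \<in> Bij (carrier L)" "g \<in> ring_hom L L" "g (\<phi> r) = \<phi> r" if "g \<in> G" for g r
    using that by (auto simp: G_def galois_group_def)
  obtain \<iota> where "bij_betw \<iota> G (carrier (sym_group n))"
    using gal unfolding is_iso_def iso_def G_def by blast
  moreover have "carrier (sym_group n) = {p. p permutes {1..n}}" by (simp add: sym_group_def)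
  ultimately have card: "card G = card {p. p permutes {1..n}}" and "finite G"
    using bij_betw_same_card bij_betw_finite finite_permutations[of "{1..n}"] by (metis, metis finite_atLeastAtMost)
  define s where "s g = (\<lambda>i. if i \<in> {1..n} then inv_into {1..n} x (g (x i)) else i)" for g
  have root: "g (x i) \<in> x ` {1..n}" if g: "g \<in> G" and i: "i \<in> {1..n}" for g i
  proof (rule L.splits_as_root[OF splits _ i])
    have "elem_sym L n i (\<lambda>j. g (x j)) = \<phi> (a i)" if "i \<in> {1..n}" for i
    proof -
      have "g (elem_sym L n i x) = elem_sym L n i (\<lambda>j. g (x j))"
        by (rule L.elem_sym_hom[OF L.ring_axioms G(2)[OF g] splitting_root_closed])
      then show ?thesis using splits splits_iff that G(3)[OF g] by metis
    qed
    then show "splits_as base_ring (signed_poly n a) L \<phi> n (\<lambda>j. g (x j))"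
      unfolding splits_iff using ring_hom_closed[OF G(2)[OF g]] splitting_root_closed by blast
  qed
  have xs: "x (s g i) = g (x i)" and si: "s g i \<in> {1..n}" if "g \<in> G" "i \<in> {1..n}" for g i
    using f_inv_into_f[OF root[OF that]] inv_into_into[OF root[OF that]] that(2) by (simp_all add: s_def)
  have perm: "s g permutes {1..n}" if g: "g \<in> G" for g
  proof (rule bij_imp_permutes)
    have "inj_on (s g) {1..n}"
    proof (rule inj_onI)
      fix i j assume ij: "i \<in> {1..n}" "j \<in> {1..n}" "s g i = s g j"
      then have "g (x i) = g (x j)" using xs[OF g] by metis
      moreover have "inj_on g (carrier L)" using G(1)[OF g] by (simp add: Bij_def bij_betw_def)
      ultimately have "x i = x j" using ij splitting_root_closed by (auto dest: inj_onD)
      then show "i = j" using ij inj by (auto dest: inj_onD)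
    qed
    moreover from this have "s g ` {1..n} = {1..n}"
      using si[OF g] by (intro endo_inj_surj) auto
    ultimately show "bij_betw (s g) {1..n} {1..n}" by (simp add: bij_betw_def)
  qed (simp only: s_def if_False)
  have "inj_on s G"
  proof (rule inj_onI)
    fix g h assume gh: "g \<in> G" "h \<in> G" "s g = s h"
    have "g (X.ev p) = h (X.ev p)" if "p \<in> carrier (mpoly_ring n)" for p
      using that
    proof (induction rule: mpoly_ring_induct)
      case (add p q)
      then show ?case
        using ring_hom_add[OF G(2)[OF gh(1)], of "X.ev p" "X.ev q"] ring_hom_add[OF G(2)[OF gh(2)], of "X.ev p" "X.ev q"]
        by (simp add: X.ev_add)
    next
      case (var i p)
      have "g (x i) = h (x i)" using xs[OF gh(1) var(1)] xs[OF gh(2) var(1)] gh(3) by simp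
      then show ?case
        using var ring_hom_mult[OF G(2)[OF gh(1)], of "x i" "X.ev p"] ring_hom_mult[OF G(2)[OF gh(2)], of "x i" "X.ev p"]
        by (simp add: X.ev_mult)
    qed (simp add: G(3)[OF gh(1)] G(3)[OF gh(2)])
    then have "g y = h y" if "y \<in> carrier L" for y
      using that unfolding surj[symmetric] by (elim imageE) (simp only:)
    \<comment> \<open>Elements of \<open>Bij\<close> are extensional, so agreement on the carrier
      gives equality of functions.\<close>
    then show "g = h"
      using G(1)[OF gh(1)] G(1)[OF gh(2)] by (intro extensionalityI[of g "carrier L" h] Bij_imp_extensional)
  qed
  then have "card (s ` G) = card {p. p permutes {1..n}}" using card by (simp add: card_image)
  moreover have "s ` G \<subseteq> {p. p permutes {1..n}}" using perm by (intro image_subsetI CollectI)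
  moreover have "finite {p. p permutes {1..n}}" by (intro finite_permutations finite_atLeastAtMost)
  ultimately have "s ` G = {p. p permutes {1..n}}" by (intro card_subset_eq)
  moreover have "\<pi> \<in> {p. p permutes {1..n}}" using \<pi> by (simp only: mem_Collect_eq)
  ultimately have "\<pi> \<in> s ` G" by (simp only:)
  then obtain g where g: "g \<in> G" "s g = \<pi>" by (elim imageE) simp
  show ?thesis
  proof (intro bexI[of _ g] conjI allI ballI)
    show "g \<in> ring_hom L L" "g (\<phi> r) = \<phi> r" for r using G(2,3)[OF g(1)] .
    show "g (x i) = x (\<pi> i)" if "i \<in> {1..n}" for i using xs[OF g(1) that] by (simp only: g(2))
  qed
qed

lemma splitting_ev_box:
  assumes inj: "inj_on x {1..n}"
    and aut: "\<And>\<pi>. \<pi> permutes {1..n} \<Longrightarrow>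
      \<exists>g\<in>ring_hom L L. (\<forall>r. g (\<phi> r) = \<phi> r) \<and> (\<forall>i\<in>{1..n}. g (x i) = x (\<pi> i))"
    and r: "supp r \<subseteq> box n n" "X.ev r = \<zero>\<^bsub>L\<^esub>"
  shows "r = 0"
proof -
  have "\<phi> (lkp r m) = \<zero>\<^bsub>L\<^esub>" if "m \<in> box n n" for m
  proof (rule L.box_sum_vanish[OF inj splitting_root_closed order_refl _ _ that])
    fix \<sigma> assume \<sigma>: "inj_on \<sigma> {1..n}" "\<sigma> ` {1..n} \<subseteq> {1..n}"
    \<comment> \<open>Outside \<open>{1..n}\<close> the map \<open>\<sigma>\<close> is arbitrary,
      whereas a permutation of that set has to be the identity there.\<close>
    define \<pi> where "\<pi> = (\<lambda>i. if i \<in> {1..n} then \<sigma> i else i)"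
    have "\<sigma> ` {1..n} = {1..n}" by (rule endo_inj_surj[OF finite_atLeastAtMost \<sigma>(2,1)])
    then have "bij_betw \<sigma> {1..n} {1..n}" using \<sigma>(1) by (simp only: bij_betw_def)
    then have "bij_betw \<pi> {1..n} {1..n}"
      by (subst bij_betw_cong[where g = \<sigma>]) (simp_all only: \<pi>_def if_True)
    then have "\<pi> permutes {1..n}" by (rule bij_imp_permutes) (simp only: \<pi>_def if_False)
    then obtain g where g: "g \<in> ring_hom L L" "\<And>r. g (\<phi> r) = \<phi> r" "\<And>i. i \<in> {1..n} \<Longrightarrow> g (x i) = x (\<pi> i)"
      using aut by blast
    have xp: "x (\<pi> i) \<in> carrier L" if "i \<in> {1..n}" for i
      using that \<sigma>(2) unfolding \<pi>_def by (intro splitting_root_closed) (simp only: if_True, blast)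
    interpret Y: evaluation L n \<phi> "\<lambda>i. x (\<pi> i)" by (rule splitting_evaluation) (rule xp)
    have gev: "g \<circ> X.ev \<in> ring_hom (mpoly_ring n) L" by (rule ring_hom_trans[OF X.ev_ring_hom g(1)])
    \<comment> \<open>Applying \<open>g\<close> after evaluation at \<open>x\<close> is evaluation
      at the permuted roots, so the vanishing is transported to every ordering.\<close>
    have "Y.ev r = (g \<circ> X.ev) r"
      by (rule Y.ev_unique[OF gev, symmetric]) (auto simp: g box_carrier[OF r(1)])
    also have "\<dots> = \<zero>\<^bsub>L\<^esub>"
      using r(2) ring_hom_zero[OF g(1) L.ring_axioms L.ring_axioms] by simp
    finally have "(\<Oplus>\<^bsub>L\<^esub>m\<in>box n n. \<phi> (lkp r m) \<otimes>\<^bsub>L\<^esub> Y.mpow m) = \<zero>\<^bsub>L\<^esub>"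
      using Y.ev_superset[OF finite_box r(1)] by simp
    moreover have "Y.mpow m = ordered_prod L n (\<lambda>i. x (\<sigma> i) [^]\<^bsub>L\<^esub> lkp m i)" for m
      unfolding Y.mpow_def by (rule L.ordered_prod_cong) (simp add: \<pi>_def)
    ultimately show "(\<Oplus>\<^bsub>L\<^esub>m\<in>box n n. \<phi> (lkp r m) \<otimes>\<^bsub>L\<^esub> ordered_prod L n (\<lambda>i. x (\<sigma> i) [^]\<^bsub>L\<^esub> lkp m i)) = \<zero>\<^bsub>L\<^esub>"
      by simp
  qed (simp_all only: splitting_hom)
  moreover have "inj \<phi>"
    using phi.img_is_subfield(1)[OF field.carrier_is_subfield[OF base]] by simp
  ultimately have "lkp r m = 0" if "m \<in> box n n" for m
    using that X.psi_0 injD[of \<phi> "lkp r m" 0] by simp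
  then show ?thesis using r(1) by (intro poly_mapping_eqI) (auto simp: in_keys_iff)
qed

end

section \<open>Identification with the splitting field\<close>

theorem adjoin_iso_splitting_field:
  fixes L :: "('l, 'm) ring_scheme" and a :: "nat \<Rightarrow> 'a::ring_1" and \<phi> :: "'a \<Rightarrow> 'l"
  assumes A: "splitting_matrices n a A"
    and base: "field (base_ring :: 'a ring)"
    and sf: "splitting_field base_ring n (signed_poly n a) L \<phi>"
    and sep: "separable_in base_ring n (signed_poly n a) L \<phi>"
    and gal: "galois_group L (\<phi> ` carrier base_ring) \<cong> sym_group n"
  shows "\<exists>h\<in>ring_iso (adjoin n A) L. \<forall>r. h (scalar n r) = \<phi> r"
proof -
  obtain x where L: "field L" and hom: "\<phi> \<in> ring_hom base_ring L"
    and x: "splits_as base_ring (signed_poly n a) L \<phi> n x"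
    and gen: "carrier L = generate_field L (\<phi> ` carrier base_ring \<union> x ` {1..n})"
    using sf unfolding splitting_field_def by blast
  obtain y where y: "splits_as base_ring (signed_poly n a) L \<phi> n y" "inj_on y {1..n}"
    using sep unfolding separable_in_def by blast
  interpret L: field L by (rule L)
  \<comment> \<open>The lists of roots in the two hypotheses may differ. All n distinct values of
    \<open>y\<close> occur in \<open>x\<close>, so \<open>x\<close> has no repetition
    either.\<close>
  have "y ` {1..n} \<subseteq> x ` {1..n}" using L.splits_as_root[OF x y(1)] by blast
  then have "card {1..n} \<le> card (x ` {1..n})"
    using card_mono[of "x ` {1..n}" "y ` {1..n}"] card_image[OF y(2)] by simp
  then have inj: "inj_on x {1..n}"
    using card_image_le[of "{1..n}" x] by (intro eq_card_imp_inj_on) auto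
  note ctx = base L hom x
  interpret X: evaluation L n \<phi> x
    by (rule splitting_evaluation[OF ctx]) (rule splitting_root_closed[OF ctx])
  interpret A: evaluation "fact_mat_ring n :: 'a mat ring" n "scalar n" A
    by (rule splitting_matrices_evaluation[OF A])
  have surj: "X.ev ` carrier (mpoly_ring n) = carrier L" by (rule splitting_image[OF ctx gen])
  have ker: "a_kernel (mpoly_ring n) L X.ev = splitting_ideal n a"
  proof (rule X.ev_kernel)
    show "elem_sym L n i x = \<phi> (a i)" if "i \<in> {1..n}" for i
      using x that splits_iff[OF ctx] by blast
    show "r = 0" if "supp r \<subseteq> box n n" "X.ev r = \<zero>\<^bsub>L\<^esub>" for r
      by (rule splitting_ev_box[OF ctx inj automorphism_of_permutation[OF ctx inj surj gal] that])
  qed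
  have "\<exists>h\<in>ring_iso ((fact_mat_ring n)\<lparr>carrier := A.ev ` carrier (mpoly_ring n)\<rparr>) L.
      \<forall>p\<in>carrier (mpoly_ring n). h (A.ev p) = X.ev p"
  proof (rule ring_iso_of_equal_kernels[OF ring_mpoly_ring A.ring_axioms L.ring_axioms
        A.ev_ring_hom X.ev_ring_hom _ surj])
    fix p :: "'a mpoly" assume "p \<in> carrier (mpoly_ring n)"
    then show "A.ev p = \<zero>\<^bsub>fact_mat_ring n\<^esub> \<longleftrightarrow> X.ev p = \<zero>\<^bsub>L\<^esub>"
      using ker splitting_matrices_kernel[OF A] unfolding a_kernel_def' by blast
  qed
  moreover have "(fact_mat_ring n)\<lparr>carrier := A.ev ` carrier (mpoly_ring n)\<rparr> = adjoin n A"
    unfolding A.ev_image by (simp add: adjoin_def)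
  ultimately obtain h where h: "h \<in> ring_iso (adjoin n A) L"
    "\<And>p. p \<in> carrier (mpoly_ring n) \<Longrightarrow> h (A.ev p) = X.ev p" by auto
  have "h (scalar n r) = \<phi> r" for r
    using h(2)[OF mpoly_carrier_mconst[of r]] by simp
  then show ?thesis using h(1) by blast
qed

theorem mainTheorem5:
  fixes n :: nat
    and a :: "nat \<Rightarrow> 'a::ring_1"
    and L :: "('l, 'm) ring_scheme"
    and \<phi> :: "'a \<Rightarrow> 'l"
  assumes "n \<ge> 1"
    and "\<forall>i\<in>{1..n}. \<forall>r. a i * r = r * a i"
  shows "(\<exists>A. splitting_matrices n a A) \<and>
    (\<forall>A. splitting_matrices n a A \<longrightarrow>
      universal_splitting_ring n a A \<and>
      (field (base_ring :: 'a ring) \<and>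
       ring_irreducible\<^bsub>UP base_ring\<^esub> (signed_poly n a) \<and>
       splitting_field base_ring n (signed_poly n a) L \<phi> \<and>
       separable_in base_ring n (signed_poly n a) L \<phi> \<and>
       galois_group L (\<phi> ` carrier base_ring) \<cong> sym_group n \<longrightarrow>
       (\<exists>h \<in> ring_iso (adjoin n A) L. \<forall>r. h (scalar n r) = \<phi> r)))"
proof (intro conjI allI impI)
  have "\<forall>i\<in>{1..n}. central (a i)" using assms(2) by (simp add: central_def)
  then show "\<exists>A. splitting_matrices n a A" using mult_mat_splitting_matrices by blast
  fix A assume A: "splitting_matrices n a A"
  show "universal_splitting_ring n a A" by (rule splitting_matrices_universal[OF A])
  assume "field (base_ring :: 'a ring) \<and>
       ring_irreducible\<^bsub>UP base_ring\<^esub> (signed_poly n a) \<and>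
       splitting_field base_ring n (signed_poly n a) L \<phi> \<and>
       separable_in base_ring n (signed_poly n a) L \<phi> \<and>
       galois_group L (\<phi> ` carrier base_ring) \<cong> sym_group n"
  then show "\<exists>h \<in> ring_iso (adjoin n A) L. \<forall>r. h (scalar n r) = \<phi> r"
    by (intro adjoin_iso_splitting_field[OF A]) simp_all
qed

end
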